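(* Let $K_{1,n}$ ($n\ge2$) be the star-graph group described in the context, with Carnot–Carathéodory distance $d$ from $o$, and write $x=(x_1,x_* )\in\mathbb R\times\mathbb R^n$. Then: (1) For every $g\in K_{1,n}$, $d(g)^2=\sup_{\tau\in\Omega_*}\phi(g;\tau)$. (2) The cut locus of $o$ is $\mathrm{Cut}_o=\mathbb M^c=\Big\{((0,x_* ),t):\ |x_*\cdot t|\le\frac{|x_*|^2}{\sqrt\pi}\sqrt{\big|t-\langle t,\tfrac{x_*}{|x_*|}\rangle\tfrac{x_*}{|x_*|}\big|}\Big\}$, with the convention $\frac{x_*}{|x_*|}=0$ if $x_*=0$. Also $d(0,t)^2=4\pi|t|$, and for $((0,x_* ),t)\in\mathbb M^c$ with $x_*\neq0$, $$d((0,x_* ),t)^2=|x_*|^2+4\pi\Big|t-\langle t,\tfrac{x_*}{|x_*|}\rangle\tfrac{x_*}{|x_*|}\Big|.$$ (3) If $(x,t)=((x_1,x_* ),t)\in\mathbb M$, there is a unique $\theta\in\Omega_*$ with $$t=\frac14\nabla_\theta\big[f(|\theta|)x_1^2+\psi(|\theta|)\langle\theta,x_*\rangle^2\big]=\frac14\Big[\frac{f'(|\theta|)}{|\theta|}x_1^2\theta+\frac{\psi'(|\theta|)}{|\theta|}\langle\theta,x_*\rangle^2\theta+2\psi(|\theta|)\langle\theta,x_*\rangle x_*\Big],$$ and $$d(x,t)^2=\phi((x,t);\theta)=\Big(\frac{|\theta|}{\sin|\theta|}\Big)^2x_1^2+|x_*|^2+\Big[\Big(\frac{|\theta|}{\sin|\theta|}\Big)^2-1\Big]\Big(x_*\cdot\frac{\theta}{|\theta|}\Big)^2=\Big|\frac{U(\theta)}{\sin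 U(\theta)}x\Big|^2.$$
   Context: $K_{1,n}$ is the step-two group $\mathbb R^{n+1}\times\mathbb R^n$ with law $(x,t)\cdot(x',t')=(x+x',t+t'+\frac12\langle\mathbb Ux,x'\rangle)$, $\langle\mathbb Ux,x'\rangle=(\langle U^{(j)}x,x'\rangle)_{j=1}^n$, where $\sum_j\tau_jU^{(j)}=\begin{pmatrix}0&\tau^T\\-\tau&\mathbb O_{n\times n}\end{pmatrix}$ for $\tau\in\mathbb R^n$ (column vector); identity $o$. $d(g)$ is the Carnot–Carathéodory distance from $o$ (infimum of $\int_0^1|x'|$ over absolutely continuous curves from $o$ to $g$ with $t'=\frac12\langle\mathbb Ux,x'\rangle$). $U(\tau)=i\sum_j\tau_jU^{(j)}$, $\Omega_*=\{\tau:\|U(\tau)\|<\pi\}=B_{\mathbb R^n}(0,\pi)$, $f(s)=1-s\cot s$, $\psi(s)=f(s)/s^2$ (with $\psi(0)=1/3$), and $\phi((x,t);\tau)=\langle U(\tau)\cot U(\tau)x,x\rangle+4t\cdot\tau=|x|^2+4t\cdot\tau-[x_1^2f(|\tau|)+\langle\tau,x_*\rangle^2\psi(|\tau|)]$. $\mathbb M$ is the set of $g$ such that $\phi(g;\cdot)$ has a nondegenerate critical point in $\Omega_*$. $\mathrm{Cut}_o$ is the complement of $\{g:d^2$ is $C^\infty$ near $g\}$. Convention $|\theta|/\sin|\theta|=1$ at $\theta=0$. *)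

theory Defs
  imports "HOL-Analysis.Analysis"
begin

text \<open>Points of K_{1,n}: g = ((x1, x_*), t) is represented as (x1, x_*, t).\<close>
type_synonym ('n) Kpt = "real \<times> (real^'n) \<times> (real^'n)"

text \<open>The bracket <U x, x'> in R^n:  j-th component = x_{*j} x'_1 - x_1 x'_{*j}.\<close>
definition Ubr :: "real \<times> (real^'n) \<Rightarrow> real \<times> (real^'n) \<Rightarrow> real^'n" where
  "Ubr x x' = (\<chi> j. (snd x $ j) * fst x' - fst x * (snd x' $ j))"

definition Kmult :: "('n::finite) Kpt \<Rightarrow> ('n::finite) Kpt \<Rightarrow> ('n::finite) Kpt" where
  "Kmult g g' = (case g of (x1, xs, t) \<Rightarrow> case g' of (x1', xs', t') \<Rightarrow>
      (x1 + x1', xs + xs', t + t' + (1/2) *\<^sub>R Ubr (x1, xs) (x1', xs')))"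

text \<open>Absolute continuity on [a,b] (epsilon-delta definition).\<close>
definition abs_cont_on :: "real \<Rightarrow> real \<Rightarrow> (real \<Rightarrow> 'a::real_normed_vector) \<Rightarrow> bool" where
  "abs_cont_on a b \<gamma> \<longleftrightarrow> (\<forall>\<epsilon>>0. \<exists>\<delta>>0. \<forall>D :: (real \<times> real) set.
      finite D \<and> (\<forall>(u,v)\<in>D. a \<le> u \<and> u \<le> v \<and> v \<le> b)
      \<and> pairwise (\<lambda>(u,v) (u',v'). {u<..<v} \<inter> {u'<..<v'} = {}) D
      \<and> (\<Sum>(u,v)\<in>D. v - u) < \<delta>
      \<longrightarrow> (\<Sum>(u,v)\<in>D. norm (\<gamma> v - \<gamma> u)) < \<epsilon>)"

text \<open>Horizontal part x = (x1, x_*) of a point.\<close>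
definition hpart :: "('n::finite) Kpt \<Rightarrow> real \<times> (real^'n)" where
  "hpart g = (fst g, fst (snd g))"

definition vpart :: "('n::finite) Kpt \<Rightarrow> real^'n" where
  "vpart g = snd (snd g)"

text \<open>Absolutely continuous horizontal curves from o = 0 to g, on [0,1].\<close>
definition horiz_curves :: "('n::finite) Kpt \<Rightarrow> (real \<Rightarrow> ('n::finite) Kpt) set" where
  "horiz_curves g = {\<gamma>. abs_cont_on 0 1 \<gamma> \<and> \<gamma> 0 = 0 \<and> \<gamma> 1 = g \<and>
     (AE s in lebesgue_on {0..1}. \<gamma> differentiable (at s) \<and>
        vpart (vector_derivative \<gamma> (at s)) =
          (1/2) *\<^sub>R Ubr (hpart (\<gamma> s)) (hpart (vector_derivative \<gamma> (at s))))}"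

text \<open>Carnot-Caratheodory distance from the identity o = 0.\<close>
definition ccdist :: "('n::finite) Kpt \<Rightarrow> real" where
  "ccdist g = Inf ((\<lambda>\<gamma>. integral {0..1} (\<lambda>s. norm (hpart (vector_derivative \<gamma> (at s)))))
                    ` horiz_curves g)"

text \<open>f(s) = 1 - s cot s (f(0) = 0), psi(s) = f(s)/s^2 (psi(0) = 1/3).\<close>
definition fK :: "real \<Rightarrow> real" where
  "fK s = (if s = 0 then 0 else 1 - s * cot s)"

definition psiK :: "real \<Rightarrow> real" where
  "psiK s = (if s = 0 then 1/3 else fK s / s^2)"

text \<open>phi((x,t); tau) (explicit form).\<close>
definition phiK :: "('n::finite) Kpt \<Rightarrow> real^'n \<Rightarrow> real" where
  "phiK g \<tau> = (case g of (x1, xs, t) \<Rightarrow>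
     x1^2 + (norm xs)^2 + 4 * (t \<bullet> \<tau>)
       - (x1^2 * fK (norm \<tau>) + (\<tau> \<bullet> xs)^2 * psiK (norm \<tau>)))"

text \<open>Omega_* = ball 0 pi.\<close>
definition OmegaK :: "(real^'n) set" where
  "OmegaK = ball 0 pi"

text \<open>Iterated partial (directional) derivatives and C^infinity on a set.\<close>
fun pdiff :: "'a list \<Rightarrow> ('a::real_normed_vector \<Rightarrow> real) \<Rightarrow> 'a \<Rightarrow> real" where
  "pdiff [] f = f"
| "pdiff (v # vs) f = (\<lambda>x. frechet_derivative (pdiff vs f) (at x) v)"

definition smooth_on :: "'a::euclidean_space set \<Rightarrow> ('a \<Rightarrow> real) \<Rightarrow> bool" where
  "smooth_on S f \<longleftrightarrow> (\<forall>vs. set vs \<subseteq> Basis \<longrightarrow> pdiff vs f differentiable_on S)"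

text \<open>Cut locus of o: complement of the set where d^2 is C^infinity near g.\<close>
definition CutK :: "('n::finite) Kpt set" where
  "CutK = - {g. \<exists>S. open S \<and> g \<in> S \<and> smooth_on S (\<lambda>h. (ccdist h)^2)}"

text \<open>Hessian of phi(g; .) at tau.\<close>
definition hessK :: "('n::finite) Kpt \<Rightarrow> real^'n \<Rightarrow> real^'n^'n" where
  "hessK g \<tau> = (\<chi> i j. pdiff [axis i 1, axis j 1] (phiK g) \<tau>)"

text \<open>M: phi(g; .) has a nondegenerate critical point in Omega_*.\<close>
definition MK :: "('n::finite) Kpt set" where
  "MK = {g. \<exists>\<tau>\<in>OmegaK. (phiK g has_derivative (\<lambda>h. 0)) (at \<tau>) \<and> det (hessK g \<tau>) \<noteq> 0}"

text \<open>U(theta) = i A(theta), A(theta) = [[0, theta^T], [-theta, 0]] acting on R x R^n.\<close>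
definition Aop :: "real^'n \<Rightarrow> real \<times> (real^'n) \<Rightarrow> real \<times> (real^'n)" where
  "Aop \<theta> x = (\<theta> \<bullet> snd x, - (fst x) *\<^sub>R \<theta>)"

text \<open>z / sin z as an entire-near-0 complex function, and the matrix function
  U/sin U = sum_k a_k U^k = sum_k a_k i^k A^k (power series, valid for |theta| < pi).\<close>
definition zsinz :: "complex \<Rightarrow> complex" where
  "zsinz z = (if z = 0 then 1 else z / sin z)"

definition zsinz_coeff :: "nat \<Rightarrow> real" where
  "zsinz_coeff k = Re ((deriv ^^ k) zsinz 0 / of_nat (fact k) * \<i> ^ k)"

definition U_over_sinU :: "real^'n \<Rightarrow> real \<times> (real^'n) \<Rightarrow> real \<times> (real^'n)" where
  "U_over_sinU \<theta> x = (\<Sum>k. zsinz_coeff k *\<^sub>R ((Aop \<theta> ^^ k) x))"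

text \<open>|theta| / sin |theta| with value 1 at 0.\<close>
definition ssin :: "real \<Rightarrow> real" where
  "ssin s = (if s = 0 then 1 else s / sin s)"

end

theory Submission
  imports Defs "HOL-Complex_Analysis.Complex_Analysis"
begin

text \<open>
Fix \<open>\<tau>\<close> with \<open>|\<tau>| < \<pi>\<close> and let \<open>A\<close> be the skew operator \<open>Aop \<tau>\<close>, \<open>U = iA\<close>. The operator \<open>S(s) = U cot(sU)\<close> solves
\<open>S' = -(S\<^sup>2 + U\<^sup>2)\<close>, so along a horizontal curve of constant speed the derivative of
\<open>\<integral>|x'|\<^sup>2 - 4t\<cdot>\<tau> - \<langle>S(s)x,x\<rangle>\<close> is \<open>|x' - (A+S)x|\<^sup>2 \<ge> 0\<close>; hence \<open>\<phi>(g;\<tau>) \<le> d(g)\<^sup>2\<close>. Equality holds along the solution of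
\<open>x' = (A+S)x\<close>, whose endpoint has \<open>t\<close> equal to a quarter of the gradient of \<open>F = f(|\<theta>|)x\<^sub>1\<^sup>2 + \<psi>(|\<theta>|)\<langle>\<theta>,x\<^sub>*\<rangle>\<^sup>2\<close>: a critical
point of \<open>\<phi>(g;\<cdot>)\<close> in the ball computes the distance and is automatically a global maximum.

Off the exceptional set the maximum of \<open>\<phi>(g;\<cdot>)\<close> is attained inside the ball, because near the sphere \<open>\<phi>\<close> is controlled by
\<open>1/(\<pi>(\<pi>-s)) \<le> \<psi>(s) \<le> \<pi>/(s\<^sup>2(\<pi>-s))\<close>; on it, a full circle combined with a straight motion is optimal.
The Hessian of \<open>F\<close> is positive definite unless \<open>x\<^sub>1 = \<langle>\<theta>,x\<^sub>*\<rangle> = 0\<close>, which comes down to strict concavity of \<open>1/\<psi>\<close>.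
Therefore \<open>(x,\<theta>) \<mapsto> (x, \<nabla>F/4)\<close> is an injective local diffeomorphism, and \<open>d\<^sup>2\<close> is smooth on its open image, which is the
complement of the exceptional set. On a dense part of the exceptional set \<open>d\<^sup>2\<close> has a kink \<open>-c|x\<^sub>1|\<close>.
\<close>

text \<open>Every distance is found by exhibiting a curve whose squared length equals a value, or a
  limit of values, of \<open>phiK\<close>; no existence theorem for minimizers enters. The
  inequality defining the exceptional set decides whether the maximizer of \<open>phiK\<close>
  escapes to the sphere of radius pi. Take x1 = 0 and let N be the length of \<open>xs\<close>, c
  the component of t along \<open>xs\<close>, and P the length of the orthogonal part of t. Since
  1/psi(s) is at most pi (pi - s), maximizing over the component of tau along \<open>xs\<close>
  bounds \<open>phiK\<close> by N^2 + 4 pi P + 4 (pi c^2 / N^2 - P) (pi - |tau|). The sign of pi c^2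
  - N^2 P therefore decides, which is where the square root of pi comes from. The bound is a tangent
  line to the concave function 1/psi at pi, hence valid on the whole interval and not only
  asymptotically. The curves that close a circle produce the same inequality from their free initial
  direction. Curves are only absolutely continuous, so the calibration is not differentiated along
  them; it is carried out on chords, with the error measured by arc length.\<close>

hide_const (open) Polynomial.content

section \<open>Absolutely continuous curves\<close>

text \<open>Absolute continuity speaks of sets of endpoint pairs, gauge integration of divisions
  into closed intervals. The dictionary is \<open>K\<close> to \<open>(Inf K, Sup K)\<close>,
  injective because the members of a division are nonempty intervals.\<close>

lemma abs_cont_on_division:
  fixes f :: "real \<Rightarrow> 'a::real_normed_vector"
  assumes ac: "abs_cont_on a b f" and e: "e > 0"
  obtains d where "d > 0"
    "\<And>D. D division_of \<Union>D \<Longrightarrow> \<Union>D \<subseteq> {a..b} \<Longrightarrow> (\<Sum>K\<in>D. content K) < d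
       \<Longrightarrow> (\<Sum>K\<in>D. norm (f (Sup K) - f (Inf K))) < e"
proof -
  obtain d where d: "d > 0"
    and *: "\<And>D :: (real \<times> real) set. \<lbrakk>finite D; \<forall>(u,v)\<in>D. a \<le> u \<and> u \<le> v \<and> v \<le> b;
      pairwise (\<lambda>(u,v) (u',v'). {u<..<v} \<inter> {u'<..<v'} = {}) D; (\<Sum>(u,v)\<in>D. v - u) < d\<rbrakk>
      \<Longrightarrow> (\<Sum>(u,v)\<in>D. norm (f v - f u)) < e"
    using ac e unfolding abs_cont_on_def by meson
  show ?thesis
  proof (rule that[OF d])
    fix D :: "real set set"
    assume D: "D division_of \<Union>D" and sub: "\<Union>D \<subseteq> {a..b}" and small: "(\<Sum>K\<in>D. content K) < d"
    define p where "p = (\<lambda>K::real set. (Inf K, Sup K))"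
    have K: "K = {Inf K..Sup K} \<and> Inf K \<le> Sup K \<and> a \<le> Inf K \<and> Sup K \<le> b" if KD: "K \<in> D" for K
    proof -
      obtain u v where uv: "K = cbox u v" "K \<noteq> {}" using division_ofD(3,4)[OF D KD] by metis
      then have "u \<le> v" by auto
      moreover have "K \<subseteq> {a..b}" using sub KD by auto
      ultimately show ?thesis using uv by auto
    qed
    have inj: "inj_on p D" using K unfolding p_def inj_on_def by (metis Pair_inject)
    have cont: "content K = Sup K - Inf K" if "K \<in> D" for K
      using K[OF that] by (metis content_real)
    have "(\<Sum>(u,v)\<in>p ` D. norm (f v - f u)) < e"
    proof (rule *)
      show "finite (p ` D)" using division_ofD(1)[OF D] by simp
      show "\<forall>(u,v)\<in>p ` D. a \<le> u \<and> u \<le> v \<and> v \<le> b" using K by (auto simp: p_def)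
      show "pairwise (\<lambda>(u,v) (u',v'). {u<..<v} \<inter> {u'<..<v'} = {}) (p ` D)"
      proof (rule pairwiseI)
        fix P Q assume PQ: "P \<in> p ` D" "Q \<in> p ` D" "P \<noteq> Q"
        then obtain K L where KL: "K \<in> D" "L \<in> D" "P = p K" "Q = p L" by auto
        then have "interior K \<inter> interior L = {}" using division_ofD(5)[OF D] PQ(3) by metis
        then show "(\<lambda>(u,v) (u',v'). {u<..<v} \<inter> {u'<..<v'} = {}) P Q"
          using K[OF KL(1)] K[OF KL(2)] interior_atLeastAtMost_real[of "Inf K" "Sup K"]
            interior_atLeastAtMost_real[of "Inf L" "Sup L"] by (simp add: KL(3,4) p_def)
      qed
      show "(\<Sum>(u,v)\<in>p ` D. v - u) < d"
        unfolding sum.reindex[OF inj] using small by (simp add: p_def o_def cont)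
    qed
    then show "(\<Sum>K\<in>D. norm (f (Sup K) - f (Inf K))) < e"
      unfolding sum.reindex[OF inj] by (simp add: p_def o_def)
  qed
qed

text \<open>Members of a division may share endpoints, so the measure is added over their interiors,
  which are disjoint and have the same content.\<close>

lemma sum_content_le_measure:
  fixes D :: "real set set"
  assumes D: "D division_of \<Union>D" and T: "T \<in> lmeasurable" "\<Union>D \<subseteq> T"
  shows "(\<Sum>K\<in>D. content K) \<le> measure lebesgue T"
proof -
  have "(\<Sum>K\<in>D. content K) = (\<Sum>K\<in>D. measure lebesgue (interior K))"
  proof (rule sum.cong[OF refl])
    fix K assume "K \<in> D"
    then obtain u v where uv: "K = cbox u v" using division_ofD(4)[OF D] by metis
    show "content K = measure lebesgue (interior K)"
      unfolding uv by (cases "u \<le> v") (auto simp: interior_atLeastAtMost_real)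
  qed
  also have "\<dots> = measure lebesgue (\<Union>K\<in>D. interior K)"
  proof (rule measure_UNION'[symmetric])
    show "interior K \<in> lmeasurable" if KD: "K \<in> D" for K
    proof -
      obtain u v where uv: "K = cbox u v" using division_ofD(4)[OF D KD] by metis
      show ?thesis unfolding uv interior_cbox by (rule lmeasurable_box)
    qed
  qed (use division_ofD(1,5)[OF D] in \<open>auto simp: pairwise_def disjnt_def\<close>)
  also have "\<dots> \<le> measure lebesgue T"
  proof (rule measure_mono_fmeasurable)
    show "(\<Union>K\<in>D. interior K) \<subseteq> T" using T(2) interior_subset by fastforce
    show "(\<Union>K\<in>D. interior K) \<in> sets lebesgue" using borel_open[OF open_UN, of D interior] by (simp add: sets_completionI_sets)
  qed (rule T)
  finally show ?thesis .
qed

lemma abs_cont_on_subinterval: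
  assumes "abs_cont_on a b f" "a \<le> c" "d \<le> b"
  shows "abs_cont_on c d f"
  unfolding abs_cont_on_def
proof (intro allI impI)
  fix \<epsilon> :: real assume "\<epsilon> > 0"
  with assms(1) obtain \<delta> where \<delta>: "\<delta> > 0"
    and *: "\<And>D :: (real \<times> real) set. \<lbrakk>finite D; \<forall>(u,v)\<in>D. a \<le> u \<and> u \<le> v \<and> v \<le> b;
      pairwise (\<lambda>(u,v) (u',v'). {u<..<v} \<inter> {u'<..<v'} = {}) D; (\<Sum>(u,v)\<in>D. v - u) < \<delta>\<rbrakk>
      \<Longrightarrow> (\<Sum>(u,v)\<in>D. norm (f v - f u)) < \<epsilon>"
    unfolding abs_cont_on_def by meson
  show "\<exists>\<delta>>0. \<forall>D. finite D \<and> (\<forall>(u,v)\<in>D. c \<le> u \<and> u \<le> v \<and> v \<le> d) \<and>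
      pairwise (\<lambda>(u,v) (u',v'). {u<..<v} \<inter> {u'<..<v'} = {}) D \<and> (\<Sum>(u,v)\<in>D. v - u) < \<delta>
      \<longrightarrow> (\<Sum>(u,v)\<in>D. norm (f v - f u)) < \<epsilon>"
  proof (intro exI[of _ \<delta>] conjI \<delta> allI impI)
    fix D :: "(real \<times> real) set"
    assume D: "finite D \<and> (\<forall>(u,v)\<in>D. c \<le> u \<and> u \<le> v \<and> v \<le> d) \<and>
      pairwise (\<lambda>(u,v) (u',v'). {u<..<v} \<inter> {u'<..<v'} = {}) D \<and> (\<Sum>(u,v)\<in>D. v - u) < \<delta>"
    show "(\<Sum>(u,v)\<in>D. norm (f v - f u)) < \<epsilon>"
      by (rule *) (use D assms(2,3) in fastforce)+
  qed
qed

text \<open>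
The gauge at a point of the null set is an open set of measure less than \<open>\<delta>\<close> that covers it; absolute continuity bounds the
contribution of the intervals tagged there.
\<close>

theorem fundamental_theorem_of_calculus_abs_cont:
  fixes f :: "real \<Rightarrow> 'a::euclidean_space"
  assumes ab: "a \<le> b" and ac: "abs_cont_on a b f" and N: "negligible N"
    and der: "\<And>x. x \<in> {a..b} - N \<Longrightarrow> (f has_vector_derivative f' x) (at x)"
  shows "(f' has_integral (f b - f a)) {a..b}"
proof -
  \<comment> \<open>With the integrand set to 0 on \<open>N\<close>, a tag in \<open>N\<close>
    contributes only an increment of \<open>f\<close>, which is what absolute continuity
    controls.\<close>
  define h where "h = (\<lambda>x. if x \<in> N then 0 else f' x)"
  have "(h has_integral (f b - f a)) (cbox a b)"
    unfolding has_integral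
  proof (intro allI impI)
    fix e :: real assume "e > 0"
    \<comment> \<open>The summand 1 covers the degenerate case a = b.\<close>
    define \<epsilon> where "\<epsilon> = e / (2 * (b - a + 1))"
    have \<epsilon>: "\<epsilon> > 0" "\<epsilon> * (b - a) < e/2" using \<open>e > 0\<close> ab by (auto simp: \<epsilon>_def field_simps)
    obtain \<delta> where \<delta>: "\<delta> > 0"
      and small: "\<And>D. D division_of \<Union>D \<Longrightarrow> \<Union>D \<subseteq> {a..b} \<Longrightarrow> (\<Sum>K\<in>D. content K) < \<delta>
       \<Longrightarrow> (\<Sum>K\<in>D. norm (f (Sup K) - f (Inf K))) < e/2"
      by (rule abs_cont_on_division[OF ac, of "e/2"]) (use \<open>e > 0\<close> in auto)
    obtain T where T: "open T" "N \<subseteq> T" "T - N \<in> lmeasurable" "emeasure lebesgue (T - N) < ennreal \<delta>"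
      using sets_lebesgue_outer_open[OF negligible_imp_sets[OF N] \<delta>] by metis
    have Nm: "N \<in> lmeasurable" "measure lebesgue N = 0"
      using N negligible_imp_measurable negligible_imp_measure0 by auto
    have TN: "T = (T - N) \<union> N" using T(2) by auto
    have Tm: "T \<in> lmeasurable" using TN fmeasurable.Un[OF T(3) Nm(1)] by simp
    have "measure lebesgue (T - N) < \<delta>"
      using T(3,4) \<delta> by (simp add: emeasure_eq_measure2 ennreal_less_iff)
    then have Td: "measure lebesgue T < \<delta>"
      using measure_Un_le[of "T - N" lebesgue N] TN T(3) Nm by fastforce
    have "\<forall>x. \<exists>d>0. x \<in> {a..b} - N \<longrightarrow>
        (\<forall>y. norm (y-x) < d \<longrightarrow> norm (f y - f x - (y-x) *\<^sub>R f' x) \<le> \<epsilon> * norm (y-x))"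
      using der[unfolded has_vector_derivative_def has_derivative_at_alt] \<epsilon>(1) by blast
    then obtain d where d: "\<And>x. 0 < d x"
                 "\<And>x y. \<lbrakk>x \<in> {a..b} - N; norm (y-x) < d x\<rbrakk>
                        \<Longrightarrow> norm (f y - f x - (y-x) *\<^sub>R f' x) \<le> \<epsilon> * norm (y-x)"
      by metis
    define \<gamma> where "\<gamma> = (\<lambda>x. if x \<in> N then T else ball x (d x))"
    show "\<exists>\<gamma>. gauge \<gamma> \<and> (\<forall>p. p tagged_division_of cbox a b \<and> \<gamma> fine p \<longrightarrow>
            norm ((\<Sum>(x,k)\<in>p. content k *\<^sub>R h x) - (f b - f a)) < e)"
    proof (intro exI[of _ \<gamma>] conjI allI impI)
      show "gauge \<gamma>" using T(1,2) d(1) by (auto simp: gauge_def \<gamma>_def)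
      fix p assume p: "p tagged_division_of cbox a b \<and> \<gamma> fine p"
      then have pt: "p tagged_division_of cbox a b" and fine: "\<gamma> fine p" by auto
      have fin: "finite p" using pt by blast
      have ba: "b - a = (\<Sum>(x,K)\<in>p. Sup K - Inf K)" "f b - f a = (\<Sum>(x,K)\<in>p. f(Sup K) - f(Inf K))"
        using additive_tagged_division_1[where f= "\<lambda>x. x"] additive_tagged_division_1[where f= f]
            ab pt by auto
      define q where "q = {xk \<in> p. fst xk \<in> N}"
      have qp: "q \<subseteq> p" by (auto simp: q_def)
      define G where "G = (\<lambda>(x,K). content K *\<^sub>R h x - (f (Sup K) - f (Inf K)))"
      have Kuv: "\<exists>u v. K = {u..v} \<and> u \<le> v \<and> x \<in> {u..v} \<and> {u..v} \<subseteq> {a..b}" if xK: "(x,K) \<in> p" for x K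
      proof -
        obtain u v where uv: "K = cbox u v" using tagged_division_ofD(4)[OF pt xK] by metis
        have "x \<in> K" "K \<subseteq> cbox a b" using tagged_division_ofD(2,3)[OF pt xK] by auto
        then show ?thesis using uv by fastforce
      qed
      have good: "norm (G (x,K)) \<le> \<epsilon> * (Sup K - Inf K)" if xK: "(x,K) \<in> p - q" for x K
      proof -
        obtain u v where uv: "K = {u..v}" "u \<le> v" "x \<in> {u..v}" "{u..v} \<subseteq> {a..b}" using Kuv xK by blast
        have xN: "x \<in> {a..b} - N" using uv xK by (auto simp: q_def)
        have "K \<subseteq> ball x (d x)" using fineD[OF fine, of x K] xK xN by (auto simp: \<gamma>_def)
        then have dd: "norm (u - x) < d x" "norm (v - x) < d x"
          using uv(1-3) subsetD[of K "ball x (d x)" u] subsetD[of K "ball x (d x)" v]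
          by (auto simp: dist_real_def)
        \<comment> \<open>Straddle argument: the tag lies between both ends, so the two
          linearization errors add up to a multiple of v - u.\<close>
        have "G (x,K) = (f u - f x - (u - x) *\<^sub>R f' x) - (f v - f x - (v - x) *\<^sub>R f' x)"
          using uv xN by (simp add: G_def h_def algebra_simps)
        then have "norm (G (x,K)) \<le> norm (f u - f x - (u - x) *\<^sub>R f' x) + norm (f v - f x - (v - x) *\<^sub>R f' x)"
          by (simp only: norm_triangle_ineq4)
        also have "\<dots> \<le> \<epsilon> * norm (u - x) + \<epsilon> * norm (v - x)"
          by (intro add_mono d(2) xN dd)
        also have "\<dots> = \<epsilon> * (Sup K - Inf K)" using uv by (simp add: algebra_simps)
        finally show ?thesis .
      qed
      have "(\<Sum>xk\<in>p-q. norm (G xk)) \<le> (\<Sum>xk\<in>p-q. \<epsilon> * (Sup (snd xk) - Inf (snd xk)))"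
        by (rule sum_mono) (use good in auto)
      also have "\<dots> \<le> (\<Sum>xk\<in>p. \<epsilon> * (Sup (snd xk) - Inf (snd xk)))"
      proof (rule sum_mono2[OF fin])
        fix xk assume "xk \<in> p - (p - q)"
        then show "0 \<le> \<epsilon> * (Sup (snd xk) - Inf (snd xk))"
          using Kuv[of "fst xk" "snd xk"] \<epsilon>(1) by fastforce
      qed auto
      also have "\<dots> = \<epsilon> * (b - a)"
        unfolding ba by (simp add: sum_distrib_left split_def)
      finally have 1: "(\<Sum>xk\<in>p-q. norm (G xk)) < e/2" using \<epsilon>(2) by linarith
      have qt: "q tagged_partial_division_of cbox a b"
        using tagged_partial_division_subset[OF _ qp] pt tagged_division_of_def by blast
      have qT: "\<Union>(snd ` q) \<subseteq> T"
        using fineD[OF fine] by (fastforce simp: \<gamma>_def q_def)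
      have qab: "\<Union>(snd ` q) \<subseteq> {a..b}"
        using tagged_division_ofD(3)[OF pt] qp by fastforce
      have qd: "snd ` q division_of \<Union>(snd ` q)"
        by (rule partial_division_of_tagged_division[OF qt])
      have "(\<Sum>K\<in>snd ` q. norm (f (Sup K) - f (Inf K))) < e/2"
        using small[OF qd qab] sum_content_le_measure[OF qd Tm qT] Td by linarith
      \<comment> \<open>Passing from tagged pairs to intervals requires a summand that vanishes on
        intervals with empty interior. The empty set has to be forced to 0, since \<open>Sup\<close>
        and \<open>Inf\<close> have no useful value there.\<close>
      also have "(\<Sum>K\<in>snd ` q. norm (f (Sup K) - f (Inf K)))
          = (\<Sum>K\<in>snd ` q. if K = {} then 0 else norm (f (Sup K) - f (Inf K)))"
        by (rule sum.cong) (use division_ofD(3)[OF qd] in auto)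
      also have "\<dots> = (\<Sum>(x,K)\<in>q. if K = {} then 0 else norm (f (Sup K) - f (Inf K)))"
        by (rule sum.over_tagged_division_lemma[OF tagged_partial_division_of_Union_self[OF qt], symmetric])
           (auto simp: not_less)
      also have "\<dots> = (\<Sum>xk\<in>q. norm (G xk))"
        by (rule sum.cong) (auto simp: G_def h_def q_def norm_minus_commute dest: Kuv)
      finally have 2: "(\<Sum>xk\<in>q. norm (G xk)) < e/2" .
      have "(\<Sum>(x,k)\<in>p. content k *\<^sub>R h x) - (f b - f a) = (\<Sum>xk\<in>p. G xk)"
        by (simp add: ba G_def split_def sum_subtractf)
      then have "norm ((\<Sum>(x,k)\<in>p. content k *\<^sub>R h x) - (f b - f a)) \<le> (\<Sum>xk\<in>p. norm (G xk))"
        by (simp add: norm_sum)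
      also have "\<dots> = (\<Sum>xk\<in>p-q. norm (G xk)) + (\<Sum>xk\<in>q. norm (G xk))"
        by (rule sum.subset_diff[OF qp fin])
      finally show "norm ((\<Sum>(x,k)\<in>p. content k *\<^sub>R h x) - (f b - f a)) < e" using 1 2 by linarith
    qed
  qed
  then show ?thesis
    unfolding box_real by (rule has_integral_spike[OF N, rotated]) (auto simp: h_def)
qed

text \<open>On an interval shorter than \<open>d\<close> the variation of \<open>f\<close> is at
  most 1, and it bounds the sums of norms of integrals of \<open>f'\<close>. Finitely many such
  intervals are then glued. This makes the length of a horizontal curve an honest integral.\<close>

lemma abs_cont_derivative_absolutely_integrable:
  fixes f :: "real \<Rightarrow> 'a::euclidean_space"
  assumes ab: "a \<le> b" and ac: "abs_cont_on a b f" and N: "negligible N"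
    and der: "\<And>x. x \<in> {a..b} - N \<Longrightarrow> (f has_vector_derivative f' x) (at x)"
  shows "f' absolutely_integrable_on {a..b}"
proof -
  have ftc: "(f' has_integral (f v - f u)) {u..v}" if "a \<le> u" "u \<le> v" "v \<le> b" for u v
    by (rule fundamental_theorem_of_calculus_abs_cont[OF that(2) abs_cont_on_subinterval[OF ac that(1,3)] N])
       (use der that in auto)
  obtain d where d: "d > 0"
    and small: "\<And>D. D division_of \<Union>D \<Longrightarrow> \<Union>D \<subseteq> {a..b} \<Longrightarrow> (\<Sum>K\<in>D. content K) < d
       \<Longrightarrow> (\<Sum>K\<in>D. norm (f (Sup K) - f (Inf K))) < 1"
    by (rule abs_cont_on_division[OF ac, of 1]) auto
  have short: "f' absolutely_integrable_on {u..v}" if uv: "a \<le> u" "u \<le> v" "v \<le> b" "v - u < d" for u v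
    unfolding box_real[symmetric]
  proof (rule bounded_variation_absolutely_integrable_interval[where B=1])
    show "f' integrable_on cbox u v" using ftc[OF uv(1-3)] by auto
    fix D assume D: "D division_of cbox u v"
    then have U: "\<Union>D = {u..v}" by auto
    have "norm (integral K f') = norm (f (Sup K) - f (Inf K))" if KD: "K \<in> D" for K
    proof -
      obtain w z where "K = cbox w z" "K \<noteq> {}" "K \<subseteq> {u..v}" using division_ofD(2-4)[OF D KD] by (metis box_real(2))
      then have "K = {w..z}" "w \<le> z" "a \<le> w" "z \<le> b" using uv by fastforce+
      then show ?thesis using ftc[of w z] by (simp add: integral_unique)
    qed
    then have "(\<Sum>K\<in>D. norm (integral K f')) = (\<Sum>K\<in>D. norm (f (Sup K) - f (Inf K)))" by simp
    also have "\<dots> < 1"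
      by (rule small) (use D U uv additive_content_division[OF D] in auto)
    finally show "(\<Sum>K\<in>D. norm (integral K f')) \<le> 1" by simp
  qed
  obtain n :: nat where n: "(b - a) / d < real n" using reals_Archimedean2 by blast
  define m where "m = (b - a) / real (Suc n)"
  have "b - a < d * real (Suc n)"
    using n d by (simp add: field_simps)
  then have m: "m < d" "0 \<le> m" using ab by (auto simp: m_def field_simps)
  have mb: "a + real (Suc n) * m = b" by (simp add: m_def)
  have "k \<le> Suc n \<longrightarrow> f' absolutely_integrable_on {a..a + real k * m}" for k
  proof (induction k)
    case 0 then show ?case using short[of a a] ab d by simp
  next
    case (Suc k)
    show ?case
    proof
      assume k: "Suc k \<le> Suc n"
      have "a + real (Suc k) * m \<le> b" using mb mult_right_mono[of "real (Suc k)" "real (Suc n)" m] k m(2) by linarith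
      then have "f' absolutely_integrable_on {a + real k * m..a + real (Suc k) * m}"
        using m by (intro short) (auto simp: algebra_simps)
      with Suc k have "f' absolutely_integrable_on {a..a + real k * m} \<union> {a + real k * m..a + real (Suc k) * m}"
        by (intro absolutely_integrable_Un) auto
      also have "{a..a + real k * m} \<union> {a + real k * m..a + real (Suc k) * m} = {a..a + real (Suc k) * m}"
        using m(2) by (intro ivl_disj_un_two_touch) (auto simp: algebra_simps)
      finally show "f' absolutely_integrable_on {a..a + real (Suc k) * m}" .
    qed
  qed
  then show ?thesis using mb by (metis order_refl)
qed

section \<open>The lower bound: calibration by a Riccati solution\<close>

lemma bounded_linear_hpart: "bounded_linear hpart"
  unfolding hpart_def
  by (intro bounded_linear_Pair bounded_linear_fst bounded_linear_compose[OF bounded_linear_fst bounded_linear_snd])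

lemma bounded_linear_vpart: "bounded_linear vpart"
  unfolding vpart_def
  by (intro bounded_linear_compose[OF bounded_linear_snd bounded_linear_snd])

lemma Ubr_eq: "Ubr x y = fst y *\<^sub>R snd x - fst x *\<^sub>R snd y"
  by (simp add: Ubr_def vec_eq_iff)

lemma bounded_linear_Ubr_right: "bounded_linear (Ubr (x :: real \<times> (real^'n::finite)))"
  unfolding Ubr_eq[abs_def]
  by (intro bounded_linear_sub bounded_linear_compose[OF bounded_linear_scaleR_right bounded_linear_snd]
        bounded_linear_compose[OF bounded_linear_scaleR_left bounded_linear_fst])

lemma norm_Ubr_le: "norm (Ubr x y) \<le> 2 * (norm x * norm (y :: real \<times> (real^'n::finite)))"
proof -
  have "norm (Ubr x y) \<le> \<bar>fst y\<bar> * norm (snd x) + \<bar>fst x\<bar> * norm (snd y)"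
    unfolding Ubr_eq by (rule order_trans[OF norm_triangle_ineq4]) simp
  also have "\<dots> \<le> norm y * norm x + norm x * norm y"
    by (intro add_mono mult_mono)
       (metis norm_ge_zero prod.collapse norm_fst_le norm_snd_le real_norm_def abs_ge_zero)+
  finally show ?thesis by (simp add: mult.commute)
qed

text \<open>Apart from its endpoints, a horizontal curve enters the lower bound only through these
  facts. For the last one, freeze the first argument of the bracket at time a: the remaining
  integrand is at most the arc length of the piece times the speed, and integrates to the squared
  arc length.\<close>

lemma horiz_curve_estimates:
  fixes g :: "('n::finite) Kpt"
  assumes "\<gamma> \<in> horiz_curves g"
  defines "v \<equiv> (\<lambda>s. hpart (vector_derivative \<gamma> (at s)))"
  shows "(\<lambda>s. norm (v s)) integrable_on {0..1}"
    and "\<And>a b. 0 \<le> a \<Longrightarrow> a \<le> b \<Longrightarrow> b \<le> 1 \<Longrightarrow>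
       norm (hpart (\<gamma> b) - hpart (\<gamma> a)) \<le> integral {a..b} (\<lambda>s. norm (v s))"
    and "\<And>a b. 0 \<le> a \<Longrightarrow> a \<le> b \<Longrightarrow> b \<le> 1 \<Longrightarrow>
       norm (vpart (\<gamma> b) - vpart (\<gamma> a) - (1/2) *\<^sub>R Ubr (hpart (\<gamma> a)) (hpart (\<gamma> b) - hpart (\<gamma> a)))
         \<le> (integral {a..b} (\<lambda>s. norm (v s)))\<^sup>2"
proof -
  define P where "P = (\<lambda>s. \<gamma> differentiable (at s) \<and>
        vpart (vector_derivative \<gamma> (at s)) =
          (1/2) *\<^sub>R Ubr (hpart (\<gamma> s)) (hpart (vector_derivative \<gamma> (at s))))"
  have ac: "abs_cont_on 0 1 \<gamma>" and ae: "AE s in lebesgue_on {0..1}. P s"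
    using assms(1) by (auto simp: horiz_curves_def P_def)
  have "AE s in lebesgue. s \<in> {0..1} \<longrightarrow> P s"
    using ae by (subst (asm) AE_restrict_space_iff) auto
  then obtain N where N: "negligible N" "{s. \<not> (s \<in> {0..1} \<longrightarrow> P s)} \<subseteq> N"
    by (auto simp: eventually_ae_filter_negligible)
  then have P: "P s" if "s \<in> {0..1} - N" for s using that by auto
  define d where "d = (\<lambda>s. vector_derivative \<gamma> (at s))"
  have der: "(\<gamma> has_vector_derivative d s) (at s)" if "s \<in> {0..1} - N" for s
    using P[OF that] unfolding P_def d_def by (simp add: vector_derivative_works)
  have dint: "(d has_integral (\<gamma> b - \<gamma> a)) {a..b}" if "0 \<le> a" "a \<le> b" "b \<le> 1" for a b
    by (rule fundamental_theorem_of_calculus_abs_cont[OF that(2) abs_cont_on_subinterval[OF ac that(1,3)] N(1)])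
       (use der that in auto)
  have "d absolutely_integrable_on {0..1}"
    by (rule abs_cont_derivative_absolutely_integrable[OF _ ac N(1)]) (use der in auto)
  then have "(hpart \<circ> d) absolutely_integrable_on {0..1}"
    by (rule absolutely_integrable_linear[OF _ bounded_linear_hpart])
  then have vab: "v absolutely_integrable_on {0..1}" by (simp add: v_def d_def o_def)
  then show nint: "(\<lambda>s. norm (v s)) integrable_on {0..1}"
    by (simp add: absolutely_integrable_on_def)
  have nint': "(\<lambda>s. norm (v s)) integrable_on {a..b}" if "0 \<le> a" "b \<le> 1" for a b
    by (rule integrable_on_subinterval[OF nint]) (use that in auto)
  have vint: "(v has_integral (hpart (\<gamma> b) - hpart (\<gamma> a))) {a..b}" if "0 \<le> a" "a \<le> b" "b \<le> 1" for a b
    using has_integral_linear[OF dint[OF that] bounded_linear_hpart]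
    by (simp add: v_def d_def o_def linear_diff[OF bounded_linear.linear[OF bounded_linear_hpart]])
  show hb: "norm (hpart (\<gamma> b) - hpart (\<gamma> a)) \<le> integral {a..b} (\<lambda>s. norm (v s))"
    if "0 \<le> a" "a \<le> b" "b \<le> 1" for a b
    using integral_norm_bound_integral[OF _ nint'[OF that(1,3)], of v] vint[OF that]
    by (metis has_integral_integrable integral_unique order_refl)
  show "norm (vpart (\<gamma> b) - vpart (\<gamma> a) - (1/2) *\<^sub>R Ubr (hpart (\<gamma> a)) (hpart (\<gamma> b) - hpart (\<gamma> a)))
         \<le> (integral {a..b} (\<lambda>s. norm (v s)))\<^sup>2"
    if ab: "0 \<le> a" "a \<le> b" "b \<le> 1" for a b
  proof -
    define l where "l = integral {a..b} (\<lambda>s. norm (v s))"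
    define h where "h = (\<lambda>s. vpart (d s) - (1/2) *\<^sub>R Ubr (hpart (\<gamma> a)) (v s))"
    have 1: "((\<lambda>s. vpart (d s)) has_integral (vpart (\<gamma> b) - vpart (\<gamma> a))) {a..b}"
      using has_integral_linear[OF dint[OF ab] bounded_linear_vpart]
      by (simp add: o_def linear_diff[OF bounded_linear.linear[OF bounded_linear_vpart]])
    have 2: "((\<lambda>s. Ubr (hpart (\<gamma> a)) (v s)) has_integral Ubr (hpart (\<gamma> a)) (hpart (\<gamma> b) - hpart (\<gamma> a))) {a..b}"
      using has_integral_linear[OF vint[OF ab] bounded_linear_Ubr_right, of "hpart (\<gamma> a)"] by (simp add: o_def)
    have h: "(h has_integral (vpart (\<gamma> b) - vpart (\<gamma> a)
        - (1/2) *\<^sub>R Ubr (hpart (\<gamma> a)) (hpart (\<gamma> b) - hpart (\<gamma> a)))) {a..b}"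
      unfolding h_def by (intro has_integral_diff 1 has_integral_cmul 2)
    define h' where "h' = (\<lambda>s. if s \<in> N then 0 else h s)"
    have h': "(h' has_integral (vpart (\<gamma> b) - vpart (\<gamma> a)
        - (1/2) *\<^sub>R Ubr (hpart (\<gamma> a)) (hpart (\<gamma> b) - hpart (\<gamma> a)))) {a..b}"
      by (rule has_integral_spike[OF N(1) _ h]) (simp add: h'_def)
    have bound: "norm (h' s) \<le> l * norm (v s)" if s: "s \<in> {a..b}" for s
    proof (cases "s \<in> N")
      case True
      have "l \<ge> 0" unfolding l_def by (rule integral_nonneg[OF nint'[OF ab(1,3)]]) auto
      then show ?thesis using True by (simp add: h'_def)
    next
      case False
      then have "P s" using P s ab by auto
      \<comment> \<open>Horizontality turns the integrand into the bracket with the displacement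
        since time a.\<close>
      then have "h' s = (1/2) *\<^sub>R Ubr (hpart (\<gamma> s) - hpart (\<gamma> a)) (v s)"
        using False by (simp add: h'_def h_def P_def d_def v_def Ubr_eq algebra_simps)
      then have "norm (h' s) \<le> norm (hpart (\<gamma> s) - hpart (\<gamma> a)) * norm (v s)"
        using norm_Ubr_le[of "hpart (\<gamma> s) - hpart (\<gamma> a)" "v s"] by simp
      also have "norm (hpart (\<gamma> s) - hpart (\<gamma> a)) \<le> integral {a..s} (\<lambda>s. norm (v s))"
        using hb[of a s] s ab by auto
      also have "\<dots> \<le> l"
        unfolding l_def by (rule integral_subset_le[OF _ nint' nint']) (use s ab in auto)
      finally show ?thesis by (simp add: mult_right_mono)
    qed
    have "norm (integral {a..b} h') \<le> integral {a..b} (\<lambda>s. l * norm (v s))"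
      by (rule integral_norm_bound_integral) (use h' integrable_on_cmult_left[OF nint'[OF ab(1,3)], of l] bound in auto)
    then show ?thesis using integral_unique[OF h'] by (simp add: l_def power2_eq_square)
  qed
qed

text \<open>
The quadratic form \<open>\<langle>U cot(sU) x, x\<rangle>\<close> for \<open>\<tau> = r e\<close>: \<open>U\<^sup>2\<close> is \<open>r\<^sup>2\<close> on the span of \<open>(1,0)\<close> and \<open>(0,e)\<close>, and zero on its
orthogonal complement.
\<close>

definition riccati_form :: "real \<Rightarrow> real^'n \<Rightarrow> real \<Rightarrow> real \<times> (real^'n) \<Rightarrow> real" where
  "riccati_form r e s x = r * cot (r * s) * ((fst x)\<^sup>2 + (snd x \<bullet> e)\<^sup>2) + ((norm (snd x))\<^sup>2 - (snd x \<bullet> e)\<^sup>2) / s"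

text \<open>The chord \<open>D\<close> is traversed in time \<delta> at speed at most \<Lambda>. On
  a chord the bracket of \<open>x + p D\<close> with \<open>D\<close> equals that of
  \<open>x\<close> with \<open>D\<close>, so the increment of t is exactly linear in p. The
  derivative of \<open>G\<close>, multiplied by \<delta>, is a sum of squares.\<close>

lemma riccati_form_segment:
  fixes e :: "real^'n" and x D :: "real \<times> (real^'n)"
  assumes e: "norm e = 1" and r: "r > 0" and s: "s > 0" and d: "\<delta> > 0" and pi: "r * (s + \<delta>) < pi"
    and D: "norm D \<le> \<Lambda> * \<delta>"
  shows "riccati_form r e (s + \<delta>) (x + D) - riccati_form r e s x
     \<le> \<Lambda>\<^sup>2 * \<delta> - 2 * r * ((snd x \<bullet> e) * fst D - fst x * (snd D \<bullet> e))"
proof -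
  obtain a y where x: "x = (a, y)" by (cases x)
  obtain A Y where DA: "D = (A, Y)" by (cases D)
  define b where "b = y \<bullet> e"
  define B where "B = Y \<bullet> e"
  define G where "G = (\<lambda>p. \<Lambda>\<^sup>2 * \<delta> * p - 2 * r * p * (b * A - a * B) -
     (r * (cos (r * (s + p * \<delta>)) / sin (r * (s + p * \<delta>))) * ((a + p * A)\<^sup>2 + (b + p * B)\<^sup>2)
      + (y \<bullet> y + 2 * p * (y \<bullet> Y) + p\<^sup>2 * (Y \<bullet> Y) - (b + p * B)\<^sup>2) / (s + p * \<delta>)))"
  have "G 0 \<le> G 1"
  proof (rule DERIV_nonneg_imp_nondecreasing[where f = G])
    fix p :: real assume p: "0 \<le> p" "p \<le> 1"
    define S where "S = s + p * \<delta>"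
    have S: "S > 0" "r * S < pi" "0 < r * S"
    proof -
      have "p * \<delta> \<le> \<delta>" "0 \<le> p * \<delta>" using p d by auto
      then show "S > 0" using s unfolding S_def by linarith
      then show "0 < r * S" using r by simp
      have "r * S \<le> r * (s + \<delta>)" unfolding S_def using r \<open>p * \<delta> \<le> \<delta>\<close> by simp
      then show "r * S < pi" using pi by linarith
    qed
    define k where "k = r * (cos (r * S) / sin (r * S))"
    have sn: "sin (r * S) > 0" using S sin_gt_zero by blast
    define a' where "a' = a + p * A"
    define b' where "b' = b + p * B"
    define n' where "n' = y \<bullet> y + 2 * p * (y \<bullet> Y) + p\<^sup>2 * (Y \<bullet> Y)"
    define G' where "G' = \<Lambda>\<^sup>2 * \<delta> - 2 * r * (b * A - a * B)
      + (r\<^sup>2 + k\<^sup>2) * \<delta> * (a'\<^sup>2 + b'\<^sup>2) - 2 * k * (a' * A + b' * B)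
      - 2 * (y \<bullet> Y + p * (Y \<bullet> Y) - b' * B) / S + (n' - b'\<^sup>2) * \<delta> / S\<^sup>2"
    have kd: "((\<lambda>p. r * (cos (r * (s + p * \<delta>)) / sin (r * (s + p * \<delta>)))) has_real_derivative
        - ((r\<^sup>2 + k\<^sup>2) * \<delta>)) (at p)"
    proof -
      have sd: "((\<lambda>p. r * (s + p * \<delta>)) has_real_derivative r * \<delta>) (at p)"
        by (auto intro!: derivative_eq_intros)
      have "((\<lambda>p. r * (cos (r * (s + p * \<delta>)) / sin (r * (s + p * \<delta>)))) has_real_derivative
         r * ((- sin (r * (s + p * \<delta>)) * (r * \<delta>) * sin (r * (s + p * \<delta>)) - cos (r * (s + p * \<delta>)) * (cos (r * (s + p * \<delta>)) * (r * \<delta>)))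
           / (sin (r * (s + p * \<delta>)) * sin (r * (s + p * \<delta>))))) (at p)"
        using sn unfolding S_def
        by (intro DERIV_cmult DERIV_divide DERIV_fun_sin DERIV_fun_cos sd) auto
      also have "r * ((- sin (r * (s + p * \<delta>)) * (r * \<delta>) * sin (r * (s + p * \<delta>)) - cos (r * (s + p * \<delta>)) * (cos (r * (s + p * \<delta>)) * (r * \<delta>)))
           / (sin (r * (s + p * \<delta>)) * sin (r * (s + p * \<delta>)))) = - ((r\<^sup>2 + k\<^sup>2) * \<delta>)"
        using sn unfolding k_def S_def[symmetric] by (simp add: field_simps power2_eq_square)
      finally show ?thesis .
    qed
    have qd: "((\<lambda>p. (a + p * A)\<^sup>2 + (b + p * B)\<^sup>2) has_real_derivative 2 * (a' * A + b' * B)) (at p)"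
      by (auto intro!: derivative_eq_intros simp: a'_def b'_def algebra_simps)
    have nd: "((\<lambda>p. y \<bullet> y + 2 * p * (y \<bullet> Y) + p\<^sup>2 * (Y \<bullet> Y) - (b + p * B)\<^sup>2) has_real_derivative
        2 * (y \<bullet> Y + p * (Y \<bullet> Y) - b' * B)) (at p)"
      by (auto intro!: derivative_eq_intros simp: a'_def b'_def algebra_simps)
    have sd: "((\<lambda>p. s + p * \<delta>) has_real_derivative \<delta>) (at p)"
      by (auto intro!: derivative_eq_intros)
    have ld: "((\<lambda>p. \<Lambda>\<^sup>2 * \<delta> * p - 2 * r * p * (b * A - a * B)) has_real_derivative
        \<Lambda>\<^sup>2 * \<delta> - 2 * r * (b * A - a * B)) (at p)"
      by (auto intro!: derivative_eq_intros)
    have S0: "s + p * \<delta> \<noteq> 0" using S by (simp add: S_def)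
    have "(G has_real_derivative (\<Lambda>\<^sup>2 * \<delta> - 2 * r * (b * A - a * B)
       - (- ((r\<^sup>2 + k\<^sup>2) * \<delta>) * ((a + p * A)\<^sup>2 + (b + p * B)\<^sup>2)
           + 2 * (a' * A + b' * B) * (r * (cos (r * (s + p * \<delta>)) / sin (r * (s + p * \<delta>))))
         + (2 * (y \<bullet> Y + p * (Y \<bullet> Y) - b' * B) * (s + p * \<delta>)
            - (y \<bullet> y + 2 * p * (y \<bullet> Y) + p\<^sup>2 * (Y \<bullet> Y) - (b + p * B)\<^sup>2) * \<delta>) / ((s + p * \<delta>) * (s + p * \<delta>))))) (at p)"
      unfolding G_def by (intro DERIV_diff ld DERIV_add DERIV_mult kd qd DERIV_divide nd sd S0)
    also have "(\<Lambda>\<^sup>2 * \<delta> - 2 * r * (b * A - a * B)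
       - (- ((r\<^sup>2 + k\<^sup>2) * \<delta>) * ((a + p * A)\<^sup>2 + (b + p * B)\<^sup>2)
           + 2 * (a' * A + b' * B) * (r * (cos (r * (s + p * \<delta>)) / sin (r * (s + p * \<delta>))))
         + (2 * (y \<bullet> Y + p * (Y \<bullet> Y) - b' * B) * (s + p * \<delta>)
            - (y \<bullet> y + 2 * p * (y \<bullet> Y) + p\<^sup>2 * (Y \<bullet> Y) - (b + p * B)\<^sup>2) * \<delta>) / ((s + p * \<delta>) * (s + p * \<delta>)))) = G'"
      unfolding G'_def S_def[symmetric] k_def[symmetric] a'_def[symmetric] b'_def[symmetric] n'_def[symmetric]
      using S(1) by (simp add: field_simps power2_eq_square)
    finally have der: "(G has_real_derivative G') (at p)" .
    \<comment> \<open>On the kernel of U the Riccati solution is 1/s; \<open>Z\<close> is \<delta>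
      times velocity minus radial field. Removing its component along \<open>e\<close>, which
      belongs to the rotating plane, leaves a nonnegative square by Cauchy-Schwarz.\<close>
    define Z where "Z = Y - (\<delta> / S) *\<^sub>R (y + p *\<^sub>R Y)"
    have ZZ: "Z \<bullet> Z = Y \<bullet> Y - 2 * (\<delta> / S) * (y \<bullet> Y + p * (Y \<bullet> Y)) + (\<delta> / S)\<^sup>2 * n'"
      unfolding Z_def n'_def
      by (simp add: inner_simps algebra_simps power2_eq_square inner_commute)
    have Ze: "Z \<bullet> e = B - (\<delta> / S) * b'"
      unfolding Z_def B_def b'_def b_def by (simp add: inner_simps)
    have "(Z \<bullet> e)\<^sup>2 \<le> Z \<bullet> Z" 
      using Cauchy_Schwarz_ineq[of Z e] e by (simp add: dot_square_norm)
    then have Zp: "0 \<le> Y \<bullet> Y - 2 * (\<delta> / S) * (y \<bullet> Y + p * (Y \<bullet> Y)) + (\<delta> / S)\<^sup>2 * n' - (B - (\<delta> / S) * b')\<^sup>2"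
      by (simp add: ZZ Ze)
    have "(norm D)\<^sup>2 \<le> (\<Lambda> * \<delta>)\<^sup>2" using D by (intro power_mono) auto
    then have Dp: "A\<^sup>2 + Y \<bullet> Y \<le> \<Lambda>\<^sup>2 * \<delta>\<^sup>2"
      by (simp add: DA norm_Pair power_mult_distrib power2_norm_eq_inner)
    define q where "q = \<delta> / S"
    have "\<delta> * G' = \<Lambda>\<^sup>2 * \<delta>\<^sup>2 - 2 * r * \<delta> * (b * A - a * B)
      + (r\<^sup>2 + k\<^sup>2) * \<delta>\<^sup>2 * (a'\<^sup>2 + b'\<^sup>2) - 2 * k * \<delta> * (a' * A + b' * B)
      - 2 * (y \<bullet> Y + p * (Y \<bullet> Y) - b' * B) * q + (n' - b'\<^sup>2) * q\<^sup>2"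
      unfolding G'_def q_def using S(1) by (simp add: field_simps power2_eq_square)
    \<comment> \<open>The first bracket is the slack in the speed bound. The two middle squares are
      the components of x' - (A + S) x along (1,0) and (0,e), and the last bracket is the part
      orthogonal to this plane.\<close>
    also have "\<dots> = (\<Lambda>\<^sup>2 * \<delta>\<^sup>2 - (A\<^sup>2 + Y \<bullet> Y)) + (A - k * \<delta> * a' - r * \<delta> * b')\<^sup>2 + (B - k * \<delta> * b' + r * \<delta> * a')\<^sup>2
      + (Y \<bullet> Y - 2 * q * (y \<bullet> Y + p * (Y \<bullet> Y)) + q\<^sup>2 * n' - (B - q * b')\<^sup>2)"
      unfolding a'_def b'_def by (simp add: power2_eq_square algebra_simps)
    also have "\<dots> \<ge> 0" using Dp Zp unfolding q_def[symmetric] by (intro add_nonneg_nonneg zero_le_power2) auto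
    finally have "G' \<ge> 0" using d by (simp add: zero_le_mult_iff)
    with der show "\<exists>y. (G has_real_derivative y) (at p) \<and> 0 \<le> y" by blast
  qed simp
  moreover have "G 0 = - riccati_form r e s x"
    by (simp add: G_def riccati_form_def x cot_def b_def power2_norm_eq_inner)
  moreover have "G 1 = \<Lambda>\<^sup>2 * \<delta> - 2 * r * ((snd x \<bullet> e) * fst D - fst x * (snd D \<bullet> e)) - riccati_form r e (s + \<delta>) (x + D)"
    by (simp add: G_def riccati_form_def x DA cot_def b_def B_def power2_norm_eq_inner inner_simps inner_commute)
  ultimately show ?thesis by linarith
qed

lemma isCont_riccati_form:
  fixes e :: "real^'n"
  assumes "0 < r" "r < pi"
  shows "isCont (\<lambda>s. riccati_form r e s x) 1"
proof -
  have "sin r > 0" using assms sin_gt_zero by blast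
  then show ?thesis unfolding riccati_form_def by (intro continuous_intros) auto
qed

text \<open>
The curve is replaced by inscribed polygons, whose error in \<open>t\<close> is at most the sum of the squared arc lengths of the pieces.
Starting the Riccati solution at time \<open>\<epsilon>\<close> avoids its pole at \<open>0\<close>, and \<open>\<eta>\<close> keeps the arc-length parameter strictly increasing.
\<close>

lemma riccati_form_le_length:
  fixes g :: "('n::finite) Kpt" and \<tau> :: "real^'n"
  assumes \<gamma>: "\<gamma> \<in> horiz_curves g" and \<tau>: "\<tau> \<noteq> 0" "norm \<tau> < pi"
  defines "L \<equiv> integral {0..1} (\<lambda>s. norm (hpart (vector_derivative \<gamma> (at s))))"
  shows "riccati_form (norm \<tau>) (sgn \<tau>) 1 (hpart g) + 4 * (vpart g \<bullet> \<tau>) \<le> L\<^sup>2"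
proof -
  define n where "n = (\<lambda>s. norm (hpart (vector_derivative \<gamma> (at s))))"
  define r where "r = norm \<tau>"
  define e where "e = sgn \<tau>"
  have r: "0 < r" "r < pi" and e: "norm e = 1" and re: "\<tau> = r *\<^sub>R e"
    using \<tau> by (auto simp: r_def e_def norm_sgn sgn_div_norm)
  note est = horiz_curve_estimates[OF \<gamma>, folded n_def]
  define x where "x = (\<lambda>s. hpart (\<gamma> s))"
  define t where "t = (\<lambda>s. vpart (\<gamma> s))"
  define l where "l = (\<lambda>s. integral {0..s} n)"
  have nint: "n integrable_on {a..b}" if "0 \<le> a" "b \<le> 1" for a b
    by (rule integrable_on_subinterval[OF est(1)]) (use that in auto)
  have n0: "n s \<ge> 0" for s by (simp add: n_def)
  have L0: "L \<ge> 0" unfolding L_def by (fold n_def, rule integral_nonneg[OF est(1)]) (simp add: n0)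
  have lab: "integral {a..b} n = l b - l a" if "0 \<le> a" "a \<le> b" "b \<le> 1" for a b
    using Henstock_Kurzweil_Integration.integral_combine[of 0 a b n] nint[of 0 b] that by (simp add: l_def)
  have l01: "l 0 = 0" "l 1 = L" by (simp_all add: l_def L_def n_def)
  have x01: "x 0 = 0" "x 1 = hpart g" "t 0 = 0" "t 1 = vpart g"
    using \<gamma> by (auto simp: horiz_curves_def x_def t_def hpart_def vpart_def zero_prod_def)
  have main: "riccati_form r e (1 + \<epsilon>) (hpart g) + 4 * (vpart g \<bullet> \<tau>) \<le> (L + \<eta>)\<^sup>2 + 4 * r * (\<omega> * L)"
    if \<epsilon>: "\<epsilon> > 0" "r * (1 + \<epsilon>) < pi" and \<eta>: "\<eta> > 0" and \<omega>: "\<omega> > 0" for \<epsilon> \<eta> \<omega>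
  proof -
    have "uniformly_continuous_on {0..1} l"
      unfolding l_def by (intro compact_uniformly_continuous indefinite_integral_continuous_1 est(1)) auto
    then obtain d where d: "d > 0" "\<And>u v. \<lbrakk>u \<in> {0..1}; v \<in> {0..1}; dist v u < d\<rbrakk> \<Longrightarrow> dist (l v) (l u) < \<omega>"
      unfolding uniformly_continuous_on_def using \<omega> by metis
    obtain N :: nat where N: "1 / d < real N" using reals_Archimedean2 by blast
    have "N > 0" using N d(1) by (intro gr0I) auto
    with N d(1) have Np: "N > 0" "1 / real N < d" by (auto simp: field_simps)
    define p where "p = (\<lambda>i. real i / real N)"
    have p: "0 \<le> p i" "p i \<le> p (Suc i)" "p (Suc i) \<le> 1" "p (Suc i) - p i = 1 / N" if "i < N" for i
      using that Np by (auto simp: p_def field_simps)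
    have pN: "p 0 = 0" "p N = 1" using Np by (auto simp: p_def)
    define li where "li = (\<lambda>i. l (p (Suc i)) - l (p i))"
    have li: "0 \<le> li i" "li i \<le> \<omega>" if "i < N" for i
    proof -
      note pi = p[OF that]
      have "0 \<le> integral {p i..p (Suc i)} n" by (rule integral_nonneg[OF nint[OF pi(1,3)]]) (simp add: n0)
      then show "0 \<le> li i" using lab[OF pi(1-3)] by (simp add: li_def)
      have "dist (l (p (Suc i))) (l (p i)) < \<omega>" using pi Np by (intro d) (auto simp: dist_real_def)
      then show "li i \<le> \<omega>" by (auto simp: li_def dist_real_def)
    qed
    define \<Lambda> where "\<Lambda> = L + \<eta>"
    have \<Lambda>: "\<Lambda> > 0" using L0 \<eta> by (simp add: \<Lambda>_def)
    \<comment> \<open>Normalized arc length, tilted by \<open>\<eta> * p i\<close> so that it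
      advances even where the curve rests. The division by \<Lambda> = L + \<eta> makes it run from
      \<epsilon> to 1 + \<epsilon>.\<close>
    define \<sigma> where "\<sigma> = (\<lambda>i. \<epsilon> + (l (p i) + \<eta> * p i) / \<Lambda>)"
    define D where "D = (\<lambda>i. x (p (Suc i)) - x (p i))"
    define V where "V = (\<lambda>i. riccati_form r e (\<sigma> i) (x (p i)))"
    define T where "T = (\<lambda>i. t (p (Suc i)) - t (p i))"
    have Dle: "norm (D i) \<le> li i" "norm (T i - (1/2) *\<^sub>R Ubr (x (p i)) (D i)) \<le> (li i)\<^sup>2" if "i < N" for i
      using est(2)[OF p(1-3)[OF that]] est(3)[OF p(1-3)[OF that]] lab[OF p(1-3)[OF that]]
      by (simp_all add: D_def T_def x_def t_def li_def)
    have lmono: "l a \<le> l b" if "0 \<le> a" "a \<le> b" "b \<le> 1" for a b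
      using lab[OF that] integral_nonneg[OF nint[of a b]] that n0 by fastforce
    have \<sigma>inc: "\<sigma> (Suc i) - \<sigma> i = (li i + \<eta> / N) / \<Lambda>" if "i < N" for i
      using p(4)[OF that] by (simp add: \<sigma>_def li_def diff_divide_distrib add_divide_distrib algebra_simps)
    have step: "V (Suc i) - V i \<le> \<Lambda>\<^sup>2 * (\<sigma> (Suc i) - \<sigma> i) - 4 * (T i \<bullet> \<tau>) + 4 * r * (\<omega> * li i)"
      if i: "i < N" for i
    proof -
      have inc: "\<sigma> (Suc i) - \<sigma> i > 0" unfolding \<sigma>inc[OF i] using li(1)[OF i] \<eta> Np \<Lambda> by (intro divide_pos_pos add_nonneg_pos) auto
      have s0: "\<sigma> i > 0" unfolding \<sigma>_def
        using \<epsilon> \<eta> \<Lambda> lmono[of 0 "p i"] p[OF i] l01 by (intro add_pos_nonneg divide_nonneg_pos) auto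
      have "l (p (Suc i)) + \<eta> * p (Suc i) \<le> \<Lambda>"
        unfolding \<Lambda>_def using lmono[of "p (Suc i)" 1] p[OF i] l01 \<eta> mult_left_mono[of "p (Suc i)" 1 \<eta>] by linarith
      then have "\<sigma> (Suc i) \<le> 1 + \<epsilon>" unfolding \<sigma>_def using \<Lambda> by simp
      then have "r * \<sigma> (Suc i) \<le> r * (1 + \<epsilon>)" using r by simp
      then have sp: "r * (\<sigma> i + (\<sigma> (Suc i) - \<sigma> i)) < pi" using \<epsilon> by simp
      have "\<Lambda> * (\<sigma> (Suc i) - \<sigma> i) = li i + \<eta> / N" unfolding \<sigma>inc[OF i] using \<Lambda> by simp
      then have "norm (D i) \<le> \<Lambda> * (\<sigma> (Suc i) - \<sigma> i)" using Dle(1)[OF i] divide_nonneg_nonneg[of \<eta> "real N"] \<eta> by linarith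
      from riccati_form_segment[OF e r(1) s0 inc sp this, of "x (p i)"]
      have 1: "V (Suc i) - V i \<le> \<Lambda>\<^sup>2 * (\<sigma> (Suc i) - \<sigma> i) - 2 * r * ((snd (x (p i)) \<bullet> e) * fst (D i) - fst (x (p i)) * (snd (D i) \<bullet> e))"
        by (simp add: V_def D_def)
      have 2: "r * ((snd (x (p i)) \<bullet> e) * fst (D i) - fst (x (p i)) * (snd (D i) \<bullet> e)) = Ubr (x (p i)) (D i) \<bullet> \<tau>"
        by (simp add: re Ubr_eq inner_simps algebra_simps)
      have "\<bar>(T i - (1/2) *\<^sub>R Ubr (x (p i)) (D i)) \<bullet> \<tau>\<bar> \<le> norm (T i - (1/2) *\<^sub>R Ubr (x (p i)) (D i)) * r"
        unfolding r_def by (rule Cauchy_Schwarz_ineq2)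
      also have "\<dots> \<le> (li i)\<^sup>2 * r" using Dle(2)[OF i] r by (intro mult_right_mono) auto
      \<comment> \<open>One of the two factors is bounded by the mesh \<omega>, so that the errors
        sum to a multiple of \<omega> L.\<close>
      also have "\<dots> \<le> \<omega> * li i * r" unfolding power2_eq_square using li[OF i] r by (intro mult_right_mono) auto
      finally have "T i \<bullet> \<tau> - (Ubr (x (p i)) (D i) \<bullet> \<tau>) / 2 \<le> \<omega> * li i * r" by (simp add: inner_simps)
      then show ?thesis using 1 2 by (simp add: algebra_simps)
    qed
    have "(\<Sum>i<N. V (Suc i) - V i) \<le> (\<Sum>i<N. \<Lambda>\<^sup>2 * (\<sigma> (Suc i) - \<sigma> i) - 4 * (T i \<bullet> \<tau>) + 4 * r * (\<omega> * li i))"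
      by (rule sum_mono) (use step in auto)
    also have "\<dots> = \<Lambda>\<^sup>2 * (\<Sum>i<N. \<sigma> (Suc i) - \<sigma> i) - 4 * ((\<Sum>i<N. T i) \<bullet> \<tau>) + 4 * r * (\<omega> * (\<Sum>i<N. li i))"
      by (simp only: sum.distrib sum_subtractf[of "\<lambda>i. \<Lambda>\<^sup>2 * (\<sigma> (Suc i) - \<sigma> i)"] sum_distrib_left inner_sum_left)
    finally have "V N - V 0 \<le> \<Lambda>\<^sup>2 * (\<sigma> N - \<sigma> 0) - 4 * ((t 1 - t 0) \<bullet> \<tau>) + 4 * r * (\<omega> * (l 1 - l 0))"
      unfolding T_def li_def sum_lessThan_telescope[of "\<lambda>i. t (p i)"] sum_lessThan_telescope[of "\<lambda>i. l (p i)"]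
        sum_lessThan_telescope[of V] sum_lessThan_telescope[of \<sigma>] pN .
    moreover have "\<sigma> N = 1 + \<epsilon>" "\<sigma> 0 = \<epsilon>" using \<Lambda> by (simp_all add: \<sigma>_def pN l01 \<Lambda>_def)
    moreover have "V 0 = 0" by (simp add: V_def pN x01 riccati_form_def)
    ultimately show ?thesis by (simp add: V_def pN x01 l01 \<Lambda>_def)
  qed
  have main2: "riccati_form r e (1 + \<epsilon>) (hpart g) + 4 * (vpart g \<bullet> \<tau>) \<le> L\<^sup>2"
    if \<epsilon>: "\<epsilon> > 0" "r * (1 + \<epsilon>) < pi" for \<epsilon>
  proof (rule tendsto_lowerbound)
    \<comment> \<open>The auxiliary quantities \<eta> and \<omega> tend to 0 together as the single
      variable \<open>h\<close>.\<close>
    show "((\<lambda>h. (L + h)\<^sup>2 + 4 * r * (h * L)) \<longlongrightarrow> L\<^sup>2) (at_right 0)"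
      by (auto intro!: tendsto_eq_intros)
    show "\<forall>\<^sub>F h in at_right 0. riccati_form r e (1 + \<epsilon>) (hpart g) + 4 * (vpart g \<bullet> \<tau>) \<le> (L + h)\<^sup>2 + 4 * r * (h * L)"
      unfolding eventually_at_right_field using main[OF \<epsilon>] by (auto intro!: exI[of _ 1])
  qed auto
  have "((\<lambda>h. riccati_form r e (1 + h) (hpart g)) \<longlongrightarrow> riccati_form r e 1 (hpart g)) (at 0)"
    using isCont_riccati_form[OF r, of e "hpart g"] unfolding isCont_def by (rule LIM_offset_zero)
  then have lim: "((\<lambda>h. riccati_form r e (1 + h) (hpart g) + 4 * (vpart g \<bullet> \<tau>)) \<longlongrightarrow> riccati_form r e 1 (hpart g) + 4 * (vpart g \<bullet> \<tau>)) (at_right 0)"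
    by (intro tendsto_add tendsto_const) (rule filterlim_mono[OF _ order_refl at_le], auto)
  have "riccati_form r e 1 (hpart g) + 4 * (vpart g \<bullet> \<tau>) \<le> L\<^sup>2"
  proof (rule tendsto_upperbound[OF lim])
    have "0 < pi / r - 1" using r by (simp add: field_simps)
    then show "\<forall>\<^sub>F h in at_right 0. riccati_form r e (1 + h) (hpart g) + 4 * (vpart g \<bullet> \<tau>) \<le> L\<^sup>2"
      unfolding eventually_at_right_field
    proof (intro exI[of _ "pi / r - 1"] conjI allI impI)
      fix y :: real assume "0 < y" "y < pi / r - 1"
      then show "riccati_form r e (1 + y) (hpart g) + 4 * (vpart g \<bullet> \<tau>) \<le> L\<^sup>2"
        using r by (intro main2) (auto simp: field_simps)
    qed
  qed auto
  then show ?thesis by (simp add: r_def e_def)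
qed

lemma phiK_le_length_sq:
  fixes g :: "('n::finite) Kpt"
  assumes \<gamma>: "\<gamma> \<in> horiz_curves g" and \<tau>: "\<tau> \<in> OmegaK"
  shows "phiK g \<tau> \<le> (integral {0..1} (\<lambda>s. norm (hpart (vector_derivative \<gamma> (at s)))))\<^sup>2"
proof (cases "\<tau> = 0")
  case True
  \<comment> \<open>At 0 there is no axis and no Riccati form; the claim reduces to the fact that
    the horizontal projection is no shorter than its chord.\<close>
  have "norm (hpart g) \<le> integral {0..1} (\<lambda>s. norm (hpart (vector_derivative \<gamma> (at s))))"
    using horiz_curve_estimates(2)[OF \<gamma>, of 0 1] \<gamma>
    by (simp add: horiz_curves_def hpart_def zero_prod_def)
  then have "(norm (hpart g))\<^sup>2 \<le> (integral {0..1} (\<lambda>s. norm (hpart (vector_derivative \<gamma> (at s)))))\<^sup>2"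
    by (intro power_mono) auto
  then show ?thesis
    by (cases g) (simp add: True phiK_def hpart_def norm_Pair fK_def)
next
  case False
  then have \<tau>': "norm \<tau> < pi" "norm \<tau> > 0" using \<tau> by (auto simp: OmegaK_def)
  obtain x1 xs t where g: "g = (x1, xs, t)" by (cases g)
  have s: "\<tau> = norm \<tau> *\<^sub>R sgn \<tau>" using False by (simp add: sgn_div_norm)
  have "phiK g \<tau> = riccati_form (norm \<tau>) (sgn \<tau>) 1 (hpart g) + 4 * (vpart g \<bullet> \<tau>)"
    using \<tau>' unfolding g phiK_def riccati_form_def hpart_def vpart_def psiK_def fK_def
    by (simp add: sgn_div_norm inner_commute) (simp add: field_simps power2_eq_square)
  then show ?thesis using riccati_form_le_length[OF \<gamma> False \<tau>'(1)] by simp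
qed

section \<open>The upper bound: explicit curves\<close>

lemma abs_cont_on_Lipschitz:
  fixes f :: "real \<Rightarrow> 'a::real_normed_vector"
  assumes lip: "\<And>u v. a \<le> u \<Longrightarrow> u \<le> v \<Longrightarrow> v \<le> b \<Longrightarrow> norm (f v - f u) \<le> C * (v - u)"
  shows "abs_cont_on a b f"
  unfolding abs_cont_on_def
proof (intro allI impI)
  fix \<epsilon> :: real assume \<epsilon>: "\<epsilon> > 0"
  define B where "B = \<bar>C\<bar> + 1"
  have B: "B > 0" "C \<le> B" by (auto simp: B_def)
  show "\<exists>\<delta>>0. \<forall>D. finite D \<and> (\<forall>(u,v)\<in>D. a \<le> u \<and> u \<le> v \<and> v \<le> b) \<and>
      pairwise (\<lambda>(u,v) (u',v'). {u<..<v} \<inter> {u'<..<v'} = {}) D \<and> (\<Sum>(u,v)\<in>D. v - u) < \<delta>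
      \<longrightarrow> (\<Sum>(u,v)\<in>D. norm (f v - f u)) < \<epsilon>"
  proof (intro exI[of _ "\<epsilon> / B"] conjI allI impI)
    show "\<epsilon> / B > 0" using \<epsilon> B by simp
    fix D :: "(real \<times> real) set"
    assume D: "finite D \<and> (\<forall>(u,v)\<in>D. a \<le> u \<and> u \<le> v \<and> v \<le> b) \<and>
      pairwise (\<lambda>(u,v) (u',v'). {u<..<v} \<inter> {u'<..<v'} = {}) D \<and> (\<Sum>(u,v)\<in>D. v - u) < \<epsilon> / B"
    have "(\<Sum>(u,v)\<in>D. norm (f v - f u)) \<le> (\<Sum>(u,v)\<in>D. B * (v - u))"
    proof (rule sum_mono)
      fix p assume p: "p \<in> D"
      obtain u v where uv: "p = (u, v)" by (cases p)
      have "norm (f v - f u) \<le> C * (v - u)" using D p uv by (intro lip) auto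
      also have "\<dots> \<le> B * (v - u)" using D p uv B by (intro mult_right_mono) auto
      finally show "(case p of (u,v) \<Rightarrow> norm (f v - f u)) \<le> (case p of (u,v) \<Rightarrow> B * (v - u))" by (simp add: uv)
    qed
    also have "\<dots> = B * (\<Sum>(u,v)\<in>D. v - u)" by (simp add: sum_distrib_left split_def)
    also have "\<dots> < \<epsilon>" using D B by (simp add: field_simps)
    finally show "(\<Sum>(u,v)\<in>D. norm (f v - f u)) < \<epsilon>" .
  qed
qed

lemma length_nonneg:
  fixes g :: "('n::finite) Kpt"
  assumes "\<gamma> \<in> horiz_curves g"
  shows "0 \<le> integral {0..1} (\<lambda>s. norm (hpart (vector_derivative \<gamma> (at s))))"
  by (rule integral_nonneg[OF horiz_curve_estimates(1)[OF assms]]) auto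

lemma ccdist_le_smooth_curve:
  fixes g :: "('n::finite) Kpt"
  assumes der: "\<And>s. (\<gamma> has_vector_derivative \<gamma>' s) (at s)"
    and cont: "continuous_on {0..1} \<gamma>'" and ends: "\<gamma> 0 = 0" "\<gamma> 1 = g"
    and horiz: "\<And>s. vpart (\<gamma>' s) = (1/2) *\<^sub>R Ubr (hpart (\<gamma> s)) (hpart (\<gamma>' s))"
    and speed: "\<And>s. norm (hpart (\<gamma>' s)) = c"
  shows "horiz_curves g \<noteq> {}" "0 \<le> c" "ccdist g \<le> c"
proof -
  have vd: "vector_derivative \<gamma> (at s) = \<gamma>' s" for s using der by (rule vector_derivative_at)
  have "bounded (\<gamma>' ` {0..1})" using cont compact_continuous_image compact_imp_bounded by blast
  then obtain C where C: "\<And>s. s \<in> {0..1} \<Longrightarrow> norm (\<gamma>' s) \<le> C" unfolding bounded_iff by blast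
  have "abs_cont_on 0 1 \<gamma>"
  proof (rule abs_cont_on_Lipschitz[where C=C])
    fix u v :: real assume uv: "0 \<le> u" "u \<le> v" "v \<le> 1"
    have "norm (\<gamma> v - \<gamma> u) \<le> C * norm (v - u)"
    proof (rule differentiable_bound[where S="{0..1}" and f'="\<lambda>s h. h *\<^sub>R \<gamma>' s"])
      fix s :: real assume "s \<in> {0..1}"
      show "(\<gamma> has_derivative (\<lambda>h. h *\<^sub>R \<gamma>' s)) (at s within {0..1})"
        using der[of s] by (simp add: has_vector_derivative_def has_derivative_at_withinI)
      show "onorm (\<lambda>h. h *\<^sub>R \<gamma>' s) \<le> C"
        by (rule onorm_le) (use C[OF \<open>s \<in> {0..1}\<close>] in \<open>simp add: mult.commute[of C] mult_left_mono\<close>)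
    qed (use uv in auto)
    then show "norm (\<gamma> v - \<gamma> u) \<le> C * (v - u)" using uv by simp
  qed
  moreover have "\<gamma> differentiable (at s)" for s
    using der[of s] differentiableI_vector by blast
  ultimately have mem: "\<gamma> \<in> horiz_curves g"
    unfolding horiz_curves_def using ends horiz by (auto simp: vd)
  then show "horiz_curves g \<noteq> {}" by auto
  show "0 \<le> c" using speed[of 0] by (metis norm_ge_zero)
  have "ccdist g \<le> integral {0..1} (\<lambda>s. norm (hpart (vector_derivative \<gamma> (at s))))"
    unfolding ccdist_def using mem by (intro cInf_lower bdd_belowI[where m=0]) (auto intro: length_nonneg)
  also have "\<dots> = c" by (simp add: vd speed)
  finally show "ccdist g \<le> c" .
qed

text \<open>\<open>ccdist\<close> is an infimum of reals and says nothing when there is no curve, so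
  nonemptiness is recorded along with the bound. The sign of \<open>c\<close> allows the bound to be
  squared.\<close>

definition reachable :: "('n::finite) Kpt \<Rightarrow> real \<Rightarrow> bool" where
  "reachable g c \<longleftrightarrow> horiz_curves g \<noteq> {} \<and> 0 \<le> c \<and> ccdist g \<le> c"

lemma reachable_line: "reachable (x1, xs :: real^'n::finite, 0) (sqrt (x1\<^sup>2 + (norm xs)\<^sup>2))"
proof -
  let ?\<gamma> = "\<lambda>s::real. (s * x1, s *\<^sub>R xs, 0 :: real^'n)"
  let ?d = "\<lambda>s::real. (x1, xs, 0 :: real^'n)"
  have 1: "(?\<gamma> has_vector_derivative ?d s) (at s)" for s
    by (intro has_vector_derivative_Pair) (auto intro!: derivative_eq_intros has_vector_derivative_real_field simp: has_vector_derivative_def)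
  show ?thesis unfolding reachable_def
    using ccdist_le_smooth_curve[OF 1, of "(x1, xs, 0)" "sqrt (x1\<^sup>2 + (norm xs)\<^sup>2)"]
    by (simp add: zero_prod_def hpart_def vpart_def Ubr_eq norm_Pair)
qed

text \<open>
The curve solves \<open>x'' = 2Ax'\<close> with \<open>\<theta> = r e\<close> and initial velocity \<open>(\<alpha>, \<beta> e + w)\<close>.
\<close>

lemma reachable_geodesic:
  fixes e w :: "real^'n::finite"
  assumes r: "r > 0" and e: "norm e = 1" and we: "w \<bullet> e = 0"
  shows "reachable ((\<alpha> * sin (2*r) + \<beta> * (1 - cos (2*r))) / (2*r),
     ((\<beta> * sin (2*r) - \<alpha> * (1 - cos (2*r))) / (2*r)) *\<^sub>R e + w,
     ((\<alpha>\<^sup>2 + \<beta>\<^sup>2) / (4*r) * (1 - sin (2*r) / (2*r))) *\<^sub>R e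
      + ((\<alpha> * sin (2*r) + \<beta> * (1 - cos (2*r))) / (4*r)
         - (\<alpha> * (1 - cos (2*r)) / (2*r) + \<beta> * (1 - sin (2*r) / (2*r))) / (2*r)) *\<^sub>R w)
     (sqrt (\<alpha>\<^sup>2 + \<beta>\<^sup>2 + (norm w)\<^sup>2))" (is "reachable ?g ?c")
proof -
  define a where "a = (\<lambda>s. (\<alpha> * sin (2*r* s) + \<beta> * (1 - cos (2*r* s))) / (2*r))"
  define b where "b = (\<lambda>s. (\<beta> * sin (2*r* s) - \<alpha> * (1 - cos (2*r* s))) / (2*r))"
  \<comment> \<open>\<open>p\<close> and \<open>q\<close> are the components of t along
    \<open>e\<close> and \<open>w\<close>; their derivatives are forced by horizontality.\<close>
  define p where "p = (\<lambda>s. (\<alpha>\<^sup>2 + \<beta>\<^sup>2) / (4*r) * (s - sin (2*r* s) / (2*r)))"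
  define q where "q = (\<lambda>s. s * a s / 2 - (\<alpha> * (1 - cos (2*r* s)) / (2*r) + \<beta> * (s - sin (2*r* s) / (2*r))) / (2*r))"
  define a' where "a' = (\<lambda>s. \<alpha> * cos (2*r* s) + \<beta> * sin (2*r* s))"
  define b' where "b' = (\<lambda>s. \<beta> * cos (2*r* s) - \<alpha> * sin (2*r* s))"
  define p' where "p' = (\<lambda>s. (\<alpha>\<^sup>2 + \<beta>\<^sup>2) / (4*r) * (1 - cos (2*r* s)))"
  define q' where "q' = (\<lambda>s. (s * a' s - a s) / 2)"
  have da: "(a has_real_derivative a' s) (at s)" for s
    unfolding a_def a'_def using r by (auto intro!: derivative_eq_intros simp: field_simps)
  have db: "(b has_real_derivative b' s) (at s)" for s
    unfolding b_def b'_def using r by (auto intro!: derivative_eq_intros simp: field_simps)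
  have dp: "(p has_real_derivative p' s) (at s)" for s
    unfolding p_def p'_def using r by (auto intro!: derivative_eq_intros simp: field_simps)
  have dq: "(q has_real_derivative q' s) (at s)" for s
  proof -
    have "(q has_real_derivative ((1 * a s + a' s * s) / 2 - (\<alpha> * sin (2*r* s) + \<beta> * (1 - cos (2*r* s))) / (2*r))) (at s)"
      unfolding q_def using r
      by (intro DERIV_diff DERIV_cdivide DERIV_mult DERIV_ident da DERIV_add)
         (auto intro!: derivative_eq_intros simp: field_simps)
    then show ?thesis by (rule DERIV_cong) (simp add: q'_def a_def field_simps)
  qed
  \<comment> \<open>The area swept in the rotating plane grows like 1 - cos(2rs): this is the
    horizontality equation along \<open>e\<close>.\<close>
  have ch: "(b s * a' s - a s * b' s) / 2 = p' s" for s
  proof -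
    define S where "S = sin (2*r* s)"
    define K where "K = cos (2*r* s)"
    have SK: "S\<^sup>2 = 1 - K\<^sup>2" unfolding S_def K_def by (simp add: sin_squared_eq)
    have "b s * a' s - a s * b' s = ((\<beta> * S - \<alpha> * (1 - K)) * (\<alpha> * K + \<beta> * S) - (\<alpha> * S + \<beta> * (1 - K)) * (\<beta> * K - \<alpha> * S)) / (2*r)"
      unfolding a_def b_def a'_def b'_def S_def[symmetric] K_def[symmetric] using r by (simp add: field_simps)
    also have "(\<beta> * S - \<alpha> * (1 - K)) * (\<alpha> * K + \<beta> * S) - (\<alpha> * S + \<beta> * (1 - K)) * (\<beta> * K - \<alpha> * S)
       = (\<alpha>\<^sup>2 + \<beta>\<^sup>2) * (S\<^sup>2 + K\<^sup>2 - K)" by (simp add: algebra_simps power2_eq_square)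
    also have "\<dots> = (\<alpha>\<^sup>2 + \<beta>\<^sup>2) * (1 - K)" by (simp add: SK)
    finally show ?thesis using r unfolding p'_def K_def by (simp add: field_simps)
  qed
  have sp: "(a' s)\<^sup>2 + (b' s)\<^sup>2 = \<alpha>\<^sup>2 + \<beta>\<^sup>2" for s
  proof -
    have "(\<alpha> * c + \<beta> * d)\<^sup>2 + (\<beta> * c - \<alpha> * d)\<^sup>2 = (\<alpha>\<^sup>2 + \<beta>\<^sup>2) * (d\<^sup>2 + c\<^sup>2)" for c d
      by (simp add: algebra_simps power2_eq_square)
    from this[where c="cos (2*r* s)" and d="sin (2*r* s)"] show ?thesis unfolding a'_def b'_def by simp
  qed
  let ?\<gamma> = "\<lambda>s::real. (a s, b s *\<^sub>R e + s *\<^sub>R w, p s *\<^sub>R e + q s *\<^sub>R w)"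
  let ?d = "\<lambda>s::real. (a' s, b' s *\<^sub>R e + w, p' s *\<^sub>R e + q' s *\<^sub>R w)"
  have sc: "((\<lambda>s. f s *\<^sub>R v) has_vector_derivative f' *\<^sub>R v) (at s)"
    if "(f has_real_derivative f') (at s)" for f f' s and v :: "real^'n"
    using has_vector_derivative_scaleR[OF that has_vector_derivative_const, of v] by simp
  have 1: "(?\<gamma> has_vector_derivative ?d s) (at s)" for s
    using sc[OF DERIV_ident, where v=w]
    by (intro has_vector_derivative_Pair has_vector_derivative_add sc da db dp dq)
       (auto simp: da[unfolded has_real_derivative_iff_has_vector_derivative])
  have 2: "continuous_on {0..1} ?d"
    unfolding a'_def b'_def p'_def q'_def a_def using r by (intro continuous_intros) auto
    have h0: "?\<gamma> 0 = 0" by (simp add: a_def b_def p_def q_def zero_prod_def)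
    have h1: "vpart (?d s) = (1/2) *\<^sub>R Ubr (hpart (?\<gamma> s)) (hpart (?d s))" for s
    proof -
      have "(1/2) *\<^sub>R Ubr (hpart (?\<gamma> s)) (hpart (?d s)) = ((b s * a' s - a s * b' s) / 2) *\<^sub>R e + ((s * a' s - a s) / 2) *\<^sub>R w"
        by (simp add: hpart_def Ubr_eq algebra_simps diff_divide_distrib scaleR_diff_left)
      then show ?thesis by (simp add: ch q'_def vpart_def)
    qed
    have h2: "norm (hpart (?d s)) = ?c" for s
    proof -
      have "(norm (b' s *\<^sub>R e + w))\<^sup>2 = (b' s)\<^sup>2 + (norm w)\<^sup>2"
        using e we unfolding power2_norm_eq_inner by (simp add: inner_simps inner_commute norm_eq_1 power2_eq_square)
      then show ?thesis using sp[of s] by (simp add: hpart_def norm_Pair add.assoc[symmetric])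
    qed
  have R: "reachable (?\<gamma> 1) ?c"
    unfolding reachable_def using ccdist_le_smooth_curve[OF 1 2 h0 refl h1 h2] by blast
  have "?\<gamma> 1 = ?g" using r by (simp add: a_def b_def p_def q_def)
  then show ?thesis using R by (simp only:)
qed

lemma reachable_interior:
  fixes e xs :: "real^'n::finite"
  assumes r: "0 < r" "r < pi" and e: "norm e = 1"
  defines "b \<equiv> xs \<bullet> e"
  shows "reachable (x1, xs, ((x1\<^sup>2 + b\<^sup>2) / 4 * ((r - sin r * cos r) / (sin r)\<^sup>2)) *\<^sub>R e
      + (b * (1 - r * cot r) / (2 * r)) *\<^sub>R (xs - b *\<^sub>R e))
     (sqrt ((r / sin r)\<^sup>2 * (x1\<^sup>2 + b\<^sup>2) + (norm xs)\<^sup>2 - b\<^sup>2))"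
proof -
  have sn: "sin r > 0" using r sin_gt_zero by blast
  define w where "w = xs - b *\<^sub>R e"
  have we: "w \<bullet> e = 0" using e by (simp add: w_def inner_simps norm_eq_1 b_def)
  have nw: "(norm w)\<^sup>2 = (norm xs)\<^sup>2 - b\<^sup>2"
    using e unfolding w_def power2_norm_eq_inner b_def by (simp add: inner_simps norm_eq_1 inner_commute power2_eq_square)
  \<comment> \<open>By the double angle formulas the plane part of the endpoint is sin r / r times
    the initial velocity turned by -r. Inverting that map gives this choice: turn the prescribed
    endpoint by r and rescale.\<close>
  define \<alpha> where "\<alpha> = (r / sin r) * (x1 * cos r - b * sin r)"
  define \<beta> where "\<beta> = (r / sin r) * (x1 * sin r + b * cos r)"
  have s2: "sin (2*r) = 2 * sin r * cos r" "1 - cos (2*r) = 2 * (sin r)\<^sup>2"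
    by (simp_all add: sin_double cos_double_sin)
  have cs: "(cos r)\<^sup>2 = 1 - (sin r)\<^sup>2" by (simp add: cos_squared_eq)
  have ab: "\<alpha>\<^sup>2 + \<beta>\<^sup>2 = (r / sin r)\<^sup>2 * (x1\<^sup>2 + b\<^sup>2)"
  proof -
    have "(q * (x1 * c - b * s))\<^sup>2 + (q * (x1 * s + b * c))\<^sup>2 = q\<^sup>2 * ((x1\<^sup>2 + b\<^sup>2) * (s\<^sup>2 + c\<^sup>2))" for q c s
      by (simp add: algebra_simps power2_eq_square)
    from this[where q="r / sin r" and c="cos r" and s="sin r"] show ?thesis unfolding \<alpha>_def \<beta>_def by simp
  qed
  have u1: "\<alpha> * cos r + \<beta> * sin r = (r / sin r) * x1"
  proof -
    have "(q * (x1 * c - b * s)) * c + (q * (x1 * s + b * c)) * s = q * (x1 * (s\<^sup>2 + c\<^sup>2))" for q c s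
      by (simp add: algebra_simps power2_eq_square)
    from this[where q="r / sin r" and c="cos r" and s="sin r"] show ?thesis unfolding \<alpha>_def \<beta>_def by simp
  qed
  have u2: "\<beta> * cos r - \<alpha> * sin r = (r / sin r) * b"
  proof -
    have "(q * (x1 * s + b * c)) * c - (q * (x1 * c - b * s)) * s = q * (b * (s\<^sup>2 + c\<^sup>2))" for q c s
      by (simp add: algebra_simps power2_eq_square)
    from this[where q="r / sin r" and c="cos r" and s="sin r"] show ?thesis unfolding \<alpha>_def \<beta>_def by simp
  qed
  have A: "(\<alpha> * sin (2*r) + \<beta> * (1 - cos (2*r))) / (2*r) = x1"
  proof -
    have "(\<alpha> * sin (2*r) + \<beta> * (1 - cos (2*r))) = 2 * sin r * (\<alpha> * cos r + \<beta> * sin r)"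
      unfolding s2 by (simp add: algebra_simps power2_eq_square)
    then show ?thesis unfolding u1 using r sn by simp
  qed
  have B: "(\<beta> * sin (2*r) - \<alpha> * (1 - cos (2*r))) / (2*r) = b"
  proof -
    have "(\<beta> * sin (2*r) - \<alpha> * (1 - cos (2*r))) = 2 * sin r * (\<beta> * cos r - \<alpha> * sin r)"
      unfolding s2 by (simp add: algebra_simps power2_eq_square)
    then show ?thesis unfolding u2 using r sn by simp
  qed
  have P: "(\<alpha>\<^sup>2 + \<beta>\<^sup>2) / (4*r) * (1 - sin (2*r) / (2*r)) = (x1\<^sup>2 + b\<^sup>2) / 4 * ((r - sin r * cos r) / (sin r)\<^sup>2)"
    unfolding ab s2 using r sn by (simp add: field_simps power2_eq_square)
  have Q: "(\<alpha> * sin (2*r) + \<beta> * (1 - cos (2*r))) / (4*r)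
         - (\<alpha> * (1 - cos (2*r)) / (2*r) + \<beta> * (1 - sin (2*r) / (2*r))) / (2*r) = b * (1 - r * cot r) / (2 * r)"
  proof -
    have "\<alpha> * (1 - cos (2*r)) / (2*r) + \<beta> * (1 - sin (2*r) / (2*r)) = \<beta> - (sin r / r) * (\<beta> * cos r - \<alpha> * sin r)"
      unfolding s2 using r by (simp add: field_simps power2_eq_square)
    also have "\<dots> = \<beta> - b" unfolding u2 using r sn by simp
    finally have 1: "\<alpha> * (1 - cos (2*r)) / (2*r) + \<beta> * (1 - sin (2*r) / (2*r)) = \<beta> - b" .
    have 2: "(\<alpha> * sin (2*r) + \<beta> * (1 - cos (2*r))) / (4*r) = x1 / 2" using A r by (simp add: field_simps)
    have "x1 / 2 - (\<beta> - b) / (2*r) = b * (1 - r * cot r) / (2 * r)"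
      unfolding \<beta>_def cot_def using r sn by (simp add: field_simps)
    then show ?thesis unfolding 1 2 .
  qed
  have X: "b *\<^sub>R e + w = xs" by (simp add: w_def)
  have N: "\<alpha>\<^sup>2 + \<beta>\<^sup>2 + (norm w)\<^sup>2 = (r / sin r)\<^sup>2 * (x1\<^sup>2 + b\<^sup>2) + (norm xs)\<^sup>2 - b\<^sup>2"
    unfolding ab nw by simp
  show ?thesis
    using reachable_geodesic[OF r(1) e we, of \<alpha> \<beta>] unfolding A B P Q N X unfolding w_def .
qed

text \<open>For r = pi the plane component closes a full circle, whatever its initial direction. The
  free component \<beta> of that direction tilts t along \<open>w\<close>, and its range \<beta>^2
  \<le> \<rho> is the geometric origin of the inequality defining the exceptional set.\<close>

lemma reachable_circle:
  fixes e w :: "real^'n::finite"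
  assumes "norm e = 1" "w \<bullet> e = 0" "\<beta>\<^sup>2 \<le> \<rho>"
  shows "reachable (0, w, (\<rho> / (4 * pi)) *\<^sub>R e - (\<beta> / (2 * pi)) *\<^sub>R w) (sqrt (\<rho> + (norm w)\<^sup>2))"
proof -
  have "(sqrt (\<rho> - \<beta>\<^sup>2))\<^sup>2 + \<beta>\<^sup>2 = \<rho>" using assms(3) by simp
  then show ?thesis
    using reachable_geodesic[OF pi_gt_zero assms(1,2), of "sqrt (\<rho> - \<beta>\<^sup>2)" \<beta>] by simp
qed

section \<open>Trigonometric inequalities\<close>

text \<open>
With \<open>u = 1/\<psi> = s\<^sup>2 sin s / jK\<close> one has \<open>u' = - s mK / jK\<^sup>2\<close> and \<open>u'' = - 2 kK / jK\<^sup>3\<close>.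
\<close>

definition jK :: "real \<Rightarrow> real" where "jK s = sin s - s * cos s"
definition mK :: "real \<Rightarrow> real" where "mK s = s\<^sup>2 + s * sin s * cos s - 2 * (sin s)\<^sup>2"
definition kK :: "real \<Rightarrow> real" where "kK s = (jK s)^3 + mK s * (jK s - s\<^sup>2 * sin s)"

lemma has_real_derivative_jK [derivative_intros]:
  "(f has_real_derivative f') (at x within A) \<Longrightarrow>
    ((\<lambda>x. jK (f x)) has_real_derivative f x * sin (f x) * f') (at x within A)"
  unfolding jK_def by (auto intro!: derivative_eq_intros simp: algebra_simps)

lemma has_real_derivative_mK [derivative_intros]:
  assumes "(f has_real_derivative f') (at x within A)"
  shows "((\<lambda>x. mK (f x)) has_real_derivative (3 * f x - 3 * sin (f x) * cos (f x) - 2 * f x * (sin (f x))\<^sup>2) * f') (at x within A)"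
proof -
  have "((\<lambda>x. mK (f x)) has_real_derivative (2 * f x + sin (f x) * cos (f x) + f x * (cos (f x) * cos (f x) - sin (f x) * sin (f x)) - 4 * sin (f x) * cos (f x)) * f') (at x within A)"
    unfolding mK_def using assms by (auto intro!: derivative_eq_intros simp: algebra_simps power2_eq_square)
  then show ?thesis
    by (rule DERIV_cong) (simp add: algebra_simps power2_eq_square cos_squared_eq[unfolded power2_eq_square])
qed

lemma positive_from_derivative:
  fixes f :: "real \<Rightarrow> real"
  assumes "\<And>x. (f has_real_derivative f' x) (at x)" "f 0 = 0" "\<And>x. 0 < x \<Longrightarrow> x < pi \<Longrightarrow> f' x > 0"
    and s: "0 < s" "s \<le> pi"
  shows "f s > 0"
proof -
  have "\<exists>z. 0 < z \<and> z < s \<and> f s - f 0 = (s - 0) * f' z"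
    using s assms(1) by (intro MVT2) auto
  then show ?thesis using assms(2,3) s by (auto simp: zero_less_mult_iff)
qed

lemma jK_pos: "0 < s \<Longrightarrow> s \<le> pi \<Longrightarrow> jK s > 0"
  by (rule positive_from_derivative[where f'="\<lambda>s. s * sin s"])
     (auto intro!: derivative_eq_intros sin_gt_zero mult_pos_pos simp: jK_def algebra_simps)

text \<open>Two differentiations reduce the claim to the positivity of 4 sin s \<open>jK s\<close>;
  all intermediate values at 0 vanish.\<close>

lemma mK_pos: "0 < s \<Longrightarrow> s \<le> pi \<Longrightarrow> mK s > 0"
proof (rule positive_from_derivative[where f=mK and f'="\<lambda>s. 3 * s - 3 * sin s * cos s - 2 * s * (sin s)\<^sup>2"])
  show "(mK has_real_derivative 3 * x - 3 * sin x * cos x - 2 * x * (sin x)\<^sup>2) (at x)" for x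
    using has_real_derivative_mK[OF DERIV_ident] by simp
next
  fix x :: real assume x: "0 < x" "x < pi"
  show "3 * x - 3 * sin x * cos x - 2 * x * (sin x)\<^sup>2 > 0"
  proof (rule positive_from_derivative[where f="\<lambda>x. 3 * x - 3 * sin x * cos x - 2 * x * (sin x)\<^sup>2" and f'="\<lambda>s. 4 * sin s * jK s"])
    fix y :: real
    have "((\<lambda>x. 3 * x - 3 * sin x * cos x - 2 * x * (sin x)\<^sup>2) has_real_derivative
        3 - 3 * (cos y * cos y - sin y * sin y) - 2 * (sin y)\<^sup>2 - 4 * y * sin y * cos y) (at y)"
      by (auto intro!: derivative_eq_intros simp: algebra_simps power2_eq_square)
    then show "((\<lambda>x. 3 * x - 3 * sin x * cos x - 2 * x * (sin x)\<^sup>2) has_real_derivative 4 * sin y * jK y) (at y)"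
      by (rule DERIV_cong) (simp add: jK_def algebra_simps power2_eq_square cos_squared_eq[unfolded power2_eq_square])
  qed (use x in \<open>auto intro!: mult_pos_pos sin_gt_zero jK_pos\<close>)
qed (auto simp: mK_def)

text \<open>In terms of u = 1/psi this is u < 3, the value of u at 0. The difference has derivative
  \<open>s * jK s\<close>.\<close>

lemma square_sin_le_jK: "0 < s \<Longrightarrow> s \<le> pi \<Longrightarrow> s\<^sup>2 * sin s < 3 * jK s"
proof -
  assume s: "0 < s" "s \<le> pi"
  have "3 * jK s - s\<^sup>2 * sin s > 0"
  proof (rule positive_from_derivative[where f="\<lambda>s. 3 * jK s - s\<^sup>2 * sin s" and f'="\<lambda>s. s * jK s"])
    show "((\<lambda>s. 3 * jK s - s\<^sup>2 * sin s) has_real_derivative x * jK x) (at x)" for x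
      by (auto intro!: derivative_eq_intros simp: jK_def algebra_simps power2_eq_square)
  qed (use s in \<open>auto intro!: mult_pos_pos jK_pos\<close>, simp add: jK_def)
  then show ?thesis by simp
qed

text \<open>
This is the equation \<open>s u' = 3u - s\<^sup>2 - u\<^sup>2\<close>, differentiated once and multiplied by the integrating factor \<open>jK\<^sup>2/s\<^sup>2\<close>.
\<close>

lemma kK_quotient_derivative:
  assumes "0 < s" "s \<le> pi"
  shows "((\<lambda>s. kK s / (s * jK s)) has_real_derivative (jK s)\<^sup>2 / s\<^sup>2 + (mK s)\<^sup>2 / (jK s)\<^sup>2) (at s)"
proof -
  have j: "jK s > 0" using jK_pos assms by blast
  let ?m' = "3 * s - 3 * sin s * cos s - 2 * s * (sin s)\<^sup>2"
  let ?k' = "3 * (jK s)\<^sup>2 * (s * sin s) + ?m' * (jK s - s\<^sup>2 * sin s) + mK s * (s * sin s - 2 * s * sin s - s\<^sup>2 * cos s)"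
  have kd: "(kK has_real_derivative ?k') (at s)"
    unfolding kK_def[abs_def] by (auto intro!: derivative_eq_intros simp: algebra_simps power2_eq_square)
  have jd: "((\<lambda>s. s * jK s) has_real_derivative (jK s + s * (s * sin s))) (at s)"
    by (auto intro!: derivative_eq_intros)
  have "((\<lambda>s. kK s / (s * jK s)) has_real_derivative
     (?k' * (s * jK s) - kK s * (jK s + s * (s * sin s))) / ((s * jK s) * (s * jK s))) (at s)"
    using DERIV_divide[OF kd jd] j assms by simp
  moreover have "?k' * (s * jK s) - kK s * (jK s + s * (s * sin s)) = (jK s)^4 + s\<^sup>2 * (mK s)\<^sup>2"
  proof -
    have c: "(cos s)\<^sup>2 = 1 - (sin s)\<^sup>2" by (simp add: cos_squared_eq)
    show ?thesis unfolding kK_def mK_def jK_def using c by algebra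
  qed
  moreover have "((jK s)^4 + s\<^sup>2 * (mK s)\<^sup>2) / ((s * jK s) * (s * jK s)) = (jK s)\<^sup>2 / s\<^sup>2 + (mK s)\<^sup>2 / (jK s)\<^sup>2"
    using j assms by (simp add: field_simps power2_eq_square power4_eq_xxxx)
  ultimately show ?thesis by simp
qed

text \<open>The quotient \<open>G\<close> increases strictly. Instead of a Taylor expansion at 0,
  the crude bound \<open>G x \<ge> - 4 * x\<close> excludes negative values close to 0, hence
  everywhere.\<close>

lemma kK_pos: 
  assumes s: "0 < s" "s \<le> pi"
  shows "kK s > 0"
proof -
  define G where "G = (\<lambda>s. kK s / (s * jK s))"
  have inc: "G a < G b" if "0 < a" "a < b" "b \<le> pi" for a b
  proof (rule DERIV_pos_imp_increasing[OF that(2)])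
    fix x assume x: "a \<le> x" "x \<le> b"
    then have "(G has_real_derivative (jK x)\<^sup>2 / x\<^sup>2 + (mK x)\<^sup>2 / (jK x)\<^sup>2) (at x)"
      unfolding G_def using that by (intro kK_quotient_derivative) auto
    moreover have "(jK x)\<^sup>2 / x\<^sup>2 + (mK x)\<^sup>2 / (jK x)\<^sup>2 > 0"
      using jK_pos[of x] that x by (intro add_pos_nonneg divide_pos_pos) auto
    ultimately show "\<exists>y. (G has_real_derivative y) (at x) \<and> 0 < y" by blast
  qed
  have low: "G x \<ge> - 4 * x" if x: "0 < x" "x \<le> pi" for x
  proof -
    have j: "jK x > 0" and m: "mK x > 0" using jK_pos mK_pos x by auto
    have "G x = (jK x)\<^sup>2 / x + (mK x / x) * (1 - x\<^sup>2 * sin x / jK x)"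
      unfolding G_def kK_def using j x by (simp add: field_simps power2_eq_square power3_eq_cube)
    moreover have "1 - x\<^sup>2 * sin x / jK x \<ge> -2"
      using square_sin_le_jK[OF x] j by (simp add: field_simps)
    then have "(mK x / x) * (1 - x\<^sup>2 * sin x / jK x) \<ge> (mK x / x) * (-2)"
      using m x by (intro mult_left_mono) auto
    moreover have "mK x / x \<le> 2 * x"
    proof -
      have "x * sin x * cos x \<le> x * sin x * 1"
        using x sin_ge_zero[of x] by (intro mult_left_mono) auto
      also have "\<dots> \<le> x * x" using x sin_x_le_x[of x] by simp
      finally have "x * sin x * cos x \<le> x * x" .
      then have "mK x \<le> 2 * x * x" unfolding mK_def power2_eq_square using zero_le_square[of "sin x"] by linarith
      then show ?thesis using x by (simp add: field_simps)
    qed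
    moreover have "(jK x)\<^sup>2 / x \<ge> 0" using x by simp
    ultimately show ?thesis by linarith
  qed
  have "G (s/2) \<ge> 0"
  proof (rule ccontr)
    assume neg: "\<not> G (s/2) \<ge> 0"
    \<comment> \<open>The choice gives -4x \<ge> G(s/2)/2 > G(s/2), against -4x \<le> G(x) <
      G(s/2).\<close>
    define x where "x = min (s/4) (- G (s/2) / 8)"
    have x: "0 < x" "x < s/2" "x \<le> - G (s/2) / 8" using neg s by (auto simp: x_def min_def)
    have "G x < G (s/2)" using inc[of x "s/2"] x s by auto
    moreover have "G x \<ge> - 4 * x" using low x s by auto
    ultimately show False using x neg by linarith
  qed
  then have "G s > 0" using inc[of "s/2" s] s by auto
  moreover have "s * jK s > 0" using jK_pos[OF s] s by simp
  ultimately show ?thesis unfolding G_def by (auto simp: zero_less_divide_iff)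
qed

text \<open>The concave function u = 1/psi lies below its tangent at pi, where u = 0 and u' = -pi.
  Here \<open>v\<close> is u', and \<open>kK_pos\<close> makes it decrease.\<close>

lemma inverse_psi_le:
  assumes s: "0 < s" "s \<le> pi"
  shows "s\<^sup>2 * sin s \<le> pi * (pi - s) * jK s"
proof -
  define u where "u = (\<lambda>s. s\<^sup>2 * sin s / jK s)"
  define v where "v = (\<lambda>s. - (s * mK s) / (jK s)\<^sup>2)"
  have c: "(cos x)\<^sup>2 = 1 - (sin x)\<^sup>2" for x :: real by (simp add: cos_squared_eq)
  have du: "(u has_real_derivative v x) (at x)" if "0 < x" "x \<le> pi" for x
  proof -
    have j: "jK x > 0" using jK_pos that by blast
    have "(u has_real_derivative ((2 * x * sin x + x\<^sup>2 * cos x) * jK x - x\<^sup>2 * sin x * (x * sin x)) / (jK x * jK x)) (at x)"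
      unfolding u_def using j by (auto intro!: derivative_eq_intros)
    moreover have "(2 * x * sin x + x\<^sup>2 * cos x) * jK x - x\<^sup>2 * sin x * (x * sin x) = - (x * mK x)"
      unfolding mK_def jK_def using c[of x] by algebra
    ultimately show ?thesis by (simp add: v_def power2_eq_square)
  qed
  have dv: "(v has_real_derivative - 2 * kK x / (jK x)^3) (at x)" if "0 < x" "x \<le> pi" for x
  proof -
    have j: "jK x > 0" using jK_pos that by blast
    let ?m' = "3 * x - 3 * sin x * cos x - 2 * x * (sin x)\<^sup>2"
    have "(v has_real_derivative (- (mK x + x * ?m') * (jK x)\<^sup>2 - (- (x * mK x)) * (2 * jK x * (x * sin x))) / ((jK x)\<^sup>2 * (jK x)\<^sup>2)) (at x)"
      unfolding v_def using j
      by (intro DERIV_divide) (auto intro!: derivative_eq_intros simp: algebra_simps)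
    moreover have "- (mK x + x * ?m') * jK x - (- (x * mK x)) * (2 * (x * sin x)) = - 2 * kK x"
      unfolding kK_def mK_def jK_def using c[of x] by algebra
    then have "(- (mK x + x * ?m') * (jK x)\<^sup>2 - (- (x * mK x)) * (2 * jK x * (x * sin x))) = - 2 * kK x * jK x"
      unfolding power2_eq_square[of "jK x"] by algebra
    ultimately show ?thesis using j by (simp add: power2_eq_square power3_eq_cube mult.assoc)
  qed
  have v: "v x \<ge> - pi" if x: "0 < x" "x \<le> pi" for x
  proof -
    have "v pi \<le> v x"
    proof (rule DERIV_nonpos_imp_nonincreasing[OF x(2)])
      fix y assume y: "x \<le> y" "y \<le> pi"
      then have "- 2 * kK y / (jK y)^3 \<le> 0" using kK_pos[of y] jK_pos[of y] x by simp
      then show "\<exists>z. (v has_real_derivative z) (at y) \<and> z \<le> 0" using dv[of y] y x by fastforce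
    qed
    moreover have "v pi = - pi" by (simp add: v_def mK_def jK_def power2_eq_square)
    ultimately show ?thesis by simp
  qed
  have "u s - pi * (pi - s) \<le> u pi - pi * (pi - pi)"
  proof (rule DERIV_nonneg_imp_nondecreasing[OF s(2), where f="\<lambda>s. u s - pi * (pi - s)"])
    fix y assume y: "s \<le> y" "y \<le> pi"
    have "((\<lambda>s. u s - pi * (pi - s)) has_real_derivative (v y - pi * (0 - 1))) (at y)"
      using du[of y] y s by (intro DERIV_diff DERIV_cmult DERIV_const DERIV_ident) auto
    then show "\<exists>z. ((\<lambda>s. u s - pi * (pi - s)) has_real_derivative z) (at y) \<and> 0 \<le> z"
      using v[of y] y s by (intro exI[of _ "v y - pi * (0 - 1)"]) auto
  qed
  then have "u s \<le> pi * (pi - s)" by (simp add: u_def)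
  then show ?thesis using jK_pos[OF s] by (simp add: u_def field_simps)
qed

section \<open>Bounds for psi with the exact pole at pi\<close>

lemma psiK_jK: "0 < s \<Longrightarrow> s < pi \<Longrightarrow> psiK s = jK s / (s\<^sup>2 * sin s)"
  using sin_gt_zero[of s] by (simp add: psiK_def fK_def jK_def cot_def field_simps)

lemma psiK_lower:
  assumes "0 < s" "s < pi"
  shows "1 / (pi * (pi - s)) \<le> psiK s"
proof -
  have "sin s > 0" using assms sin_gt_zero by blast
  then show ?thesis
    unfolding psiK_jK[OF assms] using inverse_psi_le[of s] assms by (simp add: field_simps)
qed

text \<open>The reflection s to pi - s turns the positivity of \<open>jK\<close> into this bound. At
  s = pi its pole has the same coefficient as that of \<open>psiK_lower\<close>, so nothing is lost
  to leading order.\<close>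

lemma psiK_upper:
  assumes "0 < s" "s < pi"
  shows "psiK s \<le> pi / (s\<^sup>2 * (pi - s))"
proof -
  have sn: "sin s > 0" using assms sin_gt_zero by blast
  have "jK (pi - s) > 0" using assms by (intro jK_pos) auto
  from mult_pos_pos[OF assms(1) this] have "jK s * (pi - s) \<le> pi * sin s" by (simp add: jK_def algebra_simps)
  then have "jK s / sin s \<le> pi / (pi - s)" using sn assms by (simp add: field_simps)
  then have "jK s / sin s / s\<^sup>2 \<le> pi / (pi - s) / s\<^sup>2" by (rule divide_right_mono) simp
  then show ?thesis unfolding psiK_jK[OF assms] by (simp add: field_simps)
qed

section \<open>Functions of class \<open>C\<^sup>k\<close>\<close>

text \<open>
\<open>Ck 0\<close> is vacuous and \<open>Ck k\<close> does not require the last derivatives to be continuous; only the conjunction over all \<open>k\<close> matters.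
\<close>

fun Ck :: "nat \<Rightarrow> 'a::euclidean_space set \<Rightarrow> ('a \<Rightarrow> real) \<Rightarrow> bool" where
  "Ck 0 S f \<longleftrightarrow> True"
| "Ck (Suc k) S f \<longleftrightarrow> (\<exists>f'. (\<forall>x\<in>S. (f has_derivative f' x) (at x)) \<and> (\<forall>b\<in>Basis. Ck k S (\<lambda>x. f' x b)))"

lemma Ck_cong:
  assumes "open S" "Ck k S f" "\<And>x. x \<in> S \<Longrightarrow> f x = g x"
  shows "Ck k S g"
proof (cases k)
  case (Suc n)
  then obtain f' where "\<forall>x\<in>S. (f has_derivative f' x) (at x)" "\<forall>b\<in>Basis. Ck n S (\<lambda>x. f' x b)"
    using assms(2) by auto
  moreover have "(g has_derivative f' x) (at x)" if "x \<in> S" for x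
    by (rule has_derivative_transform_within_open[OF _ assms(1) that assms(3)]) (use calculation(1) that in auto)
  ultimately show ?thesis using Suc by auto
qed simp

lemma Ck_SucD: "Ck (Suc k) S f \<Longrightarrow> Ck k S f"
  by (induction k arbitrary: f) (simp, metis Ck.simps(2))

lemma Ck_const: "Ck k S (\<lambda>x. c)"
  by (induction k arbitrary: c) (auto intro!: exI[of _ "\<lambda>x h. 0"])

lemma Ck_bounded_linear: "bounded_linear f \<Longrightarrow> Ck k S f"
  by (cases k) (auto intro!: exI[of _ "\<lambda>x. f"] Ck_const bounded_linear_imp_has_derivative)

lemma Ck_add: "Ck k S f \<Longrightarrow> Ck k S g \<Longrightarrow> Ck k S (\<lambda>x. f x + g x)"
proof (induction k arbitrary: f g)
  case (Suc k)
  then obtain f' g' where *: "\<forall>x\<in>S. (f has_derivative f' x) (at x)" "\<forall>b\<in>Basis. Ck k S (\<lambda>x. f' x b)"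
    "\<forall>x\<in>S. (g has_derivative g' x) (at x)" "\<forall>b\<in>Basis. Ck k S (\<lambda>x. g' x b)" by auto
  then show ?case using Suc.IH by (auto intro!: exI[of _ "\<lambda>x h. f' x h + g' x h"] has_derivative_add)
qed simp

lemma Ck_mult: "Ck k S f \<Longrightarrow> Ck k S g \<Longrightarrow> Ck k S (\<lambda>x. f x * g x)"
proof (induction k arbitrary: f g)
  case (Suc k)
  then obtain f' g' where *: "\<forall>x\<in>S. (f has_derivative f' x) (at x)" "\<forall>b\<in>Basis. Ck k S (\<lambda>x. f' x b)"
    "\<forall>x\<in>S. (g has_derivative g' x) (at x)" "\<forall>b\<in>Basis. Ck k S (\<lambda>x. g' x b)" by auto
  have "Ck k S f" "Ck k S g" using Suc.prems Ck_SucD by auto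
  then show ?case using Suc.IH *
    by (auto intro!: exI[of _ "\<lambda>x h. f x * g' x h + f' x h * g x"] has_derivative_mult Ck_add)
qed simp

lemma Ck_cmult: "Ck k S f \<Longrightarrow> Ck k S (\<lambda>x. c * f x)"
  by (intro Ck_mult Ck_const)

lemma Ck_diff: "Ck k S f \<Longrightarrow> Ck k S g \<Longrightarrow> Ck k S (\<lambda>x. f x - g x)"
  using Ck_add[of k S f "\<lambda>x. (-1) * g x"] Ck_cmult[of k S g "-1"] by simp

lemma Ck_power: "Ck k S f \<Longrightarrow> Ck k S (\<lambda>x. f x ^ n)"
  by (induction n) (auto intro: Ck_const Ck_mult)

lemma Ck_sum: "(\<And>i. i \<in> A \<Longrightarrow> Ck k S (f i)) \<Longrightarrow> Ck k S (\<lambda>x. \<Sum>i\<in>A. f i x)"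
  by (induction A rule: infinite_finite_induct) (auto intro: Ck_const Ck_add)

lemma Ck_prod: "(\<And>i. i \<in> A \<Longrightarrow> Ck k S (f i)) \<Longrightarrow> Ck k S (\<lambda>x. \<Prod>i\<in>A. f i x)"
  by (induction A rule: infinite_finite_induct) (auto intro: Ck_const Ck_mult)

lemma Ck_inverse:
  assumes "\<And>x. x \<in> S \<Longrightarrow> f x \<noteq> 0"
  shows "Ck k S f \<Longrightarrow> Ck k S (\<lambda>x. inverse (f x))"
proof (induction k)
  case (Suc k)
  then obtain f' where *: "\<forall>x\<in>S. (f has_derivative f' x) (at x)" "\<forall>b\<in>Basis. Ck k S (\<lambda>x. f' x b)" by auto
  have i: "Ck k S (\<lambda>x. inverse (f x))" using Suc Ck_SucD by blast
  have "Ck k S (\<lambda>x. (-1) * (inverse (f x) * f' x b * inverse (f x)))" if "b \<in> Basis" for b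
    using * i that by (intro Ck_mult Ck_const) auto
  then show ?case using *(1) assms
    by (auto intro!: exI[of _ "\<lambda>x h. - (inverse (f x) * f' x h * inverse (f x))"] Deriv.has_derivative_inverse)
qed simp

lemma Ck_divide:
  assumes "\<And>x. x \<in> S \<Longrightarrow> g x \<noteq> 0" "Ck k S f" "Ck k S g"
  shows "Ck k S (\<lambda>x. f x / g x)"
  unfolding divide_inverse by (intro Ck_mult assms Ck_inverse)

lemma Ck_det:
  fixes A :: "'a::euclidean_space \<Rightarrow> real^'n^'n"
  assumes "\<And>i j. Ck k S (\<lambda>x. A x $ i $ j)"
  shows "Ck k S (\<lambda>x. det (A x))"
  unfolding det_def by (intro Ck_sum Ck_mult Ck_const Ck_prod assms)

lemma Ck_compose:
  fixes F :: "'a::euclidean_space \<Rightarrow> 'b::euclidean_space"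
  assumes S: "open S" and FS: "\<And>x. x \<in> S \<Longrightarrow> F x \<in> T"
  shows "(\<And>c. c \<in> Basis \<Longrightarrow> Ck k S (\<lambda>x. F x \<bullet> c)) \<Longrightarrow> Ck k T G \<Longrightarrow> Ck k S (\<lambda>x. G (F x))"
proof (induction k arbitrary: G)
  case (Suc k)
  obtain G' where G': "\<forall>x\<in>T. (G has_derivative G' x) (at x)" "\<forall>b\<in>Basis. Ck k T (\<lambda>x. G' x b)"
    using Suc.prems by auto
  have "\<forall>c\<in>Basis. \<exists>f'. (\<forall>x\<in>S. ((\<lambda>x. F x \<bullet> c) has_derivative f' x) (at x)) \<and> (\<forall>b\<in>Basis. Ck k S (\<lambda>x. f' x b))"
    using Suc.prems(1) by auto
  then obtain f' where f': "\<And>c x. c \<in> Basis \<Longrightarrow> x \<in> S \<Longrightarrow> ((\<lambda>x. F x \<bullet> c) has_derivative f' c x) (at x)"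
    "\<And>c b. c \<in> Basis \<Longrightarrow> b \<in> Basis \<Longrightarrow> Ck k S (\<lambda>x. f' c x b)" by metis
  define F' where "F' = (\<lambda>x h. \<Sum>c\<in>Basis. f' c x h *\<^sub>R c)"
  have dF: "(F has_derivative F' x) (at x)" if "x \<in> S" for x
    unfolding F'_def has_derivative_componentwise_within[of F]
    using f'(1) that by (auto simp: inner_sum_left inner_Basis if_distrib cong: if_cong)
  have dG: "((\<lambda>x. G (F x)) has_derivative (\<lambda>h. G' (F x) (F' x h))) (at x)" if "x \<in> S" for x
    using has_derivative_compose[OF dF[OF that]] G'(1) FS[OF that] by blast
  have eq: "G' (F x) (F' x b) = (\<Sum>c\<in>Basis. f' c x b * G' (F x) c)" if "x \<in> S" for x b
  proof -
    have "linear (G' (F x))" using G'(1) FS[OF that] has_derivative_linear by blast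
    then show ?thesis unfolding F'_def by (simp add: linear_sum linear_scale)
  qed
  have IH: "Ck k S (\<lambda>x. G' (F x) c)" if "c \<in> Basis" for c
    using Suc.IH[of "\<lambda>x. G' x c"] Suc.prems(1) Ck_SucD G'(2) that by blast
  have "Ck k S (\<lambda>x. G' (F x) (F' x b))" if b: "b \<in> Basis" for b
    by (rule Ck_cong[OF S, where f="\<lambda>x. \<Sum>c\<in>Basis. f' c x b * G' (F x) c"])
       (auto intro!: Ck_sum Ck_mult f'(2) b IH simp: eq)
  then show ?case using dG by (auto intro!: exI[of _ "\<lambda>x h. G' (F x) (F' x h)"])
qed simp

lemma Ck_compose_real:
  assumes "open S" "\<And>x. x \<in> S \<Longrightarrow> f x \<in> T" "Ck k S f" "Ck k T G"
  shows "Ck k S (\<lambda>x. G (f x :: real))"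
  by (rule Ck_compose[OF assms(1,2)]) (use assms(3,4) in auto)

lemma Ck_deriv:
  fixes f :: "real \<Rightarrow> real"
  assumes S: "open S" and f: "Ck (Suc k) S f"
  shows "Ck k S (deriv f)" and "x \<in> S \<Longrightarrow> (f has_real_derivative deriv f x) (at x)"
proof -
  obtain f' where f': "\<forall>x\<in>S. (f has_derivative f' x) (at x)" "\<forall>b\<in>Basis. Ck k S (\<lambda>x. f' x b)"
    using f by auto
  have d: "(f has_real_derivative f' x 1) (at x)" if "x \<in> S" for x
  proof -
    have fx: "(f has_derivative f' x) (at x)" using f' that by blast
    have "f' x h = f' x 1 * h" for h
      using linear_scale[OF has_derivative_linear[OF fx], of h 1] by (simp add: mult.commute)
    then have "f' x = (*) (f' x 1)" by (rule ext)
    then show ?thesis using fx unfolding has_field_derivative_def by (simp only:)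
  qed
  show "x \<in> S \<Longrightarrow> (f has_real_derivative deriv f x) (at x)" using d[of x] by (simp add: DERIV_imp_deriv)
  show "Ck k S (deriv f)"
    by (rule Ck_cong[OF S, where f="\<lambda>x. f' x 1"]) (use f'(2) DERIV_imp_deriv[OF d] in auto)
qed

text \<open>Termwise differentiation produces another everywhere convergent power series, so the
  induction runs over all coefficient sequences at once.\<close>

lemma Ck_powser:
  fixes c :: "nat \<Rightarrow> real"
  assumes "\<And>y. summable (\<lambda>n. c n * y ^ n)"
  shows "Ck k S (\<lambda>y. \<Sum>n. c n * y ^ n)"
  using assms
proof (induction k arbitrary: c)
  case (Suc k)
  have s: "summable (\<lambda>n. diffs c n * y ^ n)" for y :: real
    by (rule termdiff_converges_all) (rule Suc.prems)
  have "((\<lambda>y. \<Sum>n. c n * y ^ n) has_derivative (\<lambda>h. (\<Sum>n. diffs c n * y ^ n) * h)) (at y)" for y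
    using termdiffs_strong_converges_everywhere[OF Suc.prems, of y] by (simp add: has_field_derivative_def)
  then show ?case using Suc.IH[OF s] by (auto intro!: exI[of _ "\<lambda>y h. (\<Sum>n. diffs c n * y ^ n) * h"])
qed simp

text \<open>Induction on the list of directions, whose head is differentiated last. Uniqueness of
  the derivative identifies the witness in \<open>Ck\<close> with the
  \<open>frechet_derivative\<close> in \<open>pdiff\<close>.\<close>

lemma smooth_onI:
  assumes S: "open S" and f: "\<And>k. Ck k S f"
  shows "smooth_on S f"
  unfolding smooth_on_def
proof (intro allI impI)
  fix vs :: "'a list" assume "set vs \<subseteq> Basis"
  then have "\<forall>k. Ck k S (pdiff vs f)"
  proof (induction vs)
    case (Cons v vs)
    then have IH: "Ck (Suc k) S (pdiff vs f)" for k by auto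
    show ?case
    proof
      fix k
      obtain f' where f': "\<forall>x\<in>S. (pdiff vs f has_derivative f' x) (at x)" "\<forall>b\<in>Basis. Ck k S (\<lambda>x. f' x b)"
        using IH[of k] by auto
      show "Ck k S (pdiff (v # vs) f)"
      proof (rule Ck_cong[OF S, where f="\<lambda>x. f' x v"])
        show "Ck k S (\<lambda>x. f' x v)" using f'(2) Cons.prems by auto
        fix x assume "x \<in> S"
        then have "f' x = frechet_derivative (pdiff vs f) (at x)" using f'(1) frechet_derivative_at by blast
        then show "f' x v = pdiff (v # vs) f x" by simp
      qed
    qed
  qed (use f in simp)
  then have "Ck (Suc 0) S (pdiff vs f)" by blast
  then show "pdiff vs f differentiable_on S"
    by (auto simp: differentiable_on_def differentiable_def intro: has_derivative_at_withinI)
qed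

section \<open>The function \<open>\<psi>\<close> as a function of the square\<close>

text \<open>
\<open>PK\<close> is the analytic function with \<open>\<psi>(s) = PK(s\<^sup>2)\<close>; it makes \<open>\<psi>(|\<theta>|)\<close> smooth at \<open>\<theta> = 0\<close>.
\<close>

definition numK :: "real \<Rightarrow> real" where "numK y = (\<Sum>k. ((-1)^k * (2 * real k + 2) / fact (2*k+3)) * y^k)"
definition denK :: "real \<Rightarrow> real" where "denK y = (\<Sum>k. ((-1)^k / fact (2*k+1)) * y^k)"
definition PK :: "real \<Rightarrow> real" where "PK y = numK y / denK y"
definition dPK :: "real \<Rightarrow> real" where "dPK = deriv PK"
definition ddPK :: "real \<Rightarrow> real" where "ddPK = deriv dPK"
definition IK :: "real set" where "IK = {y. denK y \<noteq> 0}"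

lemma summable_denK: "summable (\<lambda>k. ((-1)^k / fact (2*k+1)) * (y::real)^k)"
proof (rule summable_comparison_test'[where N=0])
  show "summable (\<lambda>n. \<bar>y\<bar>^n / fact n)" using summable_exp[of "\<bar>y\<bar>"] by (simp add: field_simps)
  fix n :: nat
  have "(fact n :: real) \<le> fact (2*n+1)" by (rule fact_mono) simp
  then have "\<bar>y\<bar>^n / fact (2*n+1) \<le> \<bar>y\<bar>^n / fact n" by (intro divide_left_mono) auto
  then show "norm ((-1)^n / fact (2*n+1) * y^n) \<le> \<bar>y\<bar>^n / fact n" by (simp add: abs_mult power_abs)
qed

lemma summable_numK: "summable (\<lambda>k. ((-1)^k * (2 * real k + 2) / fact (2*k+3)) * (y::real)^k)"
proof (rule summable_comparison_test'[where N=0])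
  show "summable (\<lambda>n. \<bar>y\<bar>^n / fact n)" using summable_exp[of "\<bar>y\<bar>"] by (simp add: field_simps)
  fix n :: nat
  have "(fact n :: real) \<le> fact (2*n+2)" by (rule fact_mono) simp
  moreover have "(fact (2*n+3) :: real) = (2 * real n + 3) * fact (2*n+2)"
    using fact_Suc[of "2*n+2", where 'a=real] by (simp add: eval_nat_numeral)
  moreover have "(2 * real n + 2) * fact (2*n+2) \<le> (2 * real n + 3) * (fact (2*n+2) :: real)"
    by (intro mult_right_mono) auto
  moreover have "(2 * real n + 2) * fact n \<le> (2 * real n + 2) * (fact (2*n+2) :: real)"
    using calculation(1) by (intro mult_left_mono) auto
  ultimately have "(2 * real n + 2) * fact n \<le> (fact (2*n+3) :: real)" by linarith
  then have "(2 * real n + 2) / fact (2*n+3) \<le> 1 / (fact n :: real)" by (simp add: field_simps)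
  then have "(2 * real n + 2) / fact (2*n+3) * \<bar>y\<bar>^n \<le> 1 / fact n * \<bar>y\<bar>^n"
    by (intro mult_right_mono) auto
  then show "norm ((-1)^n * (2 * real n + 2) / fact (2*n+3) * y^n) \<le> \<bar>y\<bar>^n / fact n"
    by (simp add: abs_mult power_abs)
qed

lemma denK_square: "s * denK (s\<^sup>2) = sin s"
proof -
  have "(\<lambda>n. s * ((-1)^n / fact (2*n+1) * (s\<^sup>2)^n)) sums (s * denK (s\<^sup>2))"
    unfolding denK_def by (intro sums_mult summable_sums summable_denK)
  moreover have "(\<lambda>n. s * ((-1)^n / fact (2*n+1) * (s\<^sup>2)^n)) = (\<lambda>n. (-1)^n / fact (2*n+1) * s^(2*n+1))"
    by (simp add: power_mult[symmetric] mult_ac fun_eq_iff)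
  ultimately have "(\<lambda>n. (-1)^n / fact (2*n+1) * s^(2*n+1)) sums (s * denK (s\<^sup>2))" by (simp only:)
  from sums_unique2[OF this sin_paired] show ?thesis .
qed

lemma numK_square: "s^3 * numK (s\<^sup>2) = sin s - s * cos s"
proof -
  have "(\<lambda>n. (-1)^n / fact (2*n+1) * s^(2*n+1) - s * ((-1)^n / fact (2*n) * s^(2*n))) sums (sin s - s * cos s)"
    by (intro sums_diff sums_mult sin_paired cos_paired)
  \<comment> \<open>The two linear terms cancel, so the index is shifted by one. The surviving
    coefficients combine by 1/(2n+2)! - 1/(2n+3)! = (2n+2)/(2n+3)!.\<close>
  then have "(\<lambda>n. (-1)^(Suc n) / fact (2*Suc n+1) * s^(2*Suc n+1) - s * ((-1)^Suc n / fact (2*Suc n) * s^(2*Suc n))) sums (sin s - s * cos s)"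
    by (subst sums_Suc_iff) simp
  moreover have "(-1)^(Suc n) / fact (2*Suc n+1) * s^(2*Suc n+1) - s * ((-1)^Suc n / fact (2*Suc n) * s^(2*Suc n))
     = s^3 * ((-1)^n * (2 * real n + 2) / fact (2*n+3) * (s\<^sup>2)^n)" for n
  proof -
    define F where "F = (fact (2*n+2) :: real)"
    have F: "F > 0" by (simp add: F_def)
    have f3: "(fact (2*n+3) :: real) = (2 * real n + 3) * F"
      using fact_Suc[of "2*n+2", where 'a=real] by (simp add: eval_nat_numeral F_def)
    have i: "2*Suc n+1 = 2*n+3" "2*Suc n = 2*n+2" by auto
    have p: "(s\<^sup>2)^n = s^(2*n)" by (simp add: power_mult)
    have q: "s^(2*n+3) = s^3 * s^(2*n)" "s * s^(2*n+2) = s^3 * s^(2*n)" by (simp_all add: power_add power3_eq_cube power2_eq_square)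
    define B where "B = (2 * real n + 3) * F"
    have B1: "- 1 / B + 1 / F = (2 * real n + 2) / B"
      using F by (simp add: B_def divide_simps)
    have "- x / B + x / F = x * ((2 * real n + 2) / B)" for x
      unfolding B1[symmetric] by (simp add: right_diff_distrib)
    then have r: "- x / ((2 * real n + 3) * F) + x / F = x * ((2 * real n + 2) / ((2 * real n + 3) * F))" for x
      unfolding B_def .
    define w where "w = s^3 * s^(2*n)"
    have t1: "(-1)^(Suc n) / fact (2*Suc n+1) * s^(2*Suc n+1) = - ((-1)^n) / ((2 * real n + 3) * F) * w"
      unfolding i(1) q(1) f3 w_def by simp
    have t2: "s * ((-1)^Suc n / fact (2*Suc n) * s^(2*Suc n)) = - ((-1)^n) / F * w"
      unfolding i(2) F_def[symmetric] w_def q(2)[symmetric] by simp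
    have t3: "s^3 * ((-1)^n * (2 * real n + 2) / fact (2*n+3) * (s\<^sup>2)^n)
        = w * ((-1)^n * ((2 * real n + 2) / ((2 * real n + 3) * F)))"
      unfolding f3 p w_def by simp
    show ?thesis unfolding t1 t2 t3 r[symmetric] by (simp add: algebra_simps)
  qed
  ultimately have 1: "(\<lambda>n. s^3 * ((-1)^n * (2 * real n + 2) / fact (2*n+3) * (s\<^sup>2)^n)) sums (sin s - s * cos s)"
    by (simp only:)
  have 2: "(\<lambda>n. s^3 * ((-1)^n * (2 * real n + 2) / fact (2*n+3) * (s\<^sup>2)^n)) sums (s^3 * numK (s\<^sup>2))"
    unfolding numK_def by (intro sums_mult summable_sums summable_numK)
  show ?thesis by (rule sums_unique2[OF 2 1])
qed

lemma denK_0: "denK 0 = 1" and numK_0: "numK 0 = 1/3"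
  unfolding denK_def numK_def unfolding powser_zero by (simp_all add: fact_numeral)

lemma IK_square: "\<bar>s\<bar> < pi \<Longrightarrow> s\<^sup>2 \<in> IK"
proof (cases "s = 0")
  case False
  assume "\<bar>s\<bar> < pi"
  then have "sin s \<noteq> 0" using False sin_gt_zero[of s] sin_gt_zero[of "-s"] by (cases "s > 0") auto
  then show ?thesis using denK_square[of s] by (auto simp: IK_def)
qed (simp add: IK_def denK_0)

lemma psiK_eq_PK: "\<bar>s\<bar> < pi \<Longrightarrow> psiK s = PK (s\<^sup>2)"
proof (cases "s = 0")
  case False
  assume "\<bar>s\<bar> < pi"
  then have sn: "sin s \<noteq> 0" using False sin_gt_zero[of s] sin_gt_zero[of "-s"] by (cases "s > 0") auto
  have n: "numK (s\<^sup>2) = (sin s - s * cos s) / s^3" "denK (s\<^sup>2) = sin s / s"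
    using numK_square[of s] denK_square[of s] False by (auto simp: field_simps)
  show ?thesis unfolding PK_def n psiK_def fK_def cot_def using False sn
    by (simp add: field_simps power2_eq_square power3_eq_cube)
qed (simp add: PK_def denK_0 numK_0 psiK_def)

lemma fK_eq_PK: "\<bar>s\<bar> < pi \<Longrightarrow> fK s = s\<^sup>2 * PK (s\<^sup>2)"
  using psiK_eq_PK[of s] by (cases "s = 0") (simp_all add: psiK_def fK_def divide_eq_eq mult.commute)

lemma Ck_denK: "Ck k S denK" unfolding denK_def[abs_def] by (rule Ck_powser) (rule summable_denK)
lemma Ck_numK: "Ck k S numK" unfolding numK_def[abs_def] by (rule Ck_powser) (rule summable_numK)

lemma open_IK: "open IK"
proof -
  have "(denK has_real_derivative deriv denK y) (at y)" for y
    by (rule Ck_deriv(2)[OF open_UNIV Ck_denK]) simp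
  then have "continuous_on UNIV denK" using DERIV_isCont continuous_at_imp_continuous_on by blast
  then have "open (denK -` (- {0}))" by (intro open_vimage) auto
  then show ?thesis by (simp add: IK_def vimage_def Compl_eq)
qed

lemma Ck_PK: "Ck k IK PK"
  unfolding PK_def[abs_def] by (intro Ck_divide Ck_numK Ck_denK) (simp add: IK_def)

lemma Ck_dPK: "Ck k IK dPK" unfolding dPK_def by (rule Ck_deriv(1)[OF open_IK Ck_PK])

lemma DERIV_PK: "y \<in> IK \<Longrightarrow> (PK has_real_derivative dPK y) (at y)"
  unfolding dPK_def by (rule Ck_deriv(2)[OF open_IK Ck_PK])
lemma DERIV_dPK: "y \<in> IK \<Longrightarrow> (dPK has_real_derivative ddPK y) (at y)"
  unfolding ddPK_def by (rule Ck_deriv(2)[OF open_IK Ck_dPK])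

section \<open>Values, signs and differential equations of \<open>PK\<close>\<close>

lemma PK_square: "0 < s \<Longrightarrow> s < pi \<Longrightarrow> PK (s\<^sup>2) = jK s / (s\<^sup>2 * sin s)"
  using psiK_jK[of s] psiK_eq_PK[of s] by simp

lemma DERIV_PK_square: "\<bar>s\<bar> < pi \<Longrightarrow> ((\<lambda>s. PK (s\<^sup>2)) has_real_derivative dPK (s\<^sup>2) * (2 * s)) (at s)"
  by (rule DERIV_chain2[where f=PK and g="\<lambda>s. s\<^sup>2"]) (auto intro!: derivative_eq_intros DERIV_PK IK_square)

lemma dPK_square:
  assumes s: "0 < s" "s < pi"
  shows "dPK (s\<^sup>2) = mK s / (2 * s^4 * (sin s)\<^sup>2)"
proof -
  have sn: "sin s > 0" using s sin_gt_zero by blast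
  have 1: "((\<lambda>s. PK (s\<^sup>2)) has_real_derivative dPK (s\<^sup>2) * (2 * s)) (at s)"
    using DERIV_PK_square s by simp
  have "((\<lambda>s. jK s / (s\<^sup>2 * sin s)) has_real_derivative
      (s * sin s * 1 * (s\<^sup>2 * sin s) - jK s * (2 * s * sin s + cos s * s\<^sup>2)) / (s\<^sup>2 * sin s * (s\<^sup>2 * sin s))) (at s)"
    using s sn by (intro DERIV_divide has_real_derivative_jK DERIV_ident) (auto intro!: derivative_eq_intros)
  then have "((\<lambda>s. PK (s\<^sup>2)) has_real_derivative
      (s * sin s * 1 * (s\<^sup>2 * sin s) - jK s * (2 * s * sin s + cos s * s\<^sup>2)) / (s\<^sup>2 * sin s * (s\<^sup>2 * sin s))) (at s)"
    by (rule has_field_derivative_transform_within_open[where S="{0<..<pi}"]) (use s PK_square in auto)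
  then have eq: "dPK (s\<^sup>2) * (2 * s) = (s * sin s * 1 * (s\<^sup>2 * sin s) - jK s * (2 * s * sin s + cos s * s\<^sup>2)) / (s\<^sup>2 * sin s * (s\<^sup>2 * sin s))"
    using 1 DERIV_unique by blast
  have c: "(cos s)\<^sup>2 = 1 - (sin s)\<^sup>2" by (simp add: cos_squared_eq)
  have "s * sin s * 1 * (s\<^sup>2 * sin s) - jK s * (2 * s * sin s + cos s * s\<^sup>2) = s * mK s"
    unfolding mK_def jK_def using c by algebra
  then have "dPK (s\<^sup>2) * (2 * s) = s * mK s / (s\<^sup>2 * sin s * (s\<^sup>2 * sin s))" using eq by simp
  then have "dPK (s\<^sup>2) = s * mK s / (s\<^sup>2 * sin s * (s\<^sup>2 * sin s)) / (2 * s)"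
    using s by (simp only: eq_divide_eq) auto
  also have "\<dots> = mK s / (2 * s^4 * (sin s)\<^sup>2)"
    using s by (simp add: power2_eq_square power4_eq_xxxx mult_ac)
  finally show ?thesis .
qed

lemma sqrt_less_pi:
  assumes "y < pi\<^sup>2"
  shows "sqrt y < pi"
proof -
  have "sqrt y < sqrt (pi\<^sup>2)" using assms by (rule real_sqrt_less_mono)
  also have "sqrt (pi\<^sup>2) = pi" by (rule real_sqrt_unique) auto
  finally show ?thesis .
qed

lemma ex_sqrt_less_pi:
  assumes "0 < y" "y < pi\<^sup>2"
  shows "\<exists>s. 0 < s \<and> s < pi \<and> y = s\<^sup>2"
proof (intro exI conjI)
  show "0 < sqrt y" using assms(1) by simp
  show "sqrt y < pi" by (rule sqrt_less_pi[OF assms(2)])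
  show "y = (sqrt y)\<^sup>2" using real_sqrt_pow2[of y] assms(1) by linarith
qed

text \<open>This is the Riccati equation of c = s cot s, namely s c' = c - c^2 - s^2, rewritten with
  c = 1 - y P(y) and y = s^2.\<close>

lemma PK_ode1:
  assumes "0 < y" "y < pi\<^sup>2"
  shows "2 * y * dPK y = y * (PK y)\<^sup>2 - 3 * PK y + 1"
proof -
  obtain s where s: "0 < s" "s < pi" "y = s\<^sup>2" using ex_sqrt_less_pi[OF assms] by blast
  have sn: "sin s > 0" using s sin_gt_zero by blast
  have c: "(cos s)\<^sup>2 = 1 - (sin s)\<^sup>2" by (simp add: cos_squared_eq)
  define A where "A = s\<^sup>2 * sin s"
  have "mK s = (jK s)\<^sup>2 - 3 * jK s * sin s + s\<^sup>2 * (sin s)\<^sup>2"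
    unfolding mK_def jK_def using c by algebra
  then have m: "s\<^sup>2 * mK s = s\<^sup>2 * (jK s)\<^sup>2 - 3 * jK s * A + A\<^sup>2" unfolding A_def by algebra
  have A: "A > 0" using s sn by (simp add: A_def)
  have P: "PK y = jK s / A" using PK_square[OF s(1,2)] s(3) by (simp add: A_def)
  have "2 * dPK y = mK s / (s^4 * (sin s)\<^sup>2)" using dPK_square[OF s(1,2)] s(3) by simp
  also have "s^4 * (sin s)\<^sup>2 = A\<^sup>2" by (simp add: A_def power_mult_distrib)
  finally have d: "2 * dPK y = mK s / A\<^sup>2" .
  have "2 * y * dPK y = s\<^sup>2 * (2 * dPK y)" using s(3) by simp
  also have "\<dots> = s\<^sup>2 * mK s / A\<^sup>2" unfolding d by simp
  also have "\<dots> = s\<^sup>2 * (jK s / A)\<^sup>2 - 3 * (jK s / A) + 1"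
    unfolding m using A by (simp add: add_divide_distrib diff_divide_distrib power_divide power2_eq_square)
  finally show ?thesis unfolding P using s(3) by simp
qed

lemma PK_pos: "0 \<le> y \<Longrightarrow> y < pi\<^sup>2 \<Longrightarrow> PK y > 0"
proof (cases "y = 0")
  case False
  assume "0 \<le> y" "y < pi\<^sup>2"
  with False have "0 < y" "y < pi\<^sup>2" by auto
  then obtain s where s: "0 < s" "s < pi" "y = s\<^sup>2" using ex_sqrt_less_pi by blast
  have "sin s > 0" using s sin_gt_zero by blast
  then show ?thesis unfolding s(3) PK_square[OF s(1,2)] using jK_pos[of s] s by simp
qed (simp add: PK_def numK_0 denK_0)

lemma dPK_pos: "0 < y \<Longrightarrow> y < pi\<^sup>2 \<Longrightarrow> dPK y > 0"
proof -
  assume "0 < y" "y < pi\<^sup>2"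
  then obtain s where s: "0 < s" "s < pi" "y = s\<^sup>2" using ex_sqrt_less_pi by blast
  have "sin s > 0" using s sin_gt_zero by blast
  then show ?thesis unfolding s(3) dPK_square[OF s(1,2)] using mK_pos[of s] s by simp
qed

lemma PK_IK: "0 \<le> y \<Longrightarrow> y < pi\<^sup>2 \<Longrightarrow> y \<in> IK"
  using IK_square[of "sqrt y"] sqrt_less_pi[of y] by simp

text \<open>Differentiating \<open>PK_ode1\<close> eliminates the second derivative, so that the
  Hessian becomes algebraic in \<open>PK\<close> and \<open>dPK\<close>.\<close>

lemma PK_ode2:
  assumes y: "0 < y" "y < pi\<^sup>2"
  shows "2 * y * ddPK y = (PK y)\<^sup>2 + 2 * y * PK y * dPK y - 5 * dPK y"
proof -
  have yI: "y \<in> IK" using PK_IK y by simp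
  note d = DERIV_PK[OF yI] DERIV_dPK[OF yI]
  have "((\<lambda>y. 2 * y * dPK y) has_real_derivative 2 * dPK y + ddPK y * (2 * y)) (at y)"
    by (rule DERIV_mult[OF _ d(2)]) (auto intro!: derivative_eq_intros)
  then have 1: "((\<lambda>y. y * (PK y)\<^sup>2 - 3 * PK y + 1) has_real_derivative 2 * dPK y + ddPK y * (2 * y)) (at y)"
    by (rule has_field_derivative_transform_within_open[where S="{0<..<pi\<^sup>2}"]) (use y PK_ode1 in auto)
  have "((\<lambda>y. y * (PK y)\<^sup>2 - 3 * PK y + 1) has_real_derivative
     (1 * (PK y)\<^sup>2 + (2 * PK y * dPK y) * y - 3 * dPK y + 0)) (at y)"
    using d(1) by (intro DERIV_add DERIV_diff DERIV_mult DERIV_ident DERIV_cmult DERIV_const) (auto intro!: derivative_eq_intros)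
  from DERIV_unique[OF 1 this] show ?thesis by (simp add: algebra_simps)
qed

text \<open>
Modulo the two differential equations above, this says that \<open>1/\<psi>\<close> is strictly concave.
\<close>

lemma PK_cubic_pos:
  assumes "0 < y" "y < pi\<^sup>2"
  shows "(PK y)^3 + 2 * dPK y * (PK y - 1) > 0"
proof -
  obtain s where s: "0 < s" "s < pi" "y = s\<^sup>2" using ex_sqrt_less_pi[OF assms] by blast
  have sn: "sin s > 0" using s sin_gt_zero by blast
  define A where "A = s\<^sup>2 * sin s"
  have A: "A > 0" using s sn by (simp add: A_def)
  have P: "PK y = jK s / A" using PK_square[OF s(1,2)] s(3) by (simp add: A_def)
  have "2 * dPK y = mK s / (s^4 * (sin s)\<^sup>2)" using dPK_square[OF s(1,2)] s(3) by simp
  also have "s^4 * (sin s)\<^sup>2 = A\<^sup>2" by (simp add: A_def power_mult_distrib)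
  finally have "(PK y)^3 + 2 * dPK y * (PK y - 1) = (jK s / A)^3 + mK s / A\<^sup>2 * (jK s / A - 1)"
    unfolding P by simp
  also have "\<dots> = kK s / A^3"
    unfolding kK_def A_def[symmetric] using A by (simp add: field_simps power2_eq_square power3_eq_cube)
  finally show ?thesis using kK_pos[of s] s A by simp
qed

section \<open>Gradient and Hessian of the reference function\<close>

definition FK :: "real \<Rightarrow> real^'n \<Rightarrow> real^'n \<Rightarrow> real" where
  "FK x1 xs \<theta> = fK (norm \<theta>) * x1\<^sup>2 + psiK (norm \<theta>) * (\<theta> \<bullet> xs)\<^sup>2"

text \<open>Differentiation passes through the square of the norm, so the formula is valid at
  \<theta> = 0, where the norm itself is not differentiable.\<close>

definition gradF :: "real \<Rightarrow> real^'n \<Rightarrow> real^'n \<Rightarrow> real^'n" where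
  "gradF x1 xs \<theta> = (2 * dPK (\<theta> \<bullet> \<theta>) * (x1\<^sup>2 * (\<theta> \<bullet> \<theta>) + (\<theta> \<bullet> xs)\<^sup>2) + 2 * PK (\<theta> \<bullet> \<theta>) * x1\<^sup>2) *\<^sub>R \<theta>
     + (2 * PK (\<theta> \<bullet> \<theta>) * (\<theta> \<bullet> xs)) *\<^sub>R xs"

definition hessF :: "real \<Rightarrow> real^'n \<Rightarrow> real^'n \<Rightarrow> real^'n \<Rightarrow> real^'n" where
  "hessF x1 xs \<theta> h = (4 * ddPK (\<theta> \<bullet> \<theta>) * (\<theta> \<bullet> h) * (x1\<^sup>2 * (\<theta> \<bullet> \<theta>) + (\<theta> \<bullet> xs)\<^sup>2)
        + 4 * dPK (\<theta> \<bullet> \<theta>) * (2 * x1\<^sup>2 * (\<theta> \<bullet> h) + (\<theta> \<bullet> xs) * (xs \<bullet> h))) *\<^sub>R \<theta>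
     + (2 * dPK (\<theta> \<bullet> \<theta>) * (x1\<^sup>2 * (\<theta> \<bullet> \<theta>) + (\<theta> \<bullet> xs)\<^sup>2) + 2 * PK (\<theta> \<bullet> \<theta>) * x1\<^sup>2) *\<^sub>R h
     + (4 * dPK (\<theta> \<bullet> \<theta>) * (\<theta> \<bullet> h) * (\<theta> \<bullet> xs) + 2 * PK (\<theta> \<bullet> \<theta>) * (xs \<bullet> h)) *\<^sub>R xs"

lemma OmegaK_inner: "\<theta> \<in> OmegaK \<longleftrightarrow> \<theta> \<bullet> \<theta> < pi\<^sup>2"
proof -
  have "norm \<theta> < pi \<longleftrightarrow> (norm \<theta>)\<^sup>2 < pi\<^sup>2"
    by (metis abs_norm_cancel abs_of_pos pi_gt_zero abs_square_le_1 abs_le_square_iff linorder_not_le)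
  then show ?thesis by (simp add: OmegaK_def power2_norm_eq_inner)
qed

lemma OmegaK_IK: "\<theta> \<in> OmegaK \<Longrightarrow> \<theta> \<bullet> \<theta> \<in> IK"
  by (simp add: OmegaK_inner PK_IK)

lemma open_OmegaK: "open OmegaK" by (simp add: OmegaK_def)

lemma FK_eq:
  assumes "\<theta> \<in> OmegaK"
  shows "FK x1 xs \<theta> = PK (\<theta> \<bullet> \<theta>) * (x1\<^sup>2 * (\<theta> \<bullet> \<theta>) + (\<theta> \<bullet> xs)\<^sup>2)"
proof -
  have n: "\<bar>norm \<theta>\<bar> < pi" using assms by (simp add: OmegaK_def)
  show ?thesis unfolding FK_def fK_eq_PK[OF n] psiK_eq_PK[OF n] power2_norm_eq_inner by (simp add: algebra_simps)
qed

lemma phiK_FK: "phiK (x1, xs, t) \<theta> = x1\<^sup>2 + (norm xs)\<^sup>2 + 4 * (t \<bullet> \<theta>) - FK x1 xs \<theta>"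
  by (simp add: phiK_def FK_def algebra_simps)

lemma has_derivative_PK:
  assumes "(\<theta>::real^'n) \<in> OmegaK"
  shows "((\<lambda>\<theta>. PK (\<theta> \<bullet> \<theta>)) has_derivative (\<lambda>h. 2 * (\<theta> \<bullet> h) * dPK (\<theta> \<bullet> \<theta>))) (at \<theta>)"
    "((\<lambda>\<theta>. dPK (\<theta> \<bullet> \<theta>)) has_derivative (\<lambda>h. 2 * (\<theta> \<bullet> h) * ddPK (\<theta> \<bullet> \<theta>))) (at \<theta>)"
proof -
  have q: "((\<lambda>\<theta>. \<theta> \<bullet> \<theta>) has_derivative (\<lambda>h. 2 * (\<theta> \<bullet> h))) (at \<theta>)"
    by (auto intro!: derivative_eq_intros simp: inner_commute)
  show "((\<lambda>\<theta>. PK (\<theta> \<bullet> \<theta>)) has_derivative (\<lambda>h. 2 * (\<theta> \<bullet> h) * dPK (\<theta> \<bullet> \<theta>))) (at \<theta>)"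
    by (rule DERIV_compose_FDERIV[OF DERIV_PK[OF OmegaK_IK[OF assms]] q])
  show "((\<lambda>\<theta>. dPK (\<theta> \<bullet> \<theta>)) has_derivative (\<lambda>h. 2 * (\<theta> \<bullet> h) * ddPK (\<theta> \<bullet> \<theta>))) (at \<theta>)"
    by (rule DERIV_compose_FDERIV[OF DERIV_dPK[OF OmegaK_IK[OF assms]] q])
qed

lemma has_derivative_FK:
  fixes \<theta> :: "real^'n"
  assumes "\<theta> \<in> OmegaK"
  shows "(FK x1 xs has_derivative (\<lambda>h. gradF x1 xs \<theta> \<bullet> h)) (at \<theta>)"
proof (rule has_derivative_transform_within_open[OF _ open_OmegaK assms])
  show "((\<lambda>\<theta>. PK (\<theta> \<bullet> \<theta>) * (x1\<^sup>2 * (\<theta> \<bullet> \<theta>) + (\<theta> \<bullet> xs)\<^sup>2)) has_derivative (\<lambda>h. gradF x1 xs \<theta> \<bullet> h)) (at \<theta>)"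
    by (rule derivative_eq_intros has_derivative_PK[OF assms] refl)+
       (auto simp: gradF_def inner_simps algebra_simps inner_commute power2_eq_square fun_eq_iff)
qed (simp add: FK_eq)

lemma has_derivative_gradF:
  fixes \<theta> :: "real^'n"
  assumes "\<theta> \<in> OmegaK"
  shows "(gradF x1 xs has_derivative hessF x1 xs \<theta>) (at \<theta>)"
  unfolding gradF_def[abs_def]
  by (rule derivative_eq_intros has_derivative_PK[OF assms] refl)+
     (auto simp: hessF_def algebra_simps inner_commute power2_eq_square fun_eq_iff scaleR_add_left)

lemma has_derivative_phiK:
  fixes \<theta> :: "real^'n"
  assumes "\<theta> \<in> OmegaK"
  shows "(phiK (x1, xs, t) has_derivative (\<lambda>h. (4 *\<^sub>R t - gradF x1 xs \<theta>) \<bullet> h)) (at \<theta>)"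
  unfolding phiK_FK[abs_def]
  by (rule derivative_eq_intros has_derivative_FK[OF assms] refl)+ (simp add: inner_simps fun_eq_iff)

lemma phiK_critical_iff:
  fixes \<theta> :: "real^'n"
  assumes "\<theta> \<in> OmegaK"
  shows "(phiK (x1, xs, t) has_derivative (\<lambda>h. 0)) (at \<theta>) \<longleftrightarrow> 4 *\<^sub>R t = gradF x1 xs \<theta>"
proof
  assume "(phiK (x1, xs, t) has_derivative (\<lambda>h. 0)) (at \<theta>)"
  then have "(\<lambda>h. 0) = (\<lambda>h. (4 *\<^sub>R t - gradF x1 xs \<theta>) \<bullet> h)"
    using has_derivative_phiK[OF assms] has_derivative_unique by blast
  then have "(4 *\<^sub>R t - gradF x1 xs \<theta>) \<bullet> (4 *\<^sub>R t - gradF x1 xs \<theta>) = 0" by metis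
  then show "4 *\<^sub>R t = gradF x1 xs \<theta>" by simp
next
  assume "4 *\<^sub>R t = gradF x1 xs \<theta>"
  then show "(phiK (x1, xs, t) has_derivative (\<lambda>h. 0)) (at \<theta>)"
    using has_derivative_phiK[OF assms, of x1 xs t] by simp
qed

lemma FK_critical_iff:
  fixes \<theta> :: "real^'n"
  assumes "\<theta> \<in> OmegaK"
  shows "(FK x1 xs has_derivative (\<lambda>h. (4 *\<^sub>R t) \<bullet> h)) (at \<theta>) \<longleftrightarrow> 4 *\<^sub>R t = gradF x1 xs \<theta>"
proof
  assume "(FK x1 xs has_derivative (\<lambda>h. (4 *\<^sub>R t) \<bullet> h)) (at \<theta>)"
  then have "(\<lambda>h. (4 *\<^sub>R t) \<bullet> h) = (\<lambda>h. gradF x1 xs \<theta> \<bullet> h)"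
    using has_derivative_FK[OF assms] has_derivative_unique by blast
  then have "(4 *\<^sub>R t - gradF x1 xs \<theta>) \<bullet> h = 0" for h
    by (metis inner_diff_left right_minus_eq)
  then show "4 *\<^sub>R t = gradF x1 xs \<theta>" using inner_eq_zero_iff[of "4 *\<^sub>R t - gradF x1 xs \<theta>"] by simp
next
  assume "4 *\<^sub>R t = gradF x1 xs \<theta>"
  then show "(FK x1 xs has_derivative (\<lambda>h. (4 *\<^sub>R t) \<bullet> h)) (at \<theta>)"
    using has_derivative_FK[OF assms, of x1 xs] by simp
qed

lemma linear_hessF: "\<theta> \<in> OmegaK \<Longrightarrow> linear (hessF x1 xs \<theta>)"
  using has_derivative_gradF has_derivative_linear by blast

text \<open>In \<open>pdiff [axis i 1, axis j 1]\<close> the direction j acts first, so row i holds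
  the derivative of the gradient in direction i. \<open>matrix\<close> stores images of basis
  vectors as columns, hence the transpose.\<close>

lemma hessK_eq:
  fixes \<theta> :: "real^'n::finite"
  assumes "\<theta> \<in> OmegaK"
  shows "hessK (x1, xs, t) \<theta> = transpose (matrix (\<lambda>h. - hessF x1 xs \<theta> h))"
proof -
  have "pdiff [axis i 1, axis j 1] (phiK (x1, xs, t)) \<theta> = - hessF x1 xs \<theta> (axis i 1) $ j" for i j :: 'n
  proof -
    have 1: "frechet_derivative (phiK (x1, xs, t)) (at \<sigma>) (axis j 1) = (4 *\<^sub>R t - gradF x1 xs \<sigma>) \<bullet> axis j 1"
      if "\<sigma> \<in> OmegaK" for \<sigma>
      using frechet_derivative_at[OF has_derivative_phiK[OF that, of x1 xs t]] by metis
    have "((\<lambda>\<sigma>. (4 *\<^sub>R t - gradF x1 xs \<sigma>) \<bullet> axis j 1) has_derivative (\<lambda>h. - hessF x1 xs \<theta> h \<bullet> axis j 1)) (at \<theta>)"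
      by (rule derivative_eq_intros has_derivative_gradF[OF assms] refl)+ simp
    then have "((\<lambda>\<sigma>. frechet_derivative (phiK (x1, xs, t)) (at \<sigma>) (axis j 1)) has_derivative (\<lambda>h. - hessF x1 xs \<theta> h \<bullet> axis j 1)) (at \<theta>)"
      by (rule has_derivative_transform_within_open[OF _ open_OmegaK assms]) (simp add: 1)
    from frechet_derivative_at[OF this]
    show ?thesis by (simp add: inner_axis fun_eq_iff)
  qed
  then show ?thesis by (simp add: hessK_def transpose_def matrix_def vec_eq_iff)
qed

lemma hessK_nondegenerate_iff:
  fixes \<theta> :: "real^'n::finite"
  assumes "\<theta> \<in> OmegaK"
  shows "det (hessK (x1, xs, t) \<theta>) \<noteq> 0 \<longleftrightarrow> (\<forall>h. hessF x1 xs \<theta> h = 0 \<longrightarrow> h = 0)"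
proof -
  have l: "linear (\<lambda>h. - hessF x1 xs \<theta> h)" using linear_hessF[OF assms] by (rule linear_compose_neg)
  show ?thesis
    unfolding hessK_eq[OF assms] det_transpose det_nz_iff_inj[OF l] linear_injective_0[OF l] by simp
qed

lemma hessF_inner: "hessF x1 xs \<theta> h \<bullet> h =
     4 * ddPK (\<theta> \<bullet> \<theta>) * (\<theta> \<bullet> h)\<^sup>2 * (x1\<^sup>2 * (\<theta> \<bullet> \<theta>) + (\<theta> \<bullet> xs)\<^sup>2)
     + 8 * dPK (\<theta> \<bullet> \<theta>) * (x1\<^sup>2 * (\<theta> \<bullet> h)\<^sup>2 + (\<theta> \<bullet> xs) * (xs \<bullet> h) * (\<theta> \<bullet> h))
     + (2 * dPK (\<theta> \<bullet> \<theta>) * (x1\<^sup>2 * (\<theta> \<bullet> \<theta>) + (\<theta> \<bullet> xs)\<^sup>2) + 2 * PK (\<theta> \<bullet> \<theta>) * x1\<^sup>2) * (h \<bullet> h)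
     + 2 * PK (\<theta> \<bullet> \<theta>) * (xs \<bullet> h)\<^sup>2"
  by (simp add: hessF_def inner_simps algebra_simps power2_eq_square)

text \<open>Away from \<theta> = 0 the quadratic form is x1^2 \<open>H1\<close> + \<open>H2\<close>.
  The differential equations and Cauchy-Schwarz give \<open>H1\<close> > 0. \<open>H2\<close> is
  nonnegative and becomes positive when \<theta> and \<open>xs\<close> are not orthogonal; this is
  where the concavity of 1/psi is needed.\<close>

lemma hessF_pos_def:
  fixes \<theta> :: "real^'n"
  assumes \<theta>: "\<theta> \<in> OmegaK" and nz: "x1 \<noteq> 0 \<or> \<theta> \<bullet> xs \<noteq> 0" and h: "h \<noteq> 0"
  shows "hessF x1 xs \<theta> h \<bullet> h > 0"
proof (cases "\<theta> = 0")
  case True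
  have "PK 0 * (x1\<^sup>2 * (h \<bullet> h)) > 0" using PK_pos[of 0] nz h True by simp
  moreover have "PK 0 * (xs \<bullet> h)\<^sup>2 \<ge> 0" using PK_pos[of 0] by simp
  ultimately show ?thesis unfolding hessF_inner using True by simp
next
  case False
  define y where "y = \<theta> \<bullet> \<theta>"
  define z where "z = \<theta> \<bullet> xs"
  define a where "a = xs \<bullet> h"
  define b where "b = \<theta> \<bullet> h"
  define n where "n = h \<bullet> h"
  have y: "0 < y" "y < pi\<^sup>2" using False \<theta> by (auto simp: y_def OmegaK_inner)
  have n: "n > 0" using h by (simp add: n_def)
  have cs: "b\<^sup>2 \<le> y * n" unfolding b_def y_def n_def by (rule Cauchy_Schwarz_ineq)
  define P where "P = PK y"
  define D where "D = dPK y"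
  define D2 where "D2 = ddPK y"
  have P: "P > 0" and D: "D > 0" and K: "P^3 + 2 * D * (P - 1) > 0"
    using PK_pos[of y] dPK_pos[OF y] PK_cubic_pos[OF y] y by (auto simp: P_def D_def)
  have o1: "2 * y * D = y * P\<^sup>2 - 3 * P + 1" and o2: "2 * y * D2 = P\<^sup>2 + 2 * y * P * D - 5 * D"
    using PK_ode1[OF y] PK_ode2[OF y] by (simp_all add: P_def D_def D2_def)
  define H1 where "H1 = 4 * D2 * b\<^sup>2 * y + 8 * D * b\<^sup>2 + (2 * D * y + 2 * P) * n"
  define H2 where "H2 = 4 * D2 * b\<^sup>2 * z\<^sup>2 + 8 * D * z * a * b + 2 * D * z\<^sup>2 * n + 2 * P * a\<^sup>2"
  have eq: "hessF x1 xs \<theta> h \<bullet> h = x1\<^sup>2 * H1 + H2"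
    unfolding hessF_inner H1_def H2_def y_def[symmetric] z_def[symmetric] a_def[symmetric] b_def[symmetric]
      n_def[symmetric] P_def[symmetric] D_def[symmetric] D2_def[symmetric]
    by (simp add: algebra_simps)
  have "H1 = 2 * P\<^sup>2 * b\<^sup>2 + 4 * y * P * D * b\<^sup>2 + 2 * D * (y * n - b\<^sup>2) + 2 * P * n"
  proof -
    have "4 * D2 * b\<^sup>2 * y = 2 * b\<^sup>2 * (P\<^sup>2 + 2 * y * P * D - 5 * D)" unfolding o2[symmetric] by simp
    then show ?thesis unfolding H1_def by (simp add: algebra_simps)
  qed
  also have "\<dots> > 0"
    using P D y n cs by (intro add_nonneg_pos add_nonneg_nonneg mult_nonneg_nonneg) auto
  finally have H1: "H1 > 0" .
  \<comment> \<open>The factor P completes the square in a, and y lets \<open>o2\<close> replace the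
    second derivative. After \<open>o1\<close> the coefficient left over b^2 z^2 is twice the cubic
    of \<open>PK_cubic_pos\<close>.\<close>
  have e2: "y * P * H2 = 2 * y * (P * a + 2 * D * z * b)\<^sup>2
      + 2 * z\<^sup>2 * b\<^sup>2 * (P^3 + 2 * D * (P - 1)) + 2 * D * P * z\<^sup>2 * (y * n - b\<^sup>2)"
  proof -
    have "y * P * H2 = P * (2 * b\<^sup>2 * z\<^sup>2 * (2 * y * D2) + 8 * y * D * z * a * b + 2 * D * z\<^sup>2 * n * y + 2 * y * P * a\<^sup>2)"
      unfolding H2_def by (simp add: algebra_simps)
    also have "\<dots> = 2 * y * (P * a + 2 * D * z * b)\<^sup>2 + 2 * D * P * z\<^sup>2 * (y * n - b\<^sup>2)
       + 2 * z\<^sup>2 * b\<^sup>2 * (P^3 + 2 * y * P\<^sup>2 * D - 4 * P * D - 2 * D * (2 * y * D))"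
      unfolding o2 by (simp add: algebra_simps power2_eq_square power3_eq_cube)
    also have "P^3 + 2 * y * P\<^sup>2 * D - 4 * P * D - 2 * D * (2 * y * D) = P^3 + P\<^sup>2 * (2 * y * D) - 4 * P * D - 2 * D * (2 * y * D)"
      by (simp add: algebra_simps)
    also have "\<dots> = P^3 + 2 * D * (P - 1) + (P\<^sup>2 * (2 * y * D) - 2 * D * (y * P\<^sup>2))"
      by (subst (2) o1) (simp add: algebra_simps)
    also have "\<dots> = P^3 + 2 * D * (P - 1)" by (simp add: algebra_simps)
    finally show ?thesis by simp
  qed
  have nn: "0 \<le> 2 * y * (P * a + 2 * D * z * b)\<^sup>2" "0 \<le> 2 * z\<^sup>2 * b\<^sup>2 * (P^3 + 2 * D * (P - 1))"
     "0 \<le> 2 * D * P * z\<^sup>2 * (y * n - b\<^sup>2)" using P D K y cs by auto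
  have H2: "H2 \<ge> 0"
  proof -
    have "y * P * H2 \<ge> 0" unfolding e2 using nn by linarith
    moreover have "y * P > 0" using y P by simp
    ultimately show ?thesis by (simp add: zero_le_mult_iff)
  qed
  show ?thesis
  proof (cases "x1 = 0")
    case False
    then show ?thesis unfolding eq using H1 H2 by (simp add: add_pos_nonneg)
  next
    case True
    then have z: "z \<noteq> 0" using nz by (simp add: z_def)
    have "y * P * H2 > 0"
    proof (cases "b = 0")
      case True
      then have "2 * D * P * z\<^sup>2 * (y * n - b\<^sup>2) > 0" using D P z y n by simp
      then show ?thesis unfolding e2 using nn by linarith
    next
      case False
      then have "2 * z\<^sup>2 * b\<^sup>2 * (P^3 + 2 * D * (P - 1)) > 0" using z K by simp
      then show ?thesis unfolding e2 using nn by linarith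
    qed
    moreover have "y * P > 0" using y P by simp
    ultimately have "H2 > 0" by (simp add: zero_less_mult_iff)
    then show ?thesis unfolding eq using True by simp
  qed
qed

section \<open>Critical points and the exceptional set\<close>

lemma ccdist_nonneg:
  fixes g :: "('n::finite) Kpt"
  assumes "horiz_curves g \<noteq> {}"
  shows "ccdist g \<ge> 0"
  unfolding ccdist_def by (rule cInf_greatest) (use assms length_nonneg[of _ g] in auto)

lemma phiK_le_ccdist_sq:
  fixes g :: "('n::finite) Kpt"
  assumes ne: "horiz_curves g \<noteq> {}" and \<tau>: "\<tau> \<in> OmegaK"
  shows "phiK g \<tau> \<le> (ccdist g)\<^sup>2"
proof -
  \<comment> \<open>\<open>phiK\<close> may be negative; truncation at 0 permits comparing square
    roots with lengths.\<close>
  define m where "m = max 0 (phiK g \<tau>)"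
  have "sqrt m \<le> ccdist g"
    unfolding ccdist_def
  proof (rule cInf_greatest)
    fix L assume "L \<in> (\<lambda>\<gamma>. integral {0..1} (\<lambda>s. norm (hpart (vector_derivative \<gamma> (at s))))) ` horiz_curves g"
    then obtain \<gamma> where \<gamma>: "\<gamma> \<in> horiz_curves g"
      and L: "L = integral {0..1} (\<lambda>s. norm (hpart (vector_derivative \<gamma> (at s))))" by auto
    have "m \<le> L\<^sup>2" "L \<ge> 0"
      using phiK_le_length_sq[OF \<gamma> \<tau>] length_nonneg[OF \<gamma>] by (auto simp: m_def L)
    then show "sqrt m \<le> L" by (simp add: real_le_lsqrt)
  qed (use ne in auto)
  then have "(sqrt m)\<^sup>2 \<le> (ccdist g)\<^sup>2" by (intro power_mono) (auto simp: m_def)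
  then show ?thesis by (simp add: m_def)
qed

text \<open>These identities match analysis with geometry: the first two turn the transverse and
  radial coefficients of \<open>gradF\<close> into those of the endpoint in
  \<open>reachable_interior\<close>, the third gives the squared speed in the rotating
  plane.\<close>

lemma PK_trig:
  assumes r: "0 < r" "r < pi"
  shows "PK (r\<^sup>2) * r\<^sup>2 = 1 - r * cot r"
    and "2 * dPK (r\<^sup>2) * r^3 + 2 * PK (r\<^sup>2) * r = (r - sin r * cos r) / (sin r)\<^sup>2"
    and "1 + 2 * dPK (r\<^sup>2) * r^4 + PK (r\<^sup>2) * r\<^sup>2 = (r / sin r)\<^sup>2"
proof -
  have sn: "sin r > 0" using r sin_gt_zero by blast
  show 1: "PK (r\<^sup>2) * r\<^sup>2 = 1 - r * cot r"
    unfolding PK_square[OF r] jK_def cot_def using r sn by (simp add: field_simps)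
  have m: "mK r + 2 * jK r * sin r = r * (r - sin r * cos r)"
    unfolding mK_def jK_def by (simp add: algebra_simps power2_eq_square)
  have d: "2 * dPK (r\<^sup>2) * r^3 = mK r / (r * (sin r)\<^sup>2)"
    unfolding dPK_square[OF r] using r by (simp add: power3_eq_cube power4_eq_xxxx mult_ac)
  have p: "2 * PK (r\<^sup>2) * r = 2 * jK r * sin r / (r * (sin r)\<^sup>2)"
    unfolding PK_square[OF r] using r sn by (simp add: power2_eq_square mult_ac)
  show 2: "2 * dPK (r\<^sup>2) * r^3 + 2 * PK (r\<^sup>2) * r = (r - sin r * cos r) / (sin r)\<^sup>2"
    unfolding d p add_divide_distrib[symmetric] m using r by simp
  have "1 + 2 * dPK (r\<^sup>2) * r^4 + PK (r\<^sup>2) * r\<^sup>2 = 1 + r * (2 * dPK (r\<^sup>2) * r^3 + 2 * PK (r\<^sup>2) * r) - PK (r\<^sup>2) * r\<^sup>2"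
    by (simp add: algebra_simps eval_nat_numeral)
  also have "\<dots> = r * (r - sin r * cos r) / (sin r)\<^sup>2 + r * cot r"
    unfolding 1 2 by simp
  also have "\<dots> = (r / sin r)\<^sup>2" unfolding cot_def using sn by (simp add: field_simps power2_eq_square)
  finally show "1 + 2 * dPK (r\<^sup>2) * r^4 + PK (r\<^sup>2) * r\<^sup>2 = (r / sin r)\<^sup>2" .
qed

theorem critical_point_ccdist:
  fixes \<theta> :: "real^'n::finite"
  assumes \<theta>: "\<theta> \<in> OmegaK" and crit: "4 *\<^sub>R t = gradF x1 xs \<theta>"
  shows "horiz_curves (x1, xs, t) \<noteq> {}"
    and "(ccdist (x1, xs, t))\<^sup>2 = phiK (x1, xs, t) \<theta>"
    and "phiK (x1, xs, t) \<theta> = (ssin (norm \<theta>))\<^sup>2 * x1\<^sup>2 + (norm xs)\<^sup>2 + ((ssin (norm \<theta>))\<^sup>2 - 1) * (xs \<bullet> sgn \<theta>)\<^sup>2"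
proof -
  define X where "X = (ssin (norm \<theta>))\<^sup>2 * x1\<^sup>2 + (norm xs)\<^sup>2 + ((ssin (norm \<theta>))\<^sup>2 - 1) * (xs \<bullet> sgn \<theta>)\<^sup>2"
  have main: "phiK (x1, xs, t) \<theta> = X \<and> reachable (x1, xs, t) (sqrt X)"
  proof (cases "\<theta> = 0")
    case True
    then have "t = 0" using crit by (simp add: gradF_def)
    then show ?thesis using reachable_line[of x1 xs] True by (simp add: X_def ssin_def phiK_def fK_def)
  next
    case False
    define r where "r = norm \<theta>"
    define e where "e = sgn \<theta>"
    define b where "b = xs \<bullet> e"
    have r: "0 < r" "r < pi" using \<theta> False by (auto simp: r_def OmegaK_def)
    have e: "norm e = 1" using False by (simp add: e_def norm_sgn)
    have re: "\<theta> = r *\<^sub>R e" using False by (simp add: r_def e_def sgn_div_norm)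
    have q: "\<theta> \<bullet> \<theta> = r\<^sup>2" by (simp add: r_def power2_norm_eq_inner)
    have z: "\<theta> \<bullet> xs = r * b" by (simp add: re b_def inner_commute)
    define w where "w = xs - b *\<^sub>R e"
    have xs: "xs = b *\<^sub>R e + w" by (simp add: w_def)
    \<comment> \<open>The gradient is resolved along \<open>e\<close> and along \<open>w\<close>,
      the part of \<open>xs\<close> orthogonal to \<open>e\<close>, to be compared with the endpoint
      in \<open>reachable_interior\<close>.\<close>
    have "gradF x1 xs \<theta> = (2 * dPK (r\<^sup>2) * (x1\<^sup>2 * r\<^sup>2 + (r * b)\<^sup>2) * r + 2 * PK (r\<^sup>2) * x1\<^sup>2 * r) *\<^sub>R e + (2 * PK (r\<^sup>2) * (r * b)) *\<^sub>R xs"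
      unfolding gradF_def q z by (subst re) (simp add: algebra_simps)
    also have "\<dots> = ((2 * dPK (r\<^sup>2) * r^3 + 2 * PK (r\<^sup>2) * r) * (x1\<^sup>2 + b\<^sup>2)) *\<^sub>R e + (2 * (PK (r\<^sup>2) * r\<^sup>2) * b / r) *\<^sub>R w"
      unfolding xs using r by (simp add: algebra_simps power2_eq_square power3_eq_cube)
    also have "\<dots> = 4 *\<^sub>R (((x1\<^sup>2 + b\<^sup>2) / 4 * ((r - sin r * cos r) / (sin r)\<^sup>2)) *\<^sub>R e
      + (b * (1 - r * cot r) / (2 * r)) *\<^sub>R (xs - b *\<^sub>R e))"
      unfolding PK_trig[OF r] w_def[symmetric] scaleR_add_right scaleR_scaleR
    proof (intro arg_cong2[where f="(+)"] arg_cong2[where f="(*\<^sub>R)"] refl)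
      show "(r - sin r * cos r) / (sin r)\<^sup>2 * (x1\<^sup>2 + b\<^sup>2) = 4 * ((x1\<^sup>2 + b\<^sup>2) / 4 * ((r - sin r * cos r) / (sin r)\<^sup>2))"
        by simp
      show "2 * (1 - r * cot r) * b / r = 4 * (b * (1 - r * cot r) / (2 * r))"
        using r by (simp add: field_simps)
    qed
    finally have t: "t = ((x1\<^sup>2 + b\<^sup>2) / 4 * ((r - sin r * cos r) / (sin r)\<^sup>2)) *\<^sub>R e
      + (b * (1 - r * cot r) / (2 * r)) *\<^sub>R (xs - b *\<^sub>R e)"
      using crit scaleR_cancel_left[of 4 t] by simp
    have X: "X = (r / sin r)\<^sup>2 * (x1\<^sup>2 + b\<^sup>2) + (norm xs)\<^sup>2 - b\<^sup>2"
      using r by (simp add: X_def ssin_def r_def[symmetric] e_def[symmetric] b_def[symmetric] algebra_simps)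
    have reach: "reachable (x1, xs, t) (sqrt X)"
      unfolding X t b_def by (rule reachable_interior[OF r e])
    \<comment> \<open>Pairing the critical equation with \<theta> itself removes t from the critical
      value.\<close>
    have "4 * (t \<bullet> \<theta>) = gradF x1 xs \<theta> \<bullet> \<theta>" using crit by (metis inner_scaleR_left)
    also have "\<dots> = (2 * dPK (r\<^sup>2) * r^4 + 2 * PK (r\<^sup>2) * r\<^sup>2) * (x1\<^sup>2 + b\<^sup>2)"
      unfolding gradF_def using q z by (simp add: inner_simps inner_commute algebra_simps power2_eq_square eval_nat_numeral)
    finally have "phiK (x1, xs, t) \<theta> = (1 + 2 * dPK (r\<^sup>2) * r^4 + PK (r\<^sup>2) * r\<^sup>2) * (x1\<^sup>2 + b\<^sup>2) + (norm xs)\<^sup>2 - b\<^sup>2"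
      unfolding phiK_FK FK_eq[OF \<theta>] q z by (simp add: algebra_simps power2_eq_square)
    then have "phiK (x1, xs, t) \<theta> = X" unfolding PK_trig(3)[OF r] X .
    then show ?thesis using reach by simp
  qed
  then show ne: "horiz_curves (x1, xs, t) \<noteq> {}" by (simp add: reachable_def)
  show "phiK (x1, xs, t) \<theta> = (ssin (norm \<theta>))\<^sup>2 * x1\<^sup>2 + (norm xs)\<^sup>2 + ((ssin (norm \<theta>))\<^sup>2 - 1) * (xs \<bullet> sgn \<theta>)\<^sup>2"
    using main X_def by simp
  have "X \<ge> 0" using main by (simp add: reachable_def)
  then have "(ccdist (x1, xs, t))\<^sup>2 \<le> X"
    using main power_mono[of "ccdist (x1, xs, t)" "sqrt X" 2] ccdist_nonneg[OF ne] by (simp add: reachable_def)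
  then show "(ccdist (x1, xs, t))\<^sup>2 = phiK (x1, xs, t) \<theta>"
    using main phiK_le_ccdist_sq[OF ne \<theta>] by simp
qed

text \<open>Since \<open>sgn 0 = 0\<close>, this is t itself when \<open>xs = 0\<close>, in
  accordance with the stated convention.\<close>

definition tperp :: "real^'n \<Rightarrow> real^'n \<Rightarrow> real^'n" where
  "tperp xs t = t - (t \<bullet> sgn xs) *\<^sub>R sgn xs"

text \<open>The candidate for the complement of \<open>MK\<close>. For \<open>xs = 0\<close> the
  inequality reads 0 \<le> 0, so every point (0, 0, t) belongs to it.\<close>

definition ZK :: "('n::finite) Kpt set" where
  "ZK = {(0, xs, t) | xs t. \<bar>xs \<bullet> t\<bar> \<le> (norm xs)\<^sup>2 / sqrt pi * sqrt (norm (tperp xs t))}"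

lemma tperp_props:
  fixes xs :: "real^'n"
  shows "tperp xs t \<bullet> sgn xs = 0" "tperp xs t \<bullet> xs = 0"
    "t \<bullet> sgn (tperp xs t) = norm (tperp xs t)" "norm xs * (t \<bullet> sgn xs) = xs \<bullet> t"
proof -
  have xn: "xs = norm xs *\<^sub>R sgn xs" by (cases "xs = 0") (simp_all add: sgn_div_norm)
  show 1: "tperp xs t \<bullet> sgn xs = 0"
    by (cases "xs = 0") (auto simp: tperp_def inner_simps dot_square_norm norm_sgn)
  show "tperp xs t \<bullet> xs = 0" by (subst xn) (simp add: 1)
  show "norm xs * (t \<bullet> sgn xs) = xs \<bullet> t" by (subst (3) xn) (simp add: inner_commute)
  define p where "p = tperp xs t"
  have "t = p + (t \<bullet> sgn xs) *\<^sub>R sgn xs" by (simp add: p_def tperp_def)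
  then have "t \<bullet> p = p \<bullet> p" using 1 p_def by (metis add.right_neutral inner_add_left inner_commute inner_scaleR_left mult_zero_right)
  then show "t \<bullet> sgn (tperp xs t) = norm (tperp xs t)"
    unfolding p_def[symmetric] by (cases "p = 0") (simp_all add: sgn_div_norm dot_square_norm power2_eq_square)
qed

lemma ZK_iff:
  fixes xs :: "real^'n::finite"
  assumes "xs \<noteq> 0"
  shows "(0, xs, t) \<in> ZK \<longleftrightarrow> pi * (t \<bullet> sgn xs)\<^sup>2 \<le> (norm xs)\<^sup>2 * norm (tperp xs t)"
proof -
  define N where "N = norm xs"
  define c where "c = t \<bullet> sgn xs"
  define P where "P = norm (tperp xs t)"
  have N: "N > 0" and P: "P \<ge> 0" using assms by (auto simp: N_def P_def)
  have "(0, xs, t) \<in> ZK \<longleftrightarrow> \<bar>N * c\<bar> \<le> N\<^sup>2 / sqrt pi * sqrt P"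
    unfolding ZK_def using tperp_props(4)[of xs t] by (simp add: N_def c_def P_def)
  also have "\<dots> \<longleftrightarrow> sqrt pi * \<bar>c\<bar> \<le> N * sqrt P"
    using N by (simp add: abs_mult field_simps power2_eq_square)
  also have "\<dots> \<longleftrightarrow> (sqrt pi * \<bar>c\<bar>)\<^sup>2 \<le> (N * sqrt P)\<^sup>2"
    using abs_le_square_iff[of "sqrt pi * \<bar>c\<bar>" "N * sqrt P"] N P by (simp only: abs_of_nonneg mult_nonneg_nonneg real_sqrt_ge_zero pi_ge_zero abs_ge_zero less_imp_le)
  also have "\<dots> \<longleftrightarrow> pi * c\<^sup>2 \<le> N\<^sup>2 * P" using P by (simp add: power_mult_distrib)
  finally show ?thesis by (simp add: N_def c_def P_def)
qed

text \<open>Write t = p + k \<open>xs\<close> with p orthogonal to \<open>xs\<close>. The circle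
  with \<rho> = 4 pi |p| and \<beta> = -2 pi k ends there, and its condition \<beta>^2 \<le> \<rho>
  becomes pi k^2 \<le> |p|. If p = 0, no axis is available, but then k = 0 as well and a straight
  line suffices.\<close>

lemma ZK_reachable:
  fixes xs :: "real^'n::finite"
  assumes Z: "(0, xs, t) \<in> ZK"
  shows "reachable (0, xs, t) (sqrt ((norm xs)\<^sup>2 + 4 * pi * norm (tperp xs t)))"
proof -
  define p where "p = tperp xs t"
  define k where "k = (t \<bullet> sgn xs) / norm xs"
  have t: "t = p + k *\<^sub>R xs"
    by (cases "xs = 0") (auto simp: p_def tperp_def k_def sgn_div_norm divide_inverse)
  have px: "p \<bullet> xs = 0" using tperp_props(2) p_def by blast
  have k: "pi * k\<^sup>2 \<le> norm p"
  proof (cases "xs = 0")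
    case False
    then have "pi * (t \<bullet> sgn xs)\<^sup>2 \<le> (norm xs)\<^sup>2 * norm p" using ZK_iff Z p_def by blast
    then show ?thesis using False by (simp add: k_def power_divide field_simps)
  qed (simp add: k_def)
  show ?thesis
  proof (cases "p = 0")
    case True
    then have "k = 0" using k pi_gt_zero by (auto simp: mult_le_0_iff dest: leD)
    then have "t = 0" using t True by simp
    then show ?thesis using reachable_line[of 0 xs] True p_def by simp
  next
    case False
    have "reachable (0, xs, ((4 * pi * norm p) / (4 * pi)) *\<^sub>R sgn p - ((- 2 * pi * k) / (2 * pi)) *\<^sub>R xs)
        (sqrt (4 * pi * norm p + (norm xs)\<^sup>2))"
    proof (rule reachable_circle)
      show "norm (sgn p) = 1" using False by (simp add: norm_sgn)
      show "xs \<bullet> sgn p = 0" using px by (simp add: sgn_div_norm inner_commute)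
      have "4 * pi * (pi * k\<^sup>2) \<le> 4 * pi * norm p" using k by simp
      then show "(- 2 * pi * k)\<^sup>2 \<le> 4 * pi * norm p" by (simp add: power_mult_distrib power2_eq_square mult_ac)
    qed
    moreover have "((4 * pi * norm p) / (4 * pi)) *\<^sub>R sgn p - ((- 2 * pi * k) / (2 * pi)) *\<^sub>R xs = t"
      using False t by (simp add: sgn_div_norm)
    ultimately show ?thesis by (simp add: p_def add.commute)
  qed
qed

text \<open>With x1 = 0 and a direction orthogonal to \<open>xs\<close>, both terms of F vanish, so
  \<open>phiK\<close> is affine along the ray.\<close>

lemma phiK_perp:
  fixes xs :: "real^'n::finite"
  shows "phiK (0, xs, t) (r *\<^sub>R sgn (tperp xs t)) = (norm xs)\<^sup>2 + 4 * r * norm (tperp xs t)"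
proof -
  have "sgn (tperp xs t) \<bullet> xs = 0" using tperp_props(2)[of xs t] by (simp add: sgn_div_norm)
  then show ?thesis using tperp_props(3)[of t xs] by (simp add: phiK_def)
qed

text \<open>The values along the ray of \<open>phiK_perp\<close> approach the claimed number as r
  tends to pi, and \<open>ZK_reachable\<close> supplies a curve bounding the distance by its square
  root.\<close>

lemma ZK_ccdist:
  fixes xs :: "real^'n::finite"
  assumes Z: "(0, xs, t) \<in> ZK"
  shows "(ccdist (0, xs, t))\<^sup>2 = (norm xs)\<^sup>2 + 4 * pi * norm (tperp xs t)"
    and "(SUP \<tau>\<in>OmegaK. phiK (0, xs, t) \<tau>) = (norm xs)\<^sup>2 + 4 * pi * norm (tperp xs t)"
proof -
  define D where "D = (norm xs)\<^sup>2 + 4 * pi * norm (tperp xs t)"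
  have D: "D \<ge> 0" by (simp add: D_def)
  have ne: "horiz_curves (0, xs, t) \<noteq> {}" and le: "ccdist (0, xs, t) \<le> sqrt D"
    using ZK_reachable[OF Z] by (auto simp: reachable_def D_def)
  have le2: "(ccdist (0, xs, t))\<^sup>2 \<le> D"
    using power_mono[OF le ccdist_nonneg[OF ne], of 2] D by simp
  let ?S = "SUP \<tau>\<in>OmegaK. phiK (0, xs, t) \<tau>"
  have bdd: "bdd_above (phiK (0, xs, t) ` OmegaK)"
    using phiK_le_ccdist_sq[OF ne] by (intro bdd_aboveI2)
  have S_le: "?S \<le> (ccdist (0, xs, t))\<^sup>2"
    using phiK_le_ccdist_sq[OF ne] pi_gt_zero by (intro cSUP_least) (auto simp: OmegaK_def simp del: pi_gt_zero)
  have "D \<le> ?S"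
  proof (rule tendsto_upperbound)
    show "((\<lambda>r. (norm xs)\<^sup>2 + 4 * r * norm (tperp xs t)) \<longlongrightarrow> D) (at_left pi)"
      unfolding D_def by (intro tendsto_intros)
    have "(norm xs)\<^sup>2 + 4 * r * norm (tperp xs t) \<le> ?S" if "0 < r" "r < pi" for r
    proof -
      have "r *\<^sub>R sgn (tperp xs t) \<in> OmegaK" using that by (auto simp: OmegaK_def norm_sgn)
      from cSUP_upper[OF this bdd] show ?thesis by (simp only: phiK_perp)
    qed
    then show "\<forall>\<^sub>F r in at_left pi. (norm xs)\<^sup>2 + 4 * r * norm (tperp xs t) \<le> ?S"
      unfolding eventually_at_left_field by (intro exI[of _ 0]) auto
  qed auto
  then show "(ccdist (0, xs, t))\<^sup>2 = (norm xs)\<^sup>2 + 4 * pi * norm (tperp xs t)" "?S = (norm xs)\<^sup>2 + 4 * pi * norm (tperp xs t)"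
    using S_le le2 unfolding D_def by linarith+
qed

text \<open>For a fixed norm of \<tau>, \<open>phiK\<close> is quadratic in the component a of
  \<tau> along \<open>xs\<close>. Completing the square leaves 4 c^2 / (N^2 psi), and
  \<open>psiK_lower\<close> makes this linear in pi - |\<tau>|.\<close>

lemma phiK_upper:
  fixes xs :: "real^'n::finite"
  assumes xs: "xs \<noteq> 0" and \<tau>: "\<tau> \<in> OmegaK"
  shows "phiK (0, xs, t) \<tau> \<le> (norm xs)\<^sup>2 + 4 * norm (tperp xs t) * norm (tperp xs \<tau>)
     + 4 * pi * (t \<bullet> sgn xs)\<^sup>2 * (pi - norm \<tau>) / (norm xs)\<^sup>2"
proof (cases "\<tau> = 0")
  case True
  then show ?thesis using xs by (simp add: phiK_def fK_def)
next
  case False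
  define u where "u = sgn xs"
  define N where "N = norm xs"
  define a where "a = \<tau> \<bullet> u"
  define c where "c = t \<bullet> u"
  define r where "r = norm \<tau>"
  define \<psi> where "\<psi> = psiK r"
  have r: "0 < r" "r < pi" using False \<tau> by (auto simp: r_def OmegaK_def)
  have N: "N > 0" using xs by (simp add: N_def)
  have uu: "u \<bullet> u = 1" using xs by (simp add: u_def dot_square_norm norm_sgn)
  have \<psi>: "\<psi> \<ge> 1 / (pi * (pi - r))" "\<psi> > 0"
    using psiK_lower[OF r] r by (auto simp: \<psi>_def intro: less_le_trans[of 0 "1 / (pi * (pi - r))"])
  have dec: "t \<bullet> \<tau> = tperp xs t \<bullet> tperp xs \<tau> + a * c"
    using uu by (simp add: tperp_def u_def[symmetric] a_def c_def inner_simps inner_commute)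
  have cs: "tperp xs t \<bullet> tperp xs \<tau> \<le> norm (tperp xs t) * norm (tperp xs \<tau>)" by (rule norm_cauchy_schwarz)
  have z: "\<tau> \<bullet> xs = N * a" using tperp_props(4)[of xs \<tau>] by (simp add: N_def a_def u_def inner_commute)
  have "4 * a * c - (N * a)\<^sup>2 * \<psi> \<le> 4 * c\<^sup>2 / (N\<^sup>2 * \<psi>)"
  proof -
    have "0 \<le> (N\<^sup>2 * \<psi> * a - 2 * c)\<^sup>2 / (N\<^sup>2 * \<psi>)" using N \<psi> by simp
    also have "\<dots> = (N * a)\<^sup>2 * \<psi> - 4 * a * c + 4 * c\<^sup>2 / (N\<^sup>2 * \<psi>)"
      using N \<psi> by (simp add: field_simps power2_eq_square)
    finally show ?thesis by simp
  qed
  also have "4 * c\<^sup>2 / (N\<^sup>2 * \<psi>) = 4 * c\<^sup>2 / N\<^sup>2 * (1 / \<psi>)" by simp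
  also have "\<dots> \<le> 4 * c\<^sup>2 / N\<^sup>2 * (pi * (pi - r))"
  proof (rule mult_left_mono)
    have "1 \<le> \<psi> * (pi * (pi - r))" using \<psi>(1) r by (simp add: field_simps)
    then show "1 / \<psi> \<le> pi * (pi - r)" using \<psi>(2) by (simp add: field_simps)
  qed simp
  also have "\<dots> = 4 * pi * c\<^sup>2 * (pi - r) / N\<^sup>2" by simp
  finally have "4 * a * c - (N * a)\<^sup>2 * \<psi> \<le> 4 * pi * c\<^sup>2 * (pi - r) / N\<^sup>2" .
  then show ?thesis
    unfolding phiK_def using dec cs z
    by (simp add: N_def[symmetric] c_def[symmetric] u_def[symmetric] r_def[symmetric] \<psi>_def[symmetric] algebra_simps)
qed

text \<open>The domain is open, so the maximum is taken over a compact ball large enough to contain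
  \<open>\<tau>0\<close>. By hypothesis the maximizer has norm below \<rho>, hence is interior to
  that ball and critical.\<close>

lemma phiK_interior_max:
  fixes g :: "('n::finite) Kpt"
  assumes \<tau>0: "\<tau>0 \<in> OmegaK" and \<rho>: "\<rho> < pi"
    and far: "\<And>\<tau>. \<tau> \<in> OmegaK \<Longrightarrow> norm \<tau> \<ge> \<rho> \<Longrightarrow> phiK g \<tau> < phiK g \<tau>0"
  obtains \<theta> where "\<theta> \<in> OmegaK" "4 *\<^sub>R vpart g = gradF (fst g) (fst (snd g)) \<theta>"
proof -
  obtain x1 xs t where g: "g = (x1, xs, t)" by (cases g)
  define R where "R = max \<rho> (norm \<tau>0)"
  have R: "R < pi" using \<rho> \<tau>0 by (simp add: R_def OmegaK_def)
  have sub: "cball 0 R \<subseteq> (OmegaK :: (real^'n) set)" using R by (auto simp: OmegaK_def)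
  have "continuous_on (cball 0 R) (phiK g)"
    using has_derivative_phiK has_derivative_continuous sub unfolding g
    by (meson continuous_at_imp_continuous_on subsetD)
  moreover have "cball (0::real^'n) R \<noteq> {}" using norm_ge_zero[of \<tau>0] by (auto simp: R_def simp del: norm_ge_zero)
  ultimately obtain \<theta> where \<theta>: "\<theta> \<in> cball 0 R" "\<And>\<tau>. \<tau> \<in> cball 0 R \<Longrightarrow> phiK g \<tau> \<le> phiK g \<theta>"
    using continuous_attains_sup[of "cball 0 R" "phiK g"] by auto
  have \<theta>\<Omega>: "\<theta> \<in> OmegaK" using \<theta>(1) sub by auto
  have "phiK g \<tau>0 \<le> phiK g \<theta>" by (rule \<theta>(2)) (simp add: R_def)
  then have small: "norm \<theta> < \<rho>" using far[OF \<theta>\<Omega>] by (meson linorder_not_le)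
  then have "ball 0 \<rho> \<subseteq> cball 0 R" by (auto simp: R_def)
  then have "(\<lambda>h. (4 *\<^sub>R t - gradF x1 xs \<theta>) \<bullet> h) = (\<lambda>h. 0)"
    using has_derivative_phiK[OF \<theta>\<Omega>, of x1 xs t] \<theta>(2) small unfolding g
    by (intro differential_zero_maxmin[of \<theta> "ball 0 \<rho>"]) auto
  then have "(phiK (x1, xs, t) has_derivative (\<lambda>h. 0)) (at \<theta>)"
    using has_derivative_phiK[OF \<theta>\<Omega>, of x1 xs t] by simp
  then show ?thesis
    using that[OF \<theta>\<Omega>] phiK_critical_iff[OF \<theta>\<Omega>] by (simp add: g vpart_def)
qed

section \<open>Existence of critical points off the exceptional set\<close>

lemma norm_tperp_le: "norm (tperp xs \<tau>) \<le> norm (\<tau> :: real^'n)"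
proof (cases "xs = 0")
  case False
  have uu: "sgn xs \<bullet> sgn xs = 1" using False by (simp add: dot_square_norm norm_sgn)
  have "(norm (tperp xs \<tau>))\<^sup>2 = (norm \<tau>)\<^sup>2 - (\<tau> \<bullet> sgn xs)\<^sup>2"
    unfolding power2_norm_eq_inner tperp_def using uu by (simp add: inner_simps inner_commute power2_eq_square)
  then have "(norm (tperp xs \<tau>))\<^sup>2 \<le> (norm \<tau>)\<^sup>2" by simp
  then show ?thesis by (rule power2_le_imp_le) simp
qed (simp add: tperp_def)

lemma norm_tperp_less:
  assumes "\<tau> \<bullet> xs \<noteq> 0"
  shows "norm (tperp xs \<tau>) < norm (\<tau> :: real^'n)"
proof -
  have xs: "xs \<noteq> 0" using assms by auto
  have uu: "sgn xs \<bullet> sgn xs = 1" using xs by (simp add: dot_square_norm norm_sgn)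
  have "(norm (tperp xs \<tau>))\<^sup>2 = (norm \<tau>)\<^sup>2 - (\<tau> \<bullet> sgn xs)\<^sup>2"
    unfolding power2_norm_eq_inner tperp_def using uu by (simp add: inner_simps inner_commute power2_eq_square)
  moreover have "\<tau> \<bullet> sgn xs \<noteq> 0" using assms xs by (simp add: sgn_div_norm)
  ultimately have "(norm (tperp xs \<tau>))\<^sup>2 < (norm \<tau>)\<^sup>2" by simp
  then show ?thesis by (rule power2_less_imp_less) simp
qed

text \<open>This blow-up forces an interior maximum when x1 is nonzero, and later produces the kink
  in x1.\<close>

lemma fK_lower:
  assumes "0 \<le> r" "r < pi"
  shows "pi / (pi - r) - 2 \<le> fK r"
proof (cases "r = 0")
  case False
  then have r: "0 < r" "r < pi" using assms by auto
  have "fK r = r\<^sup>2 * psiK r" using r by (simp add: psiK_def)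
  also have "\<dots> \<ge> r\<^sup>2 * (1 / (pi * (pi - r)))" using psiK_lower[OF r] by (intro mult_left_mono) auto
  finally have 1: "r\<^sup>2 / (pi * (pi - r)) \<le> fK r" by simp
  have "r\<^sup>2 / (pi * (pi - r)) = pi / (pi - r) - (pi + r) / pi" using r by (simp add: field_simps power2_eq_square)
  moreover have "(pi + r) / pi \<le> 2" using r by (simp add: divide_le_eq)
  ultimately show ?thesis using 1 by linarith
qed (simp add: fK_def)

lemma critical_point_exists_x1:
  fixes xs :: "real^'n::finite"
  assumes "x1 \<noteq> 0"
  obtains \<theta> where "\<theta> \<in> OmegaK" "4 *\<^sub>R t = gradF x1 xs \<theta>"
proof -
  \<comment> \<open>For radii beyond \<rho>, \<open>fK_lower\<close> yields f \<ge> M - 1, and M is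
    chosen so that x1^2 (M - 1) exceeds 4 pi |t|. Then \<open>phiK\<close> lies below its value at
    0.\<close>
  define M where "M = 4 * norm t * pi / x1\<^sup>2 + 2"
  have M: "M > 0" using assms by (auto simp: M_def intro!: add_nonneg_pos)
  define \<rho> where "\<rho> = pi - pi / (M + 1)"
  have \<rho>: "\<rho> < pi" using M by (simp add: \<rho>_def)
  have far: "phiK (x1, xs, t) \<tau> < phiK (x1, xs, t) 0" if \<tau>: "\<tau> \<in> OmegaK" "norm \<tau> \<ge> \<rho>" for \<tau>
  proof -
    define r where "r = norm \<tau>"
    have r: "0 \<le> r" "r < pi" "\<rho> \<le> r" using \<tau> by (auto simp: r_def OmegaK_def)
    have "pi - r \<le> pi / (M + 1)" using r by (simp add: \<rho>_def)
    then have "M + 1 \<le> pi / (pi - r)" using r M by (simp add: field_simps)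
    then have f: "4 * norm t * pi / x1\<^sup>2 < fK r" using fK_lower[OF r(1,2)] by (simp add: M_def)
    then have f1: "4 * norm t * pi < x1\<^sup>2 * fK r" using assms by (simp add: field_simps)
    have "t \<bullet> \<tau> \<le> norm t * r" unfolding r_def by (rule norm_cauchy_schwarz)
    also have "\<dots> \<le> norm t * pi" using r by (intro mult_left_mono) auto
    finally have t: "4 * (t \<bullet> \<tau>) \<le> 4 * norm t * pi" by simp
    have "(\<tau> \<bullet> xs)\<^sup>2 * psiK r \<ge> 0"
    proof -
      have "psiK r \<ge> 0" unfolding psiK_eq_PK[of r, unfolded abs_of_nonneg[OF r(1)], OF r(2)]
        using PK_pos[of "r\<^sup>2"] r by (simp add: power_strict_mono less_imp_le)
      then show ?thesis by simp
    qed
    then show ?thesis using t f1 by (simp add: phiK_def r_def[symmetric] fK_def[of 0])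
  qed
  have "0 \<in> (OmegaK :: (real^'n) set)" by (simp add: OmegaK_def)
  then obtain \<theta> where "\<theta> \<in> OmegaK" "4 *\<^sub>R vpart (x1, xs, t) = gradF (fst (x1, xs, t)) (fst (snd (x1, xs, t))) \<theta>"
    using phiK_interior_max[OF _ \<rho> far] by blast
  then show ?thesis using that[of \<theta>] unfolding vpart_def fst_conv snd_conv by blast
qed

text \<open>
For \<open>\<tau>\<close> with component \<open>\<delta>\<close> along \<open>x\<^sub>*\<close> and \<open>|\<tau>| = \<pi> - \<kappa>\<delta>\<close>, the gain is \<open>\<delta>(4|c| - 4P\<kappa> - N\<^sup>2/(\<pi>\<kappa>))\<close> to first order;
\<open>\<kappa>\<close> is the optimal slope.
\<close>

lemma phiK_exceeds:
  fixes xs :: "real^'n::finite"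
  assumes xs: "xs \<noteq> 0" and nZ: "(0, xs, t) \<notin> ZK"
  obtains \<tau>0 where "\<tau>0 \<in> OmegaK" "phiK (0, xs, t) \<tau>0 > (norm xs)\<^sup>2 + 4 * pi * norm (tperp xs t)"
proof -
  define u where "u = sgn xs"
  define N where "N = norm xs"
  define c where "c = t \<bullet> u"
  define p where "p = tperp xs t"
  define P where "P = norm p"
  have N: "N > 0" using xs by (simp add: N_def)
  have uu: "u \<bullet> u = 1" using xs by (simp add: u_def dot_square_norm norm_sgn)
  have nz: "pi * c\<^sup>2 > N\<^sup>2 * P"
    using nZ ZK_iff[OF xs, of t] by (simp add: c_def u_def N_def P_def p_def)
  then have c: "c \<noteq> 0" using N by (auto simp: P_def mult_less_0_iff)
  show ?thesis
  proof (cases "P = 0")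
    case True
    \<comment> \<open>When P = 0 the slope \<kappa> would have denominator 0. Here the gradient at 0
      is 4t, with nonzero component along u, so 0 is not a maximum and \<open>phiK\<close> already
      exceeds N^2.\<close>
    have "\<exists>\<tau>\<in>OmegaK. phiK (0, xs, t) \<tau> > phiK (0, xs, t) 0"
    proof (rule ccontr)
      assume "\<not> ?thesis"
      then have "\<forall>\<tau>\<in>OmegaK. phiK (0, xs, t) \<tau> \<le> phiK (0, xs, t) 0" by (auto simp: not_less)
      then have "(\<lambda>h. (4 *\<^sub>R t - gradF 0 xs 0) \<bullet> h) = (\<lambda>h. 0)"
        using has_derivative_phiK[of 0 0 xs t]
        by (intro differential_zero_maxmin[of 0 OmegaK "phiK (0, xs, t)"]) (auto simp: OmegaK_def)
      then have "(4 *\<^sub>R t) \<bullet> u = 0" by (simp add: gradF_def fun_eq_iff)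
      then show False using c by (simp add: c_def)
    qed
    then show ?thesis using that True by (auto simp: phiK_def fK_def P_def p_def)
  next
    case False
    then have P: "P > 0" by (simp add: P_def)
    define \<kappa> where "\<kappa> = N / (2 * sqrt (pi * P))"
    have \<kappa>: "\<kappa> > 0" using N P by (simp add: \<kappa>_def)
    have k2: "4 * P * \<kappa> + N\<^sup>2 / (pi * \<kappa>) < 4 * \<bar>c\<bar>"
    proof -
      define w where "w = sqrt (pi * P)"
      have w: "w > 0" "w\<^sup>2 = pi * P" using P by (simp_all add: w_def)
      have "4 * P * \<kappa> = 2 * N * P / w" by (simp add: \<kappa>_def w_def)
      also have "\<dots> = 2 * N * w / pi" using w by (simp add: field_simps power2_eq_square)
      finally have 1: "4 * P * \<kappa> = 2 * N * w / pi" .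
      have "\<kappa> = N / (2 * w)" by (simp add: \<kappa>_def w_def)
      then have 2: "N\<^sup>2 / (pi * \<kappa>) = 2 * N * w / pi" using N w(1) by (simp add: power2_eq_square)
      have "(N * w)\<^sup>2 = pi * (N\<^sup>2 * P)" using w by (simp add: power_mult_distrib)
      also have "\<dots> < pi * (pi * c\<^sup>2)" using nz by simp
      also have "\<dots> = (pi * \<bar>c\<bar>)\<^sup>2" by (simp add: power_mult_distrib power2_eq_square)
      finally have "(N * w)\<^sup>2 < (pi * \<bar>c\<bar>)\<^sup>2" .
      then have "N * w < pi * \<bar>c\<bar>" by (rule power2_less_imp_less) simp
      then show ?thesis unfolding 1 2 by (simp add: field_simps)
    qed
    \<comment> \<open>\<open>\<delta> * h \<delta>\<close> is a lower bound for the gain, by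
      \<open>psiK_upper\<close> and sqrt(s^2 - \<delta>^2) \<ge> s - \<delta>^2/s. The limit of h at
      0 is positive by \<open>k2\<close>, so some small \<delta> works.\<close>
    define h where "h = (\<lambda>\<delta>. 4 * \<bar>c\<bar> - 4 * P * (\<kappa> + \<delta> / (pi - \<kappa> * \<delta>)) - N\<^sup>2 * pi / ((pi - \<kappa> * \<delta>)\<^sup>2 * \<kappa>))"
    have "(h \<longlongrightarrow> 4 * \<bar>c\<bar> - 4 * P * (\<kappa> + 0 / (pi - \<kappa> * 0)) - N\<^sup>2 * pi / ((pi - \<kappa> * 0)\<^sup>2 * \<kappa>)) (at_right 0)"
      unfolding h_def using \<kappa> by (intro tendsto_intros) auto
    moreover have "4 * \<bar>c\<bar> - 4 * P * (\<kappa> + 0 / (pi - \<kappa> * 0)) - N\<^sup>2 * pi / ((pi - \<kappa> * 0)\<^sup>2 * \<kappa>) > 0"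
      using k2 \<kappa> by (simp add: power2_eq_square)
    ultimately have ev1: "\<forall>\<^sub>F \<delta> in at_right 0. h \<delta> > 0" by (rule order_tendstoD)
    have ev2: "\<forall>\<^sub>F \<delta> in at_right 0. \<delta> < pi - \<kappa> * \<delta>"
    proof -
      have "((\<lambda>\<delta>. pi - \<kappa> * \<delta> - \<delta>) \<longlongrightarrow> pi - \<kappa> * 0 - 0) (at_right 0)" by (intro tendsto_intros)
      from order_tendstoD(1)[OF this, of 0] show ?thesis by (simp add: less_diff_eq)
    qed
    have "\<forall>\<^sub>F \<delta> in at_right (0::real). \<delta> > 0" by (simp add: eventually_at_right_less)
    with ev1 ev2 have "\<forall>\<^sub>F \<delta> in at_right 0. \<delta> > 0 \<and> h \<delta> > 0 \<and> \<delta> < pi - \<kappa> * \<delta>" by eventually_elim auto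
    then obtain \<delta> where \<delta>: "\<delta> > 0" "h \<delta> > 0" "\<delta> < pi - \<kappa> * \<delta>"
      using eventually_happens trivial_limit_at_right_real by blast
    define s where "s = pi - \<kappa> * \<delta>"
    have s: "0 < s" "s < pi" "\<delta> < s" using \<delta> \<kappa> by (auto simp: s_def)
    define r1 where "r1 = sqrt (s\<^sup>2 - \<delta>\<^sup>2)"
    have sd: "\<delta>\<^sup>2 < s\<^sup>2" using s \<delta> by (simp add: power_strict_mono)
    have r1: "r1 \<ge> s - \<delta>\<^sup>2 / s"
      unfolding r1_def
    proof (rule real_le_rsqrt)
      have "(s - \<delta>\<^sup>2 / s)\<^sup>2 = s\<^sup>2 - 2 * (s * (\<delta>\<^sup>2 / s)) + (\<delta>\<^sup>2 / s)\<^sup>2"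
        by (simp add: power2_diff)
      also have "\<dots> = s\<^sup>2 - 2 * \<delta>\<^sup>2 + \<delta>\<^sup>2 * (\<delta>\<^sup>2 / s\<^sup>2)" using s by (simp add: power_divide power2_eq_square)
      also have "\<delta>\<^sup>2 * (\<delta>\<^sup>2 / s\<^sup>2) \<le> \<delta>\<^sup>2 * 1" using sd s by (intro mult_left_mono) auto
      finally show "(s - \<delta>\<^sup>2 / s)\<^sup>2 \<le> s\<^sup>2 - \<delta>\<^sup>2" by simp
    qed
    define e where "e = sgn p"
    define \<sigma> where "\<sigma> = sgn c"
    have \<sigma>: "\<sigma>\<^sup>2 = 1" "\<sigma> * c = \<bar>c\<bar>" using c by (auto simp: \<sigma>_def sgn_if)
    have eu: "e \<bullet> u = 0" using tperp_props(1)[of xs t] unfolding e_def p_def u_def sgn_div_norm[of "tperp xs t"] by simp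
    have ee: "e \<bullet> e = 1" using P by (simp add: e_def P_def dot_square_norm norm_sgn)
    have te: "t \<bullet> e = P" using tperp_props(3)[of t xs] by (simp add: e_def p_def P_def)
    \<comment> \<open>The component along u takes the sign of c, and \<open>r1\<close> is adjusted
      so that the norm is exactly s.\<close>
    define \<tau> where "\<tau> = r1 *\<^sub>R e + (\<delta> * \<sigma>) *\<^sub>R u"
    have "(norm \<tau>)\<^sup>2 = r1\<^sup>2 + (\<delta> * \<sigma>)\<^sup>2"
      unfolding power2_norm_eq_inner \<tau>_def using eu ee uu by (simp add: inner_simps inner_commute power2_eq_square)
    also have "\<dots> = s\<^sup>2" using sd \<sigma> by (simp add: r1_def power_mult_distrib)
    finally have n\<tau>: "norm \<tau> = s" using s by (simp add: power2_eq_iff_nonneg)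
    have \<tau>\<Omega>: "\<tau> \<in> OmegaK" using n\<tau> s by (simp add: OmegaK_def)
    have xu: "xs = N *\<^sub>R u" using xs by (simp add: N_def u_def sgn_div_norm)
    have tx: "(\<tau> \<bullet> xs)\<^sup>2 = N\<^sup>2 * \<delta>\<^sup>2"
      unfolding xu \<tau>_def using eu uu \<sigma> by (simp add: inner_simps power_mult_distrib)
    have tt: "t \<bullet> \<tau> = r1 * P + \<delta> * \<bar>c\<bar>"
      unfolding \<tau>_def using te \<sigma>(2) by (simp add: inner_simps c_def[symmetric] mult.assoc)
    have "\<delta>\<^sup>2 * psiK s \<le> \<delta>\<^sup>2 * (pi / (s\<^sup>2 * (pi - s)))" using psiK_upper[OF s(1,2)] by (intro mult_left_mono) auto
    also have "\<dots> = \<delta> * (pi / (s\<^sup>2 * \<kappa>))" using \<delta> \<kappa> by (simp add: s_def power2_eq_square)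
    finally have "N\<^sup>2 * (\<delta>\<^sup>2 * psiK s) \<le> N\<^sup>2 * (\<delta> * (pi / (s\<^sup>2 * \<kappa>)))" by (rule mult_left_mono) simp
    then have ps: "N\<^sup>2 * \<delta>\<^sup>2 * psiK s \<le> \<delta> * (N\<^sup>2 * pi / (s\<^sup>2 * \<kappa>))" by (simp add: mult_ac)
    have pr: "P * (r1 - pi) \<ge> P * (- (\<delta> * (\<kappa> + \<delta> / s)))"
      using r1 P s by (intro mult_left_mono) (auto simp: s_def algebra_simps power2_eq_square)
    have "phiK (0, xs, t) \<tau> - (N\<^sup>2 + 4 * pi * P) = 4 * (P * (r1 - pi)) + 4 * \<delta> * \<bar>c\<bar> - N\<^sup>2 * \<delta>\<^sup>2 * psiK s"
      by (simp add: phiK_def n\<tau> tx tt N_def[symmetric] algebra_simps)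
    also have "\<dots> \<ge> 4 * (P * (- (\<delta> * (\<kappa> + \<delta> / s)))) + 4 * \<delta> * \<bar>c\<bar> - \<delta> * (N\<^sup>2 * pi / (s\<^sup>2 * \<kappa>))"
      using ps pr by linarith
    also have "4 * (P * (- (\<delta> * (\<kappa> + \<delta> / s)))) + 4 * \<delta> * \<bar>c\<bar> - \<delta> * (N\<^sup>2 * pi / (s\<^sup>2 * \<kappa>)) = \<delta> * h \<delta>"
      unfolding h_def s_def[symmetric] by (simp add: algebra_simps)
    finally have "phiK (0, xs, t) \<tau> - (N\<^sup>2 + 4 * pi * P) \<ge> \<delta> * h \<delta>" .
    moreover have "\<delta> * h \<delta> > 0" using \<delta> by simp
    ultimately show ?thesis using that[OF \<tau>\<Omega>] by (simp add: N_def P_def p_def)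
  qed
qed

text \<open>For x1 = 0, \<open>phiK_exceeds\<close> gives a value larger by m than N^2 + 4 pi P,
  while \<open>phiK_upper\<close> allows at most K (pi - |\<tau>|) above that number. The radius
  \<rho> makes this excess at most m/2, so the maximum stays inside.\<close>

lemma critical_point_exists:
  assumes "(x1, xs, t) \<notin> (ZK :: ('n::finite) Kpt set)"
  obtains \<theta> where "\<theta> \<in> OmegaK" "4 *\<^sub>R t = gradF x1 xs \<theta>"
proof (cases "x1 = 0")
  case False
  then show ?thesis using critical_point_exists_x1 that by blast
next
  case True
  have xs: "xs \<noteq> 0" using assms True by (auto simp: ZK_def)
  define N where "N = norm xs"
  define c where "c = t \<bullet> sgn xs"
  define P where "P = norm (tperp xs t)"
  have N: "N > 0" using xs by (simp add: N_def)
  obtain \<tau>0 where \<tau>0: "\<tau>0 \<in> OmegaK" "phiK (0, xs, t) \<tau>0 > N\<^sup>2 + 4 * pi * P"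
    using phiK_exceeds[OF xs] assms True unfolding N_def P_def by blast
  define m where "m = phiK (0, xs, t) \<tau>0 - (N\<^sup>2 + 4 * pi * P)"
  define K where "K = 4 * pi * c\<^sup>2 / N\<^sup>2 + 1"
  have m: "m > 0" using \<tau>0 by (simp add: m_def)
  have K: "K > 0" by (auto simp: K_def intro!: add_nonneg_pos)
  define \<rho> where "\<rho> = pi - m / (2 * K)"
  have \<rho>: "\<rho> < pi" using m K by (simp add: \<rho>_def)
  have far: "phiK (0, xs, t) \<tau> < phiK (0, xs, t) \<tau>0" if \<tau>: "\<tau> \<in> OmegaK" "norm \<tau> \<ge> \<rho>" for \<tau>
  proof -
    have r: "norm \<tau> < pi" using \<tau> by (simp add: OmegaK_def)
    have 1: "phiK (0, xs, t) \<tau> \<le> N\<^sup>2 + 4 * P * norm (tperp xs \<tau>) + 4 * pi * c\<^sup>2 * (pi - norm \<tau>) / N\<^sup>2"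
      using phiK_upper[OF xs \<tau>(1), of t] by (simp add: N_def P_def c_def)
    have 2: "4 * P * norm (tperp xs \<tau>) \<le> 4 * pi * P"
      using mult_left_mono[of "norm (tperp xs \<tau>)" pi "4 * P"] norm_tperp_le[of xs \<tau>] r by (simp add: P_def mult_ac)
    have 3: "4 * pi * c\<^sup>2 * (pi - norm \<tau>) / N\<^sup>2 \<le> K * (pi - norm \<tau>)"
      using r by (simp add: K_def algebra_simps)
    have "K * (pi - norm \<tau>) \<le> K * (m / (2 * K))" using \<tau>(2) K by (intro mult_left_mono) (auto simp: \<rho>_def)
    also have "K * (m / (2 * K)) = m / 2" using K by simp
    finally have "phiK (0, xs, t) \<tau> \<le> N\<^sup>2 + 4 * pi * P + m / 2"
      by (intro order.trans[OF 1] add_mono order_refl 2 order.trans[OF 3])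
    moreover have "phiK (0, xs, t) \<tau>0 = N\<^sup>2 + 4 * pi * P + m" by (simp add: m_def)
    ultimately show ?thesis using m by linarith
  qed
  obtain \<theta> where "\<theta> \<in> OmegaK" "4 *\<^sub>R vpart (0, xs, t) = gradF (fst (0, xs, t)) (fst (snd (0::real, xs, t))) \<theta>"
    using phiK_interior_max[OF \<tau>0(1) \<rho> far] by blast
  then show ?thesis using that[of \<theta>] unfolding True vpart_def fst_conv snd_conv by blast
qed

section \<open>Nondegeneracy and the description of \<open>MK\<close>\<close>

lemma exists_orthogonal:
  assumes "CARD('n::finite) \<ge> 2"
  obtains h :: "real^'n" where "norm h = 1" "h \<bullet> v = 0"
proof -
  have "\<exists>h::real^'n. h \<noteq> 0 \<and> orthogonal v h"
    using orthogonal_to_vector_exists[of v] assms by (metis DIM_cart DIM_real mult.right_neutral)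
  then obtain h :: "real^'n" where "h \<noteq> 0" "v \<bullet> h = 0" by (auto simp: orthogonal_def)
  then show ?thesis using that[of "sgn h"] by (simp add: norm_sgn sgn_div_norm inner_commute)
qed

lemma critical_nondegenerate:
  fixes \<theta> :: "real^'n::finite"
  assumes "\<theta> \<in> OmegaK" "x1 \<noteq> 0 \<or> \<theta> \<bullet> xs \<noteq> 0"
  shows "det (hessK (x1, xs, t) \<theta>) \<noteq> 0"
  unfolding hessK_nondegenerate_iff[OF assms(1)]
proof (intro allI impI)
  fix h assume "hessF x1 xs \<theta> h = 0"
  then have "hessF x1 xs \<theta> h \<bullet> h = 0" by simp
  then show "h = 0" using hessF_pos_def[OF assms, of h] by force
qed

text \<open>The Hessian of F reduces to a multiple of the projection onto the line of
  \<open>xs\<close>; in dimension at least 2 it has a kernel.\<close>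

lemma critical_degenerate:
  fixes \<theta> :: "real^'n::finite"
  assumes n2: "CARD('n) \<ge> 2" and \<theta>: "\<theta> \<in> OmegaK" "\<theta> \<bullet> xs = 0"
  shows "det (hessK (0, xs, t) \<theta>) = 0"
proof -
  obtain h :: "real^'n" where h: "norm h = 1" "h \<bullet> xs = 0" using exists_orthogonal[OF n2] by blast
  have "hessF 0 xs \<theta> h = 0" using \<theta>(2) h(2) by (simp add: hessF_def inner_commute)
  moreover have "h \<noteq> 0" using h by auto
  ultimately show ?thesis using hessK_nondegenerate_iff[OF \<theta>(1)] by blast
qed

text \<open>A critical value equals the squared distance N^2 + 4 pi P. If \<theta> were not
  orthogonal to \<open>xs\<close>, its orthogonal part would be strictly shorter than \<theta>, and
  \<open>phiK_upper\<close> would give strictly less. For P = 0 the point t is 0 and the loss comes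
  from the psi term.\<close>

lemma ZK_no_critical:
  fixes \<theta> :: "real^'n::finite"
  assumes Z: "(0, xs, t) \<in> ZK" and \<theta>: "\<theta> \<in> OmegaK" and crit: "4 *\<^sub>R t = gradF 0 xs \<theta>"
  shows "\<theta> \<bullet> xs = 0"
proof (rule ccontr)
  assume nz: "\<theta> \<bullet> xs \<noteq> 0"
  then have xs: "xs \<noteq> 0" and \<theta>0: "\<theta> \<noteq> 0" by auto
  define N where "N = norm xs"
  define c where "c = t \<bullet> sgn xs"
  define P where "P = norm (tperp xs t)"
  have N: "N > 0" using xs by (simp add: N_def)
  have r: "0 < norm \<theta>" "norm \<theta> < pi" using \<theta> \<theta>0 by (auto simp: OmegaK_def)
  have val: "phiK (0, xs, t) \<theta> = N\<^sup>2 + 4 * pi * P"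
    using ZK_ccdist(1)[OF Z] critical_point_ccdist(2)[OF \<theta> crit] by (simp add: N_def P_def)
  have z: "pi * c\<^sup>2 \<le> N\<^sup>2 * P" using Z ZK_iff[OF xs] by (simp add: N_def P_def c_def)
  show False
  proof (cases "P = 0")
    case True
    then have "c\<^sup>2 \<le> 0" using z mult_le_cancel_left_pos[of pi "c\<^sup>2" 0] by simp
    then have "c = 0" by simp
    then have "tperp xs t = t" by (simp add: c_def tperp_def)
    then have "t = 0" using True by (simp add: P_def)
    have "0 < 1 / (pi * (pi - norm \<theta>))" using r by simp
    then have "psiK (norm \<theta>) > 0" using psiK_lower[OF r] by linarith
    then have "(\<theta> \<bullet> xs)\<^sup>2 * psiK (norm \<theta>) > 0" using nz by simp
    moreover have "phiK (0, xs, t) \<theta> = N\<^sup>2 - (\<theta> \<bullet> xs)\<^sup>2 * psiK (norm \<theta>)"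
      unfolding \<open>t = 0\<close> by (simp add: phiK_def N_def)
    moreover have "phiK (0, xs, t) \<theta> = N\<^sup>2" using val True by simp
    ultimately show False by linarith
  next
    case False
    then have P: "P > 0" by (simp add: P_def)
    have "N\<^sup>2 + 4 * pi * P \<le> N\<^sup>2 + 4 * P * norm (tperp xs \<theta>) + 4 * pi * c\<^sup>2 * (pi - norm \<theta>) / N\<^sup>2"
      using phiK_upper[OF xs \<theta>, of t] val by (simp add: N_def P_def c_def)
    also have "4 * pi * c\<^sup>2 * (pi - norm \<theta>) / N\<^sup>2 = 4 * (pi * c\<^sup>2 / N\<^sup>2) * (pi - norm \<theta>)" by simp
    also have "\<dots> \<le> 4 * P * (pi - norm \<theta>)"
      using z N r by (intro mult_right_mono) (auto simp: field_simps)
    also have "4 * P * norm (tperp xs \<theta>) < 4 * P * norm \<theta>" using norm_tperp_less[OF nz] P by simp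
    finally show False by (simp add: algebra_simps)
  qed
qed

theorem MK_eq:
  assumes n2: "CARD('n::finite) \<ge> 2"
  shows "(MK :: 'n Kpt set) = - ZK"
proof (intro set_eqI)
  fix g :: "'n Kpt"
  obtain x1 xs t where g: "g = (x1, xs, t)" by (cases g)
  have "g \<in> MK \<longleftrightarrow> (\<exists>\<theta>\<in>OmegaK. 4 *\<^sub>R t = gradF x1 xs \<theta> \<and> det (hessK (x1, xs, t) \<theta>) \<noteq> 0)"
    unfolding MK_def g mem_Collect_eq by (intro bex_cong refl) (simp add: phiK_critical_iff)
  also have "\<dots> \<longleftrightarrow> g \<notin> ZK"
  proof
    assume "\<exists>\<theta>\<in>OmegaK. 4 *\<^sub>R t = gradF x1 xs \<theta> \<and> det (hessK (x1, xs, t) \<theta>) \<noteq> 0"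
    then obtain \<theta> where \<theta>: "\<theta> \<in> OmegaK" "4 *\<^sub>R t = gradF x1 xs \<theta>" "det (hessK (x1, xs, t) \<theta>) \<noteq> 0" by auto
    show "g \<notin> ZK"
    proof
      assume Z: "g \<in> ZK"
      then have x1: "x1 = 0" by (auto simp: g ZK_def)
      then show False using ZK_no_critical[of xs t \<theta>] critical_degenerate[OF n2, of \<theta> xs t] \<theta> Z g by auto
    qed
  next
    assume nZ: "g \<notin> ZK"
    then obtain \<theta> where \<theta>: "\<theta> \<in> OmegaK" "4 *\<^sub>R t = gradF x1 xs \<theta>" using critical_point_exists g by blast
    \<comment> \<open>Otherwise the gradient vanishes, so t = 0, and (0, \<open>xs\<close>, 0) is
      exceptional.\<close>
    have "x1 \<noteq> 0 \<or> \<theta> \<bullet> xs \<noteq> 0"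
    proof (rule ccontr)
      assume *: "\<not> ?thesis"
      then have "t = 0" using \<theta>(2) by (simp add: gradF_def)
      then show False using nZ * by (simp add: g ZK_def)
    qed
    then show "\<exists>\<theta>\<in>OmegaK. 4 *\<^sub>R t = gradF x1 xs \<theta> \<and> det (hessK (x1, xs, t) \<theta>) \<noteq> 0"
      using critical_nondegenerate \<theta> by blast
  qed
  finally show "g \<in> MK \<longleftrightarrow> g \<in> - ZK" by simp
qed

theorem ccdist_eq_SUP:
  fixes g :: "('n::finite) Kpt"
  shows "(ccdist g)\<^sup>2 = (SUP \<tau>\<in>OmegaK. phiK g \<tau>)"
proof (cases "g \<in> ZK")
  case True
  then obtain xs t where "g = (0, xs, t)" "(0, xs, t) \<in> ZK" by (auto simp: ZK_def)
  then show ?thesis using ZK_ccdist by metis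
next
  case False
  obtain x1 xs t where g: "g = (x1, xs, t)" by (cases g)
  obtain \<theta> where \<theta>: "\<theta> \<in> OmegaK" "4 *\<^sub>R t = gradF x1 xs \<theta>" using critical_point_exists False g by blast
  note c = critical_point_ccdist[OF \<theta>, folded g]
  show ?thesis
  proof (rule antisym)
    show "(SUP \<tau>\<in>OmegaK. phiK g \<tau>) \<le> (ccdist g)\<^sup>2"
      using phiK_le_ccdist_sq[OF c(1)] \<theta>(1) by (intro cSUP_least) auto
    show "(ccdist g)\<^sup>2 \<le> (SUP \<tau>\<in>OmegaK. phiK g \<tau>)"
      unfolding c(2) using phiK_le_ccdist_sq[OF c(1)] by (intro cSUP_upper[OF \<theta>(1)] bdd_aboveI2)
  qed
qed

section \<open>Smoothness off the exceptional set\<close>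

text \<open>
Convexity of \<open>F\<close> comes for free: \<open>\<phi>((x,t);\<cdot>)\<close> is an infimum of affine functions, one for each horizontal curve ending above \<open>x\<close>.
\<close>

lemma FK_support:
  fixes \<sigma> \<tau> :: "real^'n::finite"
  assumes "\<sigma> \<in> OmegaK" "\<tau> \<in> OmegaK"
  shows "FK x1 xs \<tau> \<ge> FK x1 xs \<sigma> + gradF x1 xs \<sigma> \<bullet> (\<tau> - \<sigma>)"
proof -
  define t where "t = (1/4) *\<^sub>R gradF x1 xs \<sigma>"
  have t: "4 *\<^sub>R t = gradF x1 xs \<sigma>" by (simp add: t_def)
  have "phiK (x1, xs, t) \<tau> \<le> phiK (x1, xs, t) \<sigma>"
    using phiK_le_ccdist_sq[OF critical_point_ccdist(1)[OF assms(1) t] assms(2)]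
      critical_point_ccdist(2)[OF assms(1) t] by simp
  then have "4 * (t \<bullet> \<tau>) - FK x1 xs \<tau> \<le> 4 * (t \<bullet> \<sigma>) - FK x1 xs \<sigma>" by (simp add: phiK_FK)
  moreover have "gradF x1 xs \<sigma> \<bullet> (\<tau> - \<sigma>) = 4 * (t \<bullet> \<tau>) - 4 * (t \<bullet> \<sigma>)"
    unfolding t[symmetric] by (simp add: inner_diff_right)
  ultimately show ?thesis by simp
qed

text \<open>Two critical points are both global maxima of the concave function \<open>phiK\<close>,
  so the whole segment between them consists of critical points. The gradient of F is then constant
  there, against the positive Hessian at \<theta>.\<close>

lemma critical_point_unique:
  fixes \<theta> \<theta>' :: "real^'n::finite"
  assumes \<theta>: "\<theta> \<in> OmegaK" "4 *\<^sub>R t = gradF x1 xs \<theta>" and \<theta>': "\<theta>' \<in> OmegaK" "4 *\<^sub>R t = gradF x1 xs \<theta>'"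
    and nz: "x1 \<noteq> 0 \<or> \<theta> \<bullet> xs \<noteq> 0"
  shows "\<theta>' = \<theta>"
proof (rule ccontr)
  assume neq: "\<theta>' \<noteq> \<theta>"
  define h where "h = \<theta>' - \<theta>"
  have h: "h \<noteq> 0" using neq by (simp add: h_def)
  have seg: "\<theta> + s *\<^sub>R h \<in> OmegaK" if "0 \<le> s" "s \<le> 1" for s
  proof -
    have "(1 - s) *\<^sub>R \<theta> + s *\<^sub>R \<theta>' \<in> OmegaK"
      using convexD[OF convex_ball[of 0 pi], of \<theta> \<theta>' "1 - s" s] \<theta>(1) \<theta>'(1) that unfolding OmegaK_def by auto
    moreover have "(1 - s) *\<^sub>R \<theta> + s *\<^sub>R \<theta>' = \<theta> + s *\<^sub>R h" by (simp add: h_def algebra_simps)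
    ultimately show ?thesis by simp
  qed
  have max\<theta>: "phiK (x1, xs, t) \<tau> \<le> phiK (x1, xs, t) \<theta>" if "\<tau> \<in> OmegaK" for \<tau>
    using phiK_le_ccdist_sq[OF critical_point_ccdist(1)[OF \<theta>] that] critical_point_ccdist(2)[OF \<theta>] by simp
  have same: "phiK (x1, xs, t) \<theta>' = phiK (x1, xs, t) \<theta>"
    using critical_point_ccdist(2)[OF \<theta>] critical_point_ccdist(2)[OF \<theta>'] by simp
  have const: "gradF x1 xs (\<theta> + s *\<^sub>R h) = 4 *\<^sub>R t" if s: "0 \<le> s" "s \<le> 1" for s
  proof -
    define \<sigma> where "\<sigma> = \<theta> + s *\<^sub>R h"
    have \<sigma>: "\<sigma> \<in> OmegaK" using seg[OF s] by (simp add: \<sigma>_def)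
    define G where "G = gradF x1 xs \<sigma>"
    have a: "FK x1 xs \<theta> \<ge> FK x1 xs \<sigma> - s * (G \<bullet> h)"
      using FK_support[OF \<sigma> \<theta>(1), of x1 xs] by (simp add: \<sigma>_def G_def)
    have b: "FK x1 xs \<theta>' \<ge> FK x1 xs \<sigma> + (1 - s) * (G \<bullet> h)"
    proof -
      have "\<theta>' - \<sigma> = (1 - s) *\<^sub>R h" by (simp add: \<sigma>_def h_def algebra_simps)
      then show ?thesis using FK_support[OF \<sigma> \<theta>'(1), of x1 xs] by (simp add: G_def)
    qed
    have "(1 - s) * FK x1 xs \<theta> + s * FK x1 xs \<theta>' \<ge> (1 - s) * (FK x1 xs \<sigma> - s * (G \<bullet> h)) + s * (FK x1 xs \<sigma> + (1 - s) * (G \<bullet> h))"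
      using s a b by (intro add_mono mult_left_mono) auto
    also have "(1 - s) * (FK x1 xs \<sigma> - s * (G \<bullet> h)) + s * (FK x1 xs \<sigma> + (1 - s) * (G \<bullet> h)) = FK x1 xs \<sigma>"
      by (simp add: algebra_simps)
    finally have conv: "FK x1 xs \<sigma> \<le> (1 - s) * FK x1 xs \<theta> + s * FK x1 xs \<theta>'" .
    have lin: "t \<bullet> \<sigma> = (1 - s) * (t \<bullet> \<theta>) + s * (t \<bullet> \<theta>')"
      by (simp add: \<sigma>_def h_def inner_simps algebra_simps)
    have "phiK (x1, xs, t) \<sigma> \<ge> (1 - s) * phiK (x1, xs, t) \<theta> + s * phiK (x1, xs, t) \<theta>'"
      using conv unfolding phiK_FK lin by (simp add: algebra_simps)
    then have "phiK (x1, xs, t) \<sigma> \<ge> phiK (x1, xs, t) \<theta>" unfolding same by (simp add: algebra_simps)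
    then have "\<forall>\<tau>\<in>OmegaK. phiK (x1, xs, t) \<tau> \<le> phiK (x1, xs, t) \<sigma>" using max\<theta> by force
    then have "(\<lambda>h. (4 *\<^sub>R t - gradF x1 xs \<sigma>) \<bullet> h) = (\<lambda>h. 0)"
      using has_derivative_phiK[OF \<sigma>, of x1 xs t] \<sigma> open_OmegaK
      by (intro differential_zero_maxmin[of \<sigma> OmegaK "phiK (x1, xs, t)"]) auto
    then have "(phiK (x1, xs, t) has_derivative (\<lambda>h. 0)) (at \<sigma>)"
      using has_derivative_phiK[OF \<sigma>, of x1 xs t] by simp
    then show ?thesis using phiK_critical_iff[OF \<sigma>] by (simp add: \<sigma>_def)
  qed
  have line: "((\<lambda>s. \<theta> + s *\<^sub>R h) has_derivative (\<lambda>s. s *\<^sub>R h)) (at 0)"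
    by (auto intro!: derivative_eq_intros)
  have gd: "(gradF x1 xs has_derivative hessF x1 xs \<theta>) (at (\<theta> + 0 *\<^sub>R h))"
    using has_derivative_gradF[OF \<theta>(1)] by simp
  have "((\<lambda>s. gradF x1 xs (\<theta> + s *\<^sub>R h) \<bullet> h) has_derivative (\<lambda>s. hessF x1 xs \<theta> (s *\<^sub>R h) \<bullet> h)) (at 0)"
    by (rule has_derivative_inner_left[OF has_derivative_compose[OF line gd]])
  then have "((\<lambda>s. gradF x1 xs (\<theta> + s *\<^sub>R h) \<bullet> h) has_real_derivative hessF x1 xs \<theta> h \<bullet> h) (at 0)"
    by (rule has_derivative_imp_has_field_derivative) (simp add: linear_scale[OF linear_hessF[OF \<theta>(1)]])
  from DERIV_pos_inc_right[OF this hessF_pos_def[OF \<theta>(1) nz h]]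
  obtain d where d: "d > 0" "\<And>s. 0 < s \<Longrightarrow> s < d \<Longrightarrow> gradF x1 xs \<theta> \<bullet> h < gradF x1 xs (\<theta> + s *\<^sub>R h) \<bullet> h"
    by auto
  have "gradF x1 xs \<theta> \<bullet> h < gradF x1 xs (\<theta> + (min (d/2) 1) *\<^sub>R h) \<bullet> h"
    using d(1) by (intro d(2)) auto
  then show False using const[of "min (d/2) 1"] const[of 0] d(1) by simp
qed

section \<open>The map from (x, theta) to (x, t)\<close>

lemma Ck_frechet:
  fixes f :: "'a::euclidean_space \<Rightarrow> real"
  assumes S: "open S" and f: "Ck (Suc k) S f"
  shows "Ck k S (\<lambda>x. frechet_derivative f (at x) v)"
    and "x \<in> S \<Longrightarrow> (f has_derivative frechet_derivative f (at x)) (at x)"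
proof -
  obtain f' where f': "\<forall>x\<in>S. (f has_derivative f' x) (at x)" "\<forall>b\<in>Basis. Ck k S (\<lambda>x. f' x b)"
    using f by auto
  have eq: "frechet_derivative f (at x) = f' x" if "x \<in> S" for x
    using f'(1) frechet_derivative_at that by (metis (no_types))
  show "x \<in> S \<Longrightarrow> (f has_derivative frechet_derivative f (at x)) (at x)" using f'(1) eq by simp
  show "Ck k S (\<lambda>x. frechet_derivative f (at x) v)"
  proof (rule Ck_cong[OF S, where f="\<lambda>x. \<Sum>b\<in>Basis. (v \<bullet> b) * f' x b"])
    show "Ck k S (\<lambda>x. \<Sum>b\<in>Basis. (v \<bullet> b) * f' x b)" using f'(2) by (intro Ck_sum Ck_mult Ck_const) auto
    fix x assume x: "x \<in> S"
    have lin: "linear (f' x)" using f'(1) x has_derivative_linear by blast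
    have "f' x v = f' x (\<Sum>b\<in>Basis. (v \<bullet> b) *\<^sub>R b)" by (simp add: euclidean_representation)
    also have "\<dots> = (\<Sum>b\<in>Basis. (v \<bullet> b) * f' x b)" using lin by (simp add: linear_sum linear_scale)
    finally show "(\<Sum>b\<in>Basis. (v \<bullet> b) * f' x b) = frechet_derivative f (at x) v" using eq[OF x] by simp
  qed
qed

text \<open>The type of group points is reused for pairs (x, \<theta>), with \<theta> in the
  vertical slot. \<open>expK\<close> sends such a pair to the point for which \<theta> is critical,
  and \<open>WK\<close> keeps the nondegenerate pairs. The gradient is split into coordinates
  \<open>GK i\<close> because \<open>Ck\<close> concerns scalar functions.\<close>

definition W0 :: "('n::finite) Kpt set" where "W0 = {w. snd (snd w) \<in> OmegaK}"
definition WK :: "('n::finite) Kpt set" where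
  "WK = {w. snd (snd w) \<in> OmegaK \<and> (fst w \<noteq> 0 \<or> snd (snd w) \<bullet> fst (snd w) \<noteq> 0)}"
definition GK :: "'n \<Rightarrow> ('n::finite) Kpt \<Rightarrow> real" where
  "GK i w = gradF (fst w) (fst (snd w)) (snd (snd w)) $ i"
definition dGK :: "'n \<Rightarrow> ('n::finite) Kpt \<Rightarrow> 'n Kpt \<Rightarrow> real" where
  "dGK i w = frechet_derivative (GK i) (at w)"
definition expK :: "('n::finite) Kpt \<Rightarrow> 'n Kpt" where
  "expK w = (fst w, fst (snd w), (1/4) *\<^sub>R gradF (fst w) (fst (snd w)) (snd (snd w)))"

lemma open_W0: "open (W0 :: ('n::finite) Kpt set)"
proof -
  have "open ((\<lambda>w::'n Kpt. snd (snd w)) -` OmegaK)"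
    by (intro open_vimage open_OmegaK continuous_intros)
  then show ?thesis by (simp add: W0_def vimage_def)
qed

lemma open_WK: "open (WK :: ('n::finite) Kpt set)"
proof -
  have 1: "open {w::'n Kpt. fst w \<noteq> 0}" "open {w::'n Kpt. snd (snd w) \<bullet> fst (snd w) \<noteq> 0}"
    by (intro open_Collect_neq continuous_intros)+
  have 2: "WK = W0 \<inter> ({w::'n Kpt. fst w \<noteq> 0} \<union> {w. snd (snd w) \<bullet> fst (snd w) \<noteq> 0})"
    by (auto simp: WK_def W0_def)
  show ?thesis unfolding 2 by (intro open_Int open_Un open_W0 1)
qed

lemma WK_W0: "WK \<subseteq> W0" by (auto simp: WK_def W0_def)

lemma Ck_proj:
  "Ck k S (\<lambda>w::('n::finite) Kpt. fst w)"
  "Ck k S (\<lambda>w::('n::finite) Kpt. fst (snd w) $ i)"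
  "Ck k S (\<lambda>w::('n::finite) Kpt. snd (snd w) $ i)"
  by (intro Ck_bounded_linear bounded_linear_fst
      bounded_linear_compose[OF bounded_linear_vec_nth bounded_linear_compose[OF bounded_linear_fst bounded_linear_snd]]
      bounded_linear_compose[OF bounded_linear_vec_nth bounded_linear_compose[OF bounded_linear_snd bounded_linear_snd]])+

lemma Ck_inner_vec:
  fixes f g :: "'a::euclidean_space \<Rightarrow> real^'n::finite"
  assumes "\<And>i. Ck k S (\<lambda>x. f x $ i)" "\<And>i. Ck k S (\<lambda>x. g x $ i)"
  shows "Ck k S (\<lambda>x. f x \<bullet> g x)"
  unfolding inner_vec_def inner_real_def by (intro Ck_sum Ck_mult assms)

lemma Ck_GK: "Ck k W0 (GK (i :: 'n::finite))"
proof -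
  have q: "Ck k W0 (\<lambda>w::'n Kpt. snd (snd w) \<bullet> snd (snd w))"
    and z: "Ck k W0 (\<lambda>w::'n Kpt. snd (snd w) \<bullet> fst (snd w))"
    by (intro Ck_inner_vec Ck_proj)+
  have P: "Ck k W0 (\<lambda>w::'n Kpt. PK (snd (snd w) \<bullet> snd (snd w)))"
    and D: "Ck k W0 (\<lambda>w::'n Kpt. dPK (snd (snd w) \<bullet> snd (snd w)))"
    by (rule Ck_compose_real[OF open_W0 _ q, where T=IK]; simp add: W0_def OmegaK_IK Ck_PK Ck_dPK)+
  show ?thesis
    unfolding GK_def[abs_def] gradF_def vector_add_component vector_scaleR_component real_scaleR_def
    by (intro Ck_add Ck_mult Ck_const Ck_power P D q z Ck_proj)
qed

lemma has_derivative_GK: "w \<in> W0 \<Longrightarrow> (GK i has_derivative dGK i w) (at w)"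
  unfolding dGK_def by (rule Ck_frechet(2)[OF open_W0 Ck_GK])

lemma Ck_dGK: "Ck k W0 (\<lambda>w. dGK i w v)"
  unfolding dGK_def by (rule Ck_frechet(1)[OF open_W0 Ck_GK])

lemma dGK_vertical:
  assumes w: "w \<in> W0"
  shows "dGK i w (0, 0, k) = hessF (fst w) (fst (snd w)) (snd (snd w)) k $ i"
proof -
  obtain x1 xs \<theta> where ww: "w = (x1, xs, \<theta>)" by (cases w)
  have \<theta>: "\<theta> \<in> OmegaK" using w by (simp add: W0_def ww)
  have "((\<lambda>\<theta>. (x1, xs, \<theta>)) has_derivative (\<lambda>k. (0, 0, k))) (at \<theta>)"
    by (intro has_derivative_Pair has_derivative_ident has_derivative_const)
  from has_derivative_compose[OF this, of "GK i" "dGK i w"] has_derivative_GK[OF w, of i]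
  have 1: "((\<lambda>\<theta>. GK i (x1, xs, \<theta>)) has_derivative (\<lambda>k. dGK i w (0, 0, k))) (at \<theta>)"
    by (simp add: ww)
  have 2: "((\<lambda>\<theta>. gradF x1 xs \<theta> $ i) has_derivative (\<lambda>k. hessF x1 xs \<theta> k $ i)) (at \<theta>)"
    by (rule bounded_linear.has_derivative[OF bounded_linear_vec_nth has_derivative_gradF[OF \<theta>]])
  have "(\<lambda>k. dGK i w (0, 0, k)) = (\<lambda>k. hessF x1 xs \<theta> k $ i)"
    using has_derivative_unique[OF 1] 2 by (simp add: GK_def)
  then show ?thesis by (simp add: ww fun_eq_iff)
qed

lemma has_derivative_expK:
  fixes w :: "('n::finite) Kpt"
  assumes w: "w \<in> W0"
  shows "(expK has_derivative (\<lambda>v. (fst v, fst (snd v), (1/4) *\<^sub>R (\<chi> i. dGK i w v)))) (at w)"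
proof -
  have "((\<lambda>w. gradF (fst w) (fst (snd w)) (snd (snd w))) has_derivative (\<lambda>v. (\<chi> i. dGK i w v))) (at w)"
  proof (subst has_derivative_componentwise_within, intro ballI)
    fix b :: "real^'n" assume "b \<in> Basis"
    then obtain i where b: "b = axis i 1" by (auto simp: Basis_vec_def)
    show "((\<lambda>w. gradF (fst w) (fst (snd w)) (snd (snd w)) \<bullet> b) has_derivative (\<lambda>v. (\<chi> i. dGK i w v) \<bullet> b)) (at w)"
      using has_derivative_GK[OF w, of i] by (simp add: b inner_axis GK_def[abs_def])
  qed
  then show ?thesis
    unfolding expK_def[abs_def]
    by (intro has_derivative_Pair has_derivative_fst has_derivative_snd has_derivative_scaleR_right has_derivative_ident)
qed

lemma inj_on_expK: "inj_on expK (WK :: ('n::finite) Kpt set)"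
proof (rule inj_onI)
  fix w w' :: "'n Kpt" assume w: "w \<in> WK" "w' \<in> WK" "expK w = expK w'"
  obtain x1 xs \<theta> where ww: "w = (x1, xs, \<theta>)" by (cases w)
  obtain x1' xs' \<theta>' where ww': "w' = (x1', xs', \<theta>')" by (cases w')
  have eq: "x1' = x1" "xs' = xs" "gradF x1 xs \<theta> = gradF x1 xs \<theta>'"
    using w(3) by (auto simp: ww ww' expK_def)
  have "\<theta>' = \<theta>"
    by (rule critical_point_unique[of \<theta> "(1/4) *\<^sub>R gradF x1 xs \<theta>" x1 xs \<theta>']) (use w eq in \<open>auto simp: ww ww' WK_def\<close>)
  then show "w = w'" using eq by (simp add: ww ww')
qed

lemma expK_image:
  assumes n2: "CARD('n::finite) \<ge> 2"
  shows "expK ` WK = (MK :: 'n Kpt set)"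
proof (intro set_eqI)
  fix g :: "'n Kpt"
  obtain x1 xs t where g: "g = (x1, xs, t)" by (cases g)
  have "g \<in> expK ` WK \<longleftrightarrow> (\<exists>\<theta>\<in>OmegaK. t = (1/4) *\<^sub>R gradF x1 xs \<theta> \<and> (x1 \<noteq> 0 \<or> \<theta> \<bullet> xs \<noteq> 0))"
    unfolding g image_iff WK_def expK_def by auto
  also have "\<dots> \<longleftrightarrow> (\<exists>\<theta>\<in>OmegaK. (phiK (x1, xs, t) has_derivative (\<lambda>h. 0)) (at \<theta>) \<and> det (hessK (x1, xs, t) \<theta>) \<noteq> 0)"
  proof (intro bex_cong refl conj_cong)
    fix \<theta> :: "real^'n" assume \<theta>: "\<theta> \<in> OmegaK"
    show "t = (1/4) *\<^sub>R gradF x1 xs \<theta> \<longleftrightarrow> (phiK (x1, xs, t) has_derivative (\<lambda>h. 0)) (at \<theta>)"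
      unfolding phiK_critical_iff[OF \<theta>]
    proof
      assume "4 *\<^sub>R t = gradF x1 xs \<theta>"
      then have "(1/4) *\<^sub>R gradF x1 xs \<theta> = (1/4) *\<^sub>R (4 *\<^sub>R t)" by simp
      then show "t = (1/4) *\<^sub>R gradF x1 xs \<theta>" by simp
    qed simp
    show "(x1 \<noteq> 0 \<or> \<theta> \<bullet> xs \<noteq> 0) \<longleftrightarrow> det (hessK (x1, xs, t) \<theta>) \<noteq> 0"
      using critical_nondegenerate[OF \<theta>, of x1 xs t] critical_degenerate[OF n2 \<theta>, of xs t] by auto
  qed
  also have "\<dots> \<longleftrightarrow> g \<in> MK" by (simp add: MK_def g)
  finally show "g \<in> expK ` WK \<longleftrightarrow> g \<in> MK" .
qed

lemma continuous_on_expK: "continuous_on WK expK"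
  by (rule continuous_at_imp_continuous_on)
     (use has_derivative_expK has_derivative_continuous WK_W0 in blast)

text \<open>Invariance of domain applied to the injective continuous map \<open>expK\<close>;
  openness is thus known before the inverse is differentiated.\<close>

lemma open_MK:
  assumes "CARD('n::finite) \<ge> 2"
  shows "open (MK :: 'n Kpt set)"
proof -
  have "open (expK ` (WK :: 'n Kpt set))" by (rule invariance_of_domain[OF continuous_on_expK open_WK inj_on_expK])
  then show ?thesis by (simp only: expK_image[OF assms])
qed

section \<open>Smoothness of the inverse map\<close>

definition logK :: "('n::finite) Kpt \<Rightarrow> 'n Kpt" where "logK = inv_into WK expK"

lemma logK_props:
  assumes n2: "CARD('n::finite) \<ge> 2" and g: "g \<in> (MK :: 'n Kpt set)"
  shows "logK g \<in> WK" "expK (logK g) = g" "fst (logK g) = fst g" "fst (snd (logK g)) = fst (snd g)"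
    "GK i (logK g) = 4 * snd (snd g) $ i"
proof -
  have gi: "g \<in> expK ` WK" using expK_image[OF n2] g by simp
  show "logK g \<in> WK" unfolding logK_def by (rule inv_into_into[OF gi])
  show e: "expK (logK g) = g" unfolding logK_def by (rule f_inv_into_f[OF gi])
  show "fst (logK g) = fst g" "fst (snd (logK g)) = fst (snd g)" 
    using arg_cong[OF e, of fst] arg_cong[OF e, of "\<lambda>w. fst (snd w)"] by (simp_all add: expK_def)
  have "snd (snd g) = (1/4) *\<^sub>R gradF (fst (logK g)) (fst (snd (logK g))) (snd (snd (logK g)))"
    using arg_cong[OF e, of "\<lambda>w. snd (snd w)"] by (simp add: expK_def)
  then show "GK i (logK g) = 4 * snd (snd g) $ i" by (simp add: GK_def)
qed

lemma logK_differentiable: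
  assumes n2: "CARD('n::finite) \<ge> 2" and g: "g \<in> (MK :: 'n Kpt set)"
  shows "logK differentiable (at g)"
proof -
  obtain w where w: "w \<in> WK" "g = expK w" using g expK_image[OF n2] by blast
  have w0: "w \<in> W0" using w WK_W0 by blast
  define E where "E = (\<lambda>v::'n Kpt. (fst v, fst (snd v), (1/4::real) *\<^sub>R ((\<chi> i. dGK i w v) :: real^'n)))"
  have dE: "(expK has_derivative E) (at w)" unfolding E_def by (rule has_derivative_expK[OF w0])
  have linE: "linear E" using dE has_derivative_linear by blast
  \<comment> \<open>\<open>E\<close> is block triangular: the identity on x, and on \<theta> a
    quarter of the Hessian, which has trivial kernel on \<open>WK\<close>.\<close>
  have "inj E"
    unfolding linear_injective_0[OF linE]
  proof (intro allI impI)
    fix v assume v: "E v = 0"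
    obtain a b k where vv: "v = (a, b, k)" by (cases v)
    have ab: "a = 0" "b = 0" using v by (auto simp: E_def vv zero_prod_def)
    have "(\<chi> i. dGK i w v) = 0" using v by (simp add: E_def zero_prod_def)
    then have "dGK i w (0, 0, k) = 0" for i using ab by (simp add: vec_eq_iff vv)
    then have h0: "hessF (fst w) (fst (snd w)) (snd (snd w)) k = 0"
      by (simp add: dGK_vertical[OF w0] vec_eq_iff)
    have "k = 0"
    proof (rule ccontr)
      assume "k \<noteq> 0"
      then have "hessF (fst w) (fst (snd w)) (snd (snd w)) k \<bullet> k > 0"
        using w(1) by (intro hessF_pos_def) (auto simp: WK_def)
      then show False using h0 by simp
    qed
    then show "v = 0" using ab by (simp add: vv zero_prod_def)
  qed
  then obtain E' where E': "linear E'" "\<And>x. E' (E x) = x" "\<And>x. E (E' x) = x"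
    using linear_injective_isomorphism[OF linE] by blast
  have "(logK has_derivative E') (at (expK w))"
  proof (rule has_derivative_inverse_strong[OF open_WK w(1) continuous_on_expK _ dE])
    show "logK (expK x) = x" if "x \<in> WK" for x
      unfolding logK_def by (rule inv_into_f_f[OF inj_on_expK that])
    show "E \<circ> E' = id" using E'(3) by (simp add: fun_eq_iff)
  qed
  then show ?thesis using w(2) differentiable_def by blast
qed

text \<open>Implicit differentiation of \<open>expK (logK g) = g\<close>. The last equation is
  linear in the unknown \<theta>-component of \<open>L v\<close>, with the Hessian as
  matrix.\<close>

lemma logK_derivative_system:
  fixes v :: "('n::finite) Kpt"
  assumes n2: "CARD('n) \<ge> 2" and g: "g \<in> (MK :: 'n Kpt set)"
  defines "L \<equiv> frechet_derivative logK (at g)"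
  shows "fst (L v) = fst v" "fst (snd (L v)) = fst (snd v)" "dGK i (logK g) (L v) = 4 * snd (snd v) $ i"
proof -
  have L: "(logK has_derivative L) (at g)"
    unfolding L_def using logK_differentiable[OF n2 g] frechet_derivative_works by blast
  note tr = has_derivative_transform_within_open[OF _ open_MK[OF n2] g]
  have a1: "((\<lambda>g. fst (logK g)) has_derivative (\<lambda>v. fst (L v))) (at g)"
    by (rule has_derivative_fst[OF L])
  have a2: "((\<lambda>g. fst (logK g)) has_derivative (\<lambda>v. fst v)) (at g)"
    by (rule tr[of fst]) (use logK_props(3)[OF n2] in \<open>auto intro!: has_derivative_fst has_derivative_ident\<close>)
  show "fst (L v) = fst v" using has_derivative_unique[OF a1 a2] by metis
  have b1: "((\<lambda>g. fst (snd (logK g))) has_derivative (\<lambda>v. fst (snd (L v)))) (at g)"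
    by (intro has_derivative_fst has_derivative_snd L)
  have b2: "((\<lambda>g. fst (snd (logK g))) has_derivative (\<lambda>v. fst (snd v))) (at g)"
    by (rule tr[of "\<lambda>g. fst (snd g)"]) (use logK_props(4)[OF n2] in \<open>auto intro!: has_derivative_fst has_derivative_snd has_derivative_ident\<close>)
  show "fst (snd (L v)) = fst (snd v)" using has_derivative_unique[OF b1 b2] by metis
  have "logK g \<in> W0" using logK_props(1)[OF n2 g] WK_W0 by blast
  then have c1: "((\<lambda>g. GK i (logK g)) has_derivative (\<lambda>v. dGK i (logK g) (L v))) (at g)"
    using has_derivative_compose[OF L has_derivative_GK] by blast
  have "bounded_linear (\<lambda>g::'n Kpt. 4 * snd (snd g) $ i)"
    by (intro bounded_linear_const_mult bounded_linear_compose[OF bounded_linear_vec_nth bounded_linear_compose[OF bounded_linear_snd bounded_linear_snd]])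
  then have "((\<lambda>g. 4 * snd (snd g) $ i) has_derivative (\<lambda>v. 4 * snd (snd v) $ i)) (at g)"
    by (rule bounded_linear_imp_has_derivative)
  then have c2: "((\<lambda>g. GK i (logK g)) has_derivative (\<lambda>v. 4 * snd (snd v) $ i)) (at g)"
    by (rule tr) (use logK_props(5)[OF n2] in auto)
  show "dGK i (logK g) (L v) = 4 * snd (snd v) $ i" using has_derivative_unique[OF c1 c2] by metis
qed

text \<open>Bootstrapping: if \<theta> is \<open>Ck k\<close> in g, so are the coefficients of the
  system in \<open>logK_derivative_system\<close>. Cramer's rule expresses the derivative of
  \<theta> as a quotient of determinants of such functions, which gains one order.\<close>

lemma Ck_logK:
  fixes i :: "'n::finite"
  assumes n2: "CARD('n) \<ge> 2"
  shows "Ck k (MK :: 'n Kpt set) (\<lambda>g. snd (snd (logK g)) $ i)"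
proof (induction k arbitrary: i)
  case (Suc k)
  have M: "open (MK :: 'n Kpt set)" by (rule open_MK[OF n2])
  define L where "L = (\<lambda>g. frechet_derivative logK (at (g :: 'n Kpt)))"
  have dL: "(logK has_derivative L g) (at g)" if "g \<in> MK" for g
    unfolding L_def using logK_differentiable[OF n2 that] frechet_derivative_works by blast
  have comp: "Ck k MK (\<lambda>g. logK g \<bullet> c)" for c :: "'n Kpt"
  proof (rule Ck_cong[OF M, where f="\<lambda>g. fst g * fst c + (fst (snd g) \<bullet> fst (snd c) + snd (snd (logK g)) \<bullet> snd (snd c))"])
    show "Ck k MK (\<lambda>g::'n Kpt. fst g * fst c + (fst (snd g) \<bullet> fst (snd c) + snd (snd (logK g)) \<bullet> snd (snd c)))"
      by (intro Ck_add Ck_mult Ck_inner_vec Ck_proj Ck_const Suc.IH)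
    fix g :: "'n Kpt" assume "g \<in> MK"
    then show "fst g * fst c + (fst (snd g) \<bullet> fst (snd c) + snd (snd (logK g)) \<bullet> snd (snd c)) = logK g \<bullet> c"
      using logK_props(3,4)[OF n2] by (simp add: inner_prod_def)
  qed
  have W: "logK g \<in> W0" if "g \<in> MK" for g :: "'n Kpt" using logK_props(1)[OF n2 that] WK_W0 by blast
  have dG: "Ck k MK (\<lambda>g. dGK j (logK g) v)" for j and v :: "'n Kpt"
    by (rule Ck_compose[OF M W comp Ck_dGK])
  have "Ck k MK (\<lambda>g. snd (snd (L g b)) $ i)" for b :: "'n Kpt"
  proof -
    define A where "A = (\<lambda>g. (\<chi> i j. dGK i (logK g) (0, 0, axis j 1)) :: real^'n^'n)"
    define R where "R = (\<lambda>g. (\<chi> i. 4 * snd (snd b) $ i - dGK i (logK g) (fst b, fst (snd b), 0)) :: real^'n)"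
    \<comment> \<open>Cramer's numerator: column i of the Hessian matrix replaced by the right-hand
      side.\<close>
    define C where "C = (\<lambda>g. (\<chi> p q. if q = i then R g $ p else A g $ p $ q) :: real^'n^'n)"
    have CA: "Ck k MK (\<lambda>g. A g $ p $ q)" for p q unfolding A_def by (simp add: dG)
    have CR: "Ck k MK (\<lambda>g. R g $ p)" for p unfolding R_def by (simp add: Ck_diff Ck_const dG)
    have CC: "Ck k MK (\<lambda>g. C g $ p $ q)" for p q unfolding C_def by (cases "q = i") (simp_all add: CA CR)
    have detA: "det (A g) \<noteq> 0" if g: "g \<in> MK" for g
    proof -
      define w where "w = logK g"
      have w: "w \<in> WK" "w \<in> W0" using logK_props(1)[OF n2 g] W[OF g] by (auto simp: w_def)
      have l: "linear (hessF (fst w) (fst (snd w)) (snd (snd w)))" using w by (intro linear_hessF) (auto simp: W0_def)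
      have "A g = matrix (hessF (fst w) (fst (snd w)) (snd (snd w)))"
        unfolding A_def matrix_def w_def[symmetric] by (simp add: dGK_vertical[OF w(2)] vec_eq_iff)
      moreover have "inj (hessF (fst w) (fst (snd w)) (snd (snd w)))"
        unfolding linear_injective_0[OF l]
      proof (intro allI impI)
        fix k assume h0: "hessF (fst w) (fst (snd w)) (snd (snd w)) k = 0"
        show "k = 0"
        proof (rule ccontr)
          assume "k \<noteq> 0"
          then have "hessF (fst w) (fst (snd w)) (snd (snd w)) k \<bullet> k > 0"
            using w(1) by (intro hessF_pos_def) (auto simp: WK_def)
          then show False using h0 by simp
        qed
      qed
      ultimately show ?thesis using det_nz_iff_inj[OF l] by simp
    qed
    have sol: "det (C g) / det (A g) = snd (snd (L g b)) $ i" if g: "g \<in> MK" for g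
    proof -
      define \<kappa> where "\<kappa> = snd (snd (L g b))"
      have Lb: "L g b = (fst b, fst (snd b), \<kappa>)"
        using logK_derivative_system(1,2)[OF n2 g, of b] by (simp add: L_def \<kappa>_def prod_eq_iff)
      have "(A g *v \<kappa>) $ p = R g $ p" for p
      proof -
        have l: "linear (dGK p (logK g))" using has_derivative_GK[OF W[OF g]] has_derivative_linear by blast
        have lk: "linear (\<lambda>k. dGK p (logK g) (0, 0, k))"
          using hessF_def dGK_vertical[OF W[OF g], of p]
          by (intro linear_compose[OF _ l, unfolded o_def]) (auto intro!: linearI)
        have "\<kappa> = (\<Sum>q\<in>UNIV. \<kappa> $ q *\<^sub>R axis q 1)" by (simp add: vec_eq_iff axis_def if_distrib cong: if_cong)
        then have "dGK p (logK g) (0, 0, \<kappa>) = (\<Sum>q\<in>UNIV. \<kappa> $ q * dGK p (logK g) (0, 0, axis q 1))"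
          using linear_sum[OF lk] linear_scale[OF lk] by (metis (mono_tags, lifting) real_scaleR_def sum.cong)
        moreover have Ls: "L g b = (fst b, fst (snd b), 0) + (0, 0, \<kappa>)" by (simp add: Lb)
        have "dGK p (logK g) (L g b) = dGK p (logK g) (fst b, fst (snd b), 0) + dGK p (logK g) (0, 0, \<kappa>)"
          unfolding Ls by (rule linear_add[OF l])
        moreover have "dGK p (logK g) (L g b) = 4 * snd (snd b) $ p"
          using logK_derivative_system(3)[OF n2 g] by (simp add: L_def)
        ultimately show ?thesis
          by (simp add: A_def R_def matrix_vector_mult_def mult.commute)
      qed
      then have "A g *v \<kappa> = R g" by (simp add: vec_eq_iff)
      then have "\<kappa> = (\<chi> k. det (\<chi> p q. if q = k then R g $ p else A g $ p $ q) / det (A g))"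
        using cramer[OF detA[OF g]] by blast
      then show ?thesis unfolding C_def \<kappa>_def by (metis (no_types, lifting) vec_lambda_beta)
    qed
    show ?thesis
      by (rule Ck_cong[OF M, where f="\<lambda>g. det (C g) / det (A g)"])
         (auto intro!: Ck_divide Ck_det CC CA simp: detA sol)
  qed
  moreover have "((\<lambda>g. snd (snd (logK g)) $ i) has_derivative (\<lambda>v. snd (snd (L g v)) $ i)) (at g)" if "g \<in> MK" for g
    by (intro bounded_linear.has_derivative[OF bounded_linear_vec_nth] has_derivative_snd dL that)
  ultimately show ?case by (auto intro!: exI[of _ "\<lambda>g v. snd (snd (L g v)) $ i"])
qed simp

theorem smooth_on_MK:
  assumes n2: "CARD('n::finite) \<ge> 2"
  shows "smooth_on (MK :: 'n Kpt set) (\<lambda>g. (ccdist g)\<^sup>2)"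
proof (rule smooth_onI[OF open_MK[OF n2]])
  fix k
  let ?th = "\<lambda>g::'n Kpt. snd (snd (logK g))"
  have q: "Ck k MK (\<lambda>g. ?th g \<bullet> ?th g)" and z: "Ck k MK (\<lambda>g. ?th g \<bullet> fst (snd g))"
    and tt: "Ck k MK (\<lambda>g. snd (snd g) \<bullet> ?th g)" and xx: "Ck k MK (\<lambda>g::'n Kpt. fst (snd g) \<bullet> fst (snd g))"
    by (intro Ck_inner_vec Ck_proj Ck_logK[OF n2])+
  have W: "?th g \<in> OmegaK" if "g \<in> MK" for g using logK_props(1)[OF n2 that] by (simp add: WK_def)
  have P: "Ck k MK (\<lambda>g. PK (?th g \<bullet> ?th g))"
    by (rule Ck_compose_real[OF open_MK[OF n2] _ q Ck_PK]) (simp add: OmegaK_IK W)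
  show "Ck k MK (\<lambda>g::'n Kpt. (ccdist g)\<^sup>2)"
  proof (rule Ck_cong[OF open_MK[OF n2], where f="\<lambda>g. (fst g)\<^sup>2 + fst (snd g) \<bullet> fst (snd g) + 4 * (snd (snd g) \<bullet> ?th g)
       - PK (?th g \<bullet> ?th g) * ((fst g)\<^sup>2 * (?th g \<bullet> ?th g) + (?th g \<bullet> fst (snd g))\<^sup>2)"])
    show "Ck k MK (\<lambda>g. (fst g)\<^sup>2 + fst (snd g) \<bullet> fst (snd g) + 4 * (snd (snd g) \<bullet> ?th g)
       - PK (?th g \<bullet> ?th g) * ((fst g)\<^sup>2 * (?th g \<bullet> ?th g) + (?th g \<bullet> fst (snd g))\<^sup>2))"
      by (intro Ck_diff Ck_add Ck_mult Ck_power Ck_const Ck_proj P q z tt xx)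
    fix g :: "'n Kpt" assume g: "g \<in> MK"
    obtain x1 xs t where gg: "g = (x1, xs, t)" by (cases g)
    have "gradF x1 xs (?th g) $ i = 4 * t $ i" for i
      using logK_props(5)[OF n2 g, of i] logK_props(3,4)[OF n2 g] by (simp add: GK_def gg)
    then have "4 *\<^sub>R t = gradF x1 xs (?th g)" by (simp add: vec_eq_iff)
    from critical_point_ccdist(2)[OF W[OF g] this]
    show "(fst g)\<^sup>2 + fst (snd g) \<bullet> fst (snd g) + 4 * (snd (snd g) \<bullet> ?th g)
       - PK (?th g \<bullet> ?th g) * ((fst g)\<^sup>2 * (?th g \<bullet> ?th g) + (?th g \<bullet> fst (snd g))\<^sup>2) = (ccdist g)\<^sup>2"
      by (simp add: gg phiK_FK FK_eq[OF W[OF g, unfolded gg]] power2_norm_eq_inner)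
  qed
qed

section \<open>Non-smoothness on the exceptional set\<close>

text \<open>With \<rho> the distance of |\<tau>| from pi, \<open>phiK\<close> is at most D -
  \<kappa> \<rho> - pi s^2 / \<rho> + 3 s^2, where strictness gives \<kappa> > 0. The
  arithmetic-geometric mean inequality removes \<rho> and leaves -2 |s| sqrt(\<kappa> pi): this is
  the constant C. The supremum formula carries the bound over to the distance.\<close>

lemma ccdist_kink:
  fixes xs :: "real^'n::finite"
  assumes xs: "xs \<noteq> 0" and strict: "pi * (t \<bullet> sgn xs)\<^sup>2 < (norm xs)\<^sup>2 * norm (tperp xs t)"
  obtains C where "C > 0" "\<And>s. (ccdist (s, xs, t))\<^sup>2 \<le> (ccdist (0, xs, t))\<^sup>2 - C * \<bar>s\<bar> + 3 * s\<^sup>2"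
proof -
  define N where "N = norm xs"
  define c where "c = t \<bullet> sgn xs"
  define P where "P = norm (tperp xs t)"
  have N: "N > 0" using xs by (simp add: N_def)
  define \<kappa> where "\<kappa> = 4 * (P - pi * c\<^sup>2 / N\<^sup>2)"
  have \<kappa>: "\<kappa> > 0" using strict N by (simp add: \<kappa>_def N_def c_def P_def field_simps)
  have Z: "(0, xs, t) \<in> ZK" using ZK_iff[OF xs] strict by simp
  define D where "D = N\<^sup>2 + 4 * pi * P"
  have D: "(ccdist (0, xs, t))\<^sup>2 = D" using ZK_ccdist(1)[OF Z] by (simp add: D_def N_def P_def)
  define C where "C = 2 * sqrt (\<kappa> * pi)"
  show ?thesis
  proof
    show "C > 0" using \<kappa> by (simp add: C_def)
    fix s :: real
    have "phiK (s, xs, t) \<tau> \<le> D - C * \<bar>s\<bar> + 3 * s\<^sup>2" if \<tau>: "\<tau> \<in> OmegaK" for \<tau>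
    proof -
      define r where "r = norm \<tau>"
      define \<rho> where "\<rho> = pi - r"
      have r: "0 \<le> r" "r < pi" using \<tau> by (auto simp: r_def OmegaK_def)
      have \<rho>: "\<rho> > 0" using r by (simp add: \<rho>_def)
      have 0: "phiK (s, xs, t) \<tau> = phiK (0, xs, t) \<tau> + s\<^sup>2 * (1 - fK r)"
        by (simp add: phiK_def r_def algebra_simps)
      have 1: "phiK (0, xs, t) \<tau> \<le> N\<^sup>2 + 4 * P * norm (tperp xs \<tau>) + 4 * pi * c\<^sup>2 * \<rho> / N\<^sup>2"
        using phiK_upper[OF xs \<tau>, of t] by (simp add: N_def P_def c_def \<rho>_def r_def)
      have 2: "4 * P * norm (tperp xs \<tau>) \<le> 4 * P * r"
        using norm_tperp_le[of xs \<tau>] by (intro mult_left_mono) (auto simp: P_def r_def)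
      have 3: "N\<^sup>2 + 4 * P * r + 4 * pi * c\<^sup>2 * \<rho> / N\<^sup>2 = D - \<rho> * \<kappa>"
        by (simp add: D_def \<rho>_def \<kappa>_def algebra_simps)
      have 4: "s\<^sup>2 * (1 - fK r) \<le> s\<^sup>2 * (3 - pi / \<rho>)"
        using fK_lower[OF r] by (intro mult_left_mono) (auto simp: \<rho>_def)
      have "2 * sqrt (\<rho> * \<kappa>) * (\<bar>s\<bar> * sqrt (pi / \<rho>)) \<le> (sqrt (\<rho> * \<kappa>))\<^sup>2 + (\<bar>s\<bar> * sqrt (pi / \<rho>))\<^sup>2"
        by (rule sum_squares_bound)
      also have "\<dots> = \<rho> * \<kappa> + s\<^sup>2 * (pi / \<rho>)"
        using \<rho> \<kappa> by (simp add: power_mult_distrib)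
      also have "2 * sqrt (\<rho> * \<kappa>) * (\<bar>s\<bar> * sqrt (pi / \<rho>)) = 2 * \<bar>s\<bar> * (sqrt (\<rho> * \<kappa>) * sqrt (pi / \<rho>))"
        by simp
      also have "sqrt (\<rho> * \<kappa>) * sqrt (pi / \<rho>) = sqrt (\<kappa> * pi)"
        unfolding real_sqrt_mult[symmetric] using \<rho> by simp
      finally have 5: "C * \<bar>s\<bar> \<le> \<rho> * \<kappa> + s\<^sup>2 * (pi / \<rho>)" by (simp add: C_def mult_ac)
      have "N\<^sup>2 + 4 * P * norm (tperp xs \<tau>) + 4 * pi * c\<^sup>2 * \<rho> / N\<^sup>2 \<le> N\<^sup>2 + 4 * P * r + 4 * pi * c\<^sup>2 * \<rho> / N\<^sup>2"
        using 2 by simp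
      then have 6: "phiK (0, xs, t) \<tau> \<le> D - \<rho> * \<kappa>" using order.trans[OF 1] unfolding 3 by blast
      have "s\<^sup>2 * (3 - pi / \<rho>) = 3 * s\<^sup>2 - s\<^sup>2 * (pi / \<rho>)" by (simp add: right_diff_distrib mult.commute)
      then have "s\<^sup>2 * (1 - fK r) \<le> 3 * s\<^sup>2 - s\<^sup>2 * (pi / \<rho>)" using 4 by (simp only:)
      then show ?thesis unfolding 0 using add_mono[OF 6] 5 by fastforce
    qed
    then show "(ccdist (s, xs, t))\<^sup>2 \<le> (ccdist (0, xs, t))\<^sup>2 - C * \<bar>s\<bar> + 3 * s\<^sup>2"
      unfolding ccdist_eq_SUP[of "(s, xs, t)"] D
      by (intro cSUP_least) (use pi_gt_zero in \<open>auto simp: OmegaK_def simp del: pi_gt_zero\<close>)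
  qed
qed

text \<open>Difference quotients have limit at most -C from the right and at least C from the
  left.\<close>

lemma kink_not_differentiable:
  fixes f :: "real \<Rightarrow> real"
  assumes C: "C > 0" and le: "\<And>s. f s \<le> f 0 - C * \<bar>s\<bar> + B * s\<^sup>2"
  shows "\<not> f differentiable (at 0)"
proof
  assume "f differentiable (at 0)"
  then obtain l where l: "(f has_real_derivative l) (at 0)" using real_differentiable_def by blast
  then have lim: "((\<lambda>h. (f h - f 0) / h) \<longlongrightarrow> l) (at 0)" by (simp add: DERIV_def)
  have lin: "((\<lambda>h. - C + B * h) \<longlongrightarrow> - C + B * 0) (at_right 0)" "((\<lambda>h. C + B * h) \<longlongrightarrow> C + B * 0) (at_left 0)"
    by (intro tendsto_intros)+
  have "l \<le> - C + B * 0"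
  proof (rule tendsto_le[OF _ lin(1)])
    show "((\<lambda>h. (f h - f 0) / h) \<longlongrightarrow> l) (at_right 0)" using lim by (simp add: filterlim_at_split)
    have "(f h - f 0) / h \<le> - C + B * h" if "h > 0" for h
      using le[of h] that by (simp add: field_simps power2_eq_square)
    then show "\<forall>\<^sub>F h in at_right 0. (f h - f 0) / h \<le> - C + B * h"
      by (simp add: eventually_at_right_field) (meson gt_ex)
  qed simp
  moreover have "C + B * 0 \<le> l"
  proof (rule tendsto_le[OF _ _ lin(2)])
    show "((\<lambda>h. (f h - f 0) / h) \<longlongrightarrow> l) (at_left 0)" using lim by (simp add: filterlim_at_split)
    have "C + B * h \<le> (f h - f 0) / h" if "h < 0" for h
      using le[of h] that by (simp add: field_simps power2_eq_square)
    then show "\<forall>\<^sub>F h in at_left 0. C + B * h \<le> (f h - f 0) / h"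
      by (simp add: eventually_at_left_field) (meson lt_ex)
  qed simp
  ultimately show False using C by simp
qed

lemma ccdist_sq_not_differentiable:
  fixes xs :: "real^'n::finite"
  assumes xs: "xs \<noteq> 0" and strict: "pi * (t \<bullet> sgn xs)\<^sup>2 < (norm xs)\<^sup>2 * norm (tperp xs t)"
  shows "\<not> (\<lambda>h. (ccdist h)\<^sup>2) differentiable (at (0, xs, t))"
proof
  assume d: "(\<lambda>h. (ccdist h)\<^sup>2) differentiable (at (0, xs, t))"
  obtain C where C: "C > 0" "\<And>s. (ccdist (s, xs, t))\<^sup>2 \<le> (ccdist (0, xs, t))\<^sup>2 - C * \<bar>s\<bar> + 3 * s\<^sup>2"
    using ccdist_kink[OF assms] by blast
  have "((\<lambda>s::real. (s, xs, t)) has_derivative (\<lambda>s. (s, 0, 0))) (at 0)"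
    by (intro has_derivative_Pair has_derivative_ident has_derivative_const)
  then have "(\<lambda>s::real. (s, xs, t)) differentiable (at 0)" by (auto simp: differentiable_def)
  then have "((\<lambda>h. (ccdist h)\<^sup>2) \<circ> (\<lambda>s. (s, xs, t))) differentiable (at 0)"
    by (rule differentiable_chain_at) (use d in simp)
  then show False using kink_not_differentiable[OF C(1), of "\<lambda>s. (ccdist (s, xs, t))\<^sup>2" 3] C(2) by (simp add: o_def)
qed

text \<open>
Every point of \<open>ZK\<close> is a limit of points where the defining inequality is strict and \<open>x\<^sub>* \<noteq> 0\<close>, so that \<open>ccdist_sq_not_differentiable\<close>
applies arbitrarily close to it.
\<close>

lemma ZK_strict_direction:
  fixes xs t :: "real^'n::finite"
  assumes n2: "CARD('n) \<ge> 2" and Z: "(0, xs, t) \<in> ZK"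
  obtains v e where "\<And>\<epsilon>. \<epsilon> > 0 \<Longrightarrow> xs + \<epsilon> *\<^sub>R v \<noteq> 0 \<and>
    pi * ((t + \<epsilon> *\<^sub>R e) \<bullet> sgn (xs + \<epsilon> *\<^sub>R v))\<^sup>2 < (norm (xs + \<epsilon> *\<^sub>R v))\<^sup>2 * norm (tperp (xs + \<epsilon> *\<^sub>R v) (t + \<epsilon> *\<^sub>R e))"
proof (cases "xs = 0")
  case True
  obtain e0 :: "real^'n" where e0: "norm e0 = 1" using exists_orthogonal[OF n2] by blast
  define e where "e = (if t = 0 then e0 else sgn t)"
  have e: "norm e = 1" "t = norm t *\<^sub>R e" using e0 by (auto simp: e_def norm_sgn sgn_div_norm)
  \<comment> \<open>At \<open>xs = 0\<close> the base moves orthogonally to t while t is lengthened: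
    then t has no component along the new base, and the left side of the strict inequality is
    0.\<close>
  obtain v :: "real^'n" where v: "norm v = 1" "v \<bullet> e = 0" using exists_orthogonal[OF n2] by blast
  show ?thesis
  proof (rule that[of v e])
    fix \<epsilon> :: real assume \<epsilon>: "\<epsilon> > 0"
    have te: "t + \<epsilon> *\<^sub>R e = (norm t + \<epsilon>) *\<^sub>R e" using e(2) by (metis scaleR_add_left)
    have sv: "sgn (\<epsilon> *\<^sub>R v) = v" using \<epsilon> v by (simp add: sgn_div_norm)
    have ev: "e \<bullet> v = 0" using v(2) by (simp add: inner_commute)
    have "norm t + \<epsilon> > 0" using \<epsilon> by (simp add: add_nonneg_pos)
    then show "xs + \<epsilon> *\<^sub>R v \<noteq> 0 \<and>
      pi * ((t + \<epsilon> *\<^sub>R e) \<bullet> sgn (xs + \<epsilon> *\<^sub>R v))\<^sup>2 < (norm (xs + \<epsilon> *\<^sub>R v))\<^sup>2 * norm (tperp (xs + \<epsilon> *\<^sub>R v) (t + \<epsilon> *\<^sub>R e))"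
      unfolding te True tperp_def using \<epsilon> v e(1) ev by (auto simp: sv)
  qed
next
  case False
  define p where "p = tperp xs t"
  obtain e0 :: "real^'n" where e0: "norm e0 = 1" "e0 \<bullet> xs = 0" using exists_orthogonal[OF n2] by blast
  \<comment> \<open>Here \<open>xs\<close> stays fixed and only the orthogonal part of t grows,
    which raises the right side and leaves the left one unchanged.\<close>
  define e where "e = (if p = 0 then e0 else sgn p)"
  have e: "norm e = 1" "p = norm p *\<^sub>R e" "e \<bullet> xs = 0"
    using e0 tperp_props(2)[of xs t] by (auto simp: e_def norm_sgn sgn_div_norm p_def)
  show ?thesis
  proof (rule that[of 0 e])
    fix \<epsilon> :: real assume \<epsilon>: "\<epsilon> > 0"
    have es: "e \<bullet> sgn xs = 0" using e(3) by (simp add: sgn_div_norm)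
    have "tperp xs (t + \<epsilon> *\<^sub>R e) = p + \<epsilon> *\<^sub>R e" using es by (simp add: tperp_def p_def inner_simps)
    also have "\<dots> = (norm p + \<epsilon>) *\<^sub>R e" using e(2) by (metis scaleR_add_left)
    finally have a: "norm (tperp xs (t + \<epsilon> *\<^sub>R e)) = norm p + \<epsilon>" using e(1) \<epsilon> by (simp add: abs_of_nonneg)
    have "pi * (t \<bullet> sgn xs)\<^sup>2 \<le> (norm xs)\<^sup>2 * norm p" using Z ZK_iff[OF False] p_def by blast
    also have "(norm xs)\<^sup>2 * norm p < (norm xs)\<^sup>2 * (norm p + \<epsilon>)" using False \<epsilon> by simp
    finally have "pi * (t \<bullet> sgn xs)\<^sup>2 < (norm xs)\<^sup>2 * norm (tperp xs (t + \<epsilon> *\<^sub>R e))" unfolding a .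
    then show "xs + \<epsilon> *\<^sub>R 0 \<noteq> 0 \<and>
      pi * ((t + \<epsilon> *\<^sub>R e) \<bullet> sgn (xs + \<epsilon> *\<^sub>R 0))\<^sup>2 < (norm (xs + \<epsilon> *\<^sub>R 0))\<^sup>2 * norm (tperp (xs + \<epsilon> *\<^sub>R 0) (t + \<epsilon> *\<^sub>R e))"
      unfolding scaleR_zero_right add_0_right inner_add_left inner_scaleR_left es mult_zero_right
      using False by blast
  qed
qed

theorem ZK_subset_CutK:
  assumes n2: "CARD('n::finite) \<ge> 2"
  shows "(ZK :: 'n Kpt set) \<subseteq> CutK"
proof
  fix g :: "'n Kpt" assume "g \<in> ZK"
  then obtain xs t where g: "g = (0, xs, t)" and Z: "(0, xs, t) \<in> ZK" by (auto simp: ZK_def)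
  obtain v e :: "real^'n" where ve: "\<And>\<epsilon>. \<epsilon> > 0 \<Longrightarrow> xs + \<epsilon> *\<^sub>R v \<noteq> 0 \<and>
    pi * ((t + \<epsilon> *\<^sub>R e) \<bullet> sgn (xs + \<epsilon> *\<^sub>R v))\<^sup>2 < (norm (xs + \<epsilon> *\<^sub>R v))\<^sup>2 * norm (tperp (xs + \<epsilon> *\<^sub>R v) (t + \<epsilon> *\<^sub>R e))"
    using ZK_strict_direction[OF n2 Z] by blast
  have "\<not> (open S \<and> g \<in> S \<and> smooth_on S (\<lambda>h. (ccdist h)\<^sup>2))" for S :: "'n Kpt set"
  proof
    assume S: "open S \<and> g \<in> S \<and> smooth_on S (\<lambda>h. (ccdist h)\<^sup>2)"
    \<comment> \<open>The empty list of directions already gives differentiability of the squared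
      distance, which the kink contradicts.\<close>
    then have diff: "(\<lambda>h. (ccdist h)\<^sup>2) differentiable_on S"
      unfolding smooth_on_def by (metis empty_subsetI list.set(1) pdiff.simps(1))
    have "((\<lambda>\<epsilon>::real. (0::real, xs + \<epsilon> *\<^sub>R v, t + \<epsilon> *\<^sub>R e)) \<longlongrightarrow> (0, xs + 0 *\<^sub>R v, t + 0 *\<^sub>R e)) (at_right 0)"
      by (intro tendsto_intros)
    then have "\<forall>\<^sub>F \<epsilon> in at_right 0. (0::real, xs + \<epsilon> *\<^sub>R v, t + \<epsilon> *\<^sub>R e) \<in> S"
      using S g topological_tendstoD by fastforce
    then obtain \<epsilon> where \<epsilon>: "\<epsilon> > 0" "(0::real, xs + \<epsilon> *\<^sub>R v, t + \<epsilon> *\<^sub>R e) \<in> S"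
      unfolding eventually_at_right_field using dense by blast
    then have "(\<lambda>h. (ccdist h)\<^sup>2) differentiable (at (0, xs + \<epsilon> *\<^sub>R v, t + \<epsilon> *\<^sub>R e))"
      using diff S by (simp add: differentiable_on_eq_differentiable_at)
    then show False using ccdist_sq_not_differentiable ve[OF \<epsilon>(1)] by blast
  qed
  then show "g \<in> CutK" unfolding CutK_def by blast
qed

section \<open>The operator \<open>U / sin U\<close>\<close>

text \<open>The singularity at 0 is removable and the other zeros of sine have modulus at least pi,
  so the Taylor series at 0 converges on all of \<open>OmegaK\<close>.\<close>

lemma zsinz_holomorphic: "zsinz holomorphic_on ball 0 pi"
proof -
  have sn: "sin z \<noteq> 0" if "z \<in> ball 0 pi - {0}" for z :: complex
  proof
    assume "sin z = 0"
    then obtain n :: int where n: "z = of_real (of_int n * pi)" by (auto simp: sin_eq_0)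
    have "cmod z = \<bar>real_of_int n\<bar> * pi" unfolding n by (simp add: norm_mult)
    moreover have "cmod z < pi" using that by simp
    ultimately have "\<bar>real_of_int n\<bar> * pi < 1 * pi" by simp
    then have "\<bar>real_of_int n\<bar> < 1" by (simp only: mult_less_cancel_right_pos[OF pi_gt_zero])
    then have "n = 0" by linarith
    then show False using that n by simp
  qed
  have "(\<lambda>z. z / sin z) holomorphic_on (ball 0 pi - {0})"
    using sn by (intro holomorphic_intros) auto
  then have h: "zsinz holomorphic_on (ball 0 pi - {0})"
    by (rule holomorphic_transform) (auto simp: zsinz_def)
  have "((\<lambda>z::complex. sin z / z) \<longlongrightarrow> 1) (at 0)"
    using DERIV_sin[of "0::complex"] by (simp add: DERIV_def)
  then have "((\<lambda>z::complex. inverse (sin z / z)) \<longlongrightarrow> inverse 1) (at 0)"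
    by (intro tendsto_inverse) auto
  then have "(zsinz \<longlongrightarrow> inverse 1) (at 0)"
    by (rule Lim_transform_eventually) (auto simp: zsinz_def eventually_at_filter)
  then have "(zsinz \<longlongrightarrow> zsinz 0) (at 0)" by (simp add: zsinz_def)
  then show ?thesis
    using no_isolated_singularity'[of "{0}" zsinz "ball 0 pi"] h
    by (auto simp: Lim_at_imp_Lim_at_within)
qed

definition zc :: "nat \<Rightarrow> complex" where "zc k = (deriv ^^ k) zsinz 0 / of_nat (fact k)"

lemma zsinz_sums:
  assumes "0 \<le> r" "r < pi"
  shows "(\<lambda>k. zc k * of_real r ^ k) sums of_real (ssin r)"
proof -
  have "of_real r \<in> ball (0::complex) pi" using assms by simp
  from holomorphic_power_series[OF zsinz_holomorphic this]
  have "(\<lambda>k. zc k * of_real r ^ k) sums zsinz (of_real r)" by (simp add: zc_def)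
  moreover have "zsinz (of_real r) = of_real (ssin r)"
    by (simp add: zsinz_def ssin_def sin_of_real)
  ultimately show ?thesis by simp
qed

lemma zc_odd:
  assumes "odd k"
  shows "zc k = 0"
proof -
  have "zsinz = (\<lambda>w. zsinz (-1 * w))" by (simp add: zsinz_def fun_eq_iff)
  then have "(deriv ^^ k) zsinz 0 = (deriv ^^ k) (\<lambda>w. zsinz (-1 * w)) 0" by simp
  also have "\<dots> = (-1) ^ k * (deriv ^^ k) zsinz (-1 * 0)"
    by (rule higher_deriv_compose_linear[OF zsinz_holomorphic, of "ball 0 pi"]) auto
  finally have "(deriv ^^ k) zsinz 0 = 0" using assms by simp
  then show ?thesis by (simp add: zc_def)
qed

lemma zc_0: "zc 0 = 1" by (simp add: zc_def zsinz_def)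

text \<open>For even exponents the power of i coming from U = iA is a real sign, so it can be taken
  out of \<open>Re\<close>; it will cancel the sign of the even powers of A.\<close>

lemma zsinz_coeff_even: "zsinz_coeff (2 * m) = (-1) ^ m * Re (zc (2 * m))"
  unfolding zsinz_coeff_def zc_def[symmetric] by (simp add: power_mult)

lemma zsinz_coeff_odd: "odd k \<Longrightarrow> zsinz_coeff k = 0"
  unfolding zsinz_coeff_def zc_def[symmetric] using zc_odd by simp

lemma Aop_scaleR_pair:
  assumes "norm e = 1"
  shows "Aop (r *\<^sub>R e) (a, b *\<^sub>R e + w) = (r * b + r * (e \<bullet> w), (- (r * a)) *\<^sub>R e)"
  using assms by (simp add: Aop_def inner_simps dot_square_norm mult.commute distrib_left)

text \<open>The square of A is -r^2 on the plane spanned by (1,0) and (0,e), and A kills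
  \<open>w\<close>. The exponent starts at 2 because the zeroth power still contains
  \<open>w\<close>.\<close>

lemma Aop_even_power:
  fixes e w :: "real^'n"
  assumes e: "norm e = 1" and w: "e \<bullet> w = 0"
  shows "(Aop (r *\<^sub>R e) ^^ (2 * Suc m)) (a, b *\<^sub>R e + w) = ((-1) ^ Suc m * r ^ (2 * Suc m)) *\<^sub>R (a, b *\<^sub>R e)"
proof (induction m)
  have two: "Aop (r *\<^sub>R e) (Aop (r *\<^sub>R e) (a, b *\<^sub>R e + w)) = (- (r\<^sup>2)) *\<^sub>R (a, b *\<^sub>R e)"
    if "e \<bullet> w = 0" for a b and w :: "real^'n"
    unfolding Aop_scaleR_pair[OF e] using Aop_scaleR_pair[OF e, of r "r * b" "- (r * a)" 0] that
    by (simp add: power2_eq_square)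
  case 0
  show ?case using two[OF w, of a b] by (simp add: numeral_2_eq_2)
  case (Suc m)
  have "(Aop (r *\<^sub>R e) ^^ (2 * Suc (Suc m))) (a, b *\<^sub>R e + w)
     = Aop (r *\<^sub>R e) (Aop (r *\<^sub>R e) ((Aop (r *\<^sub>R e) ^^ (2 * Suc m)) (a, b *\<^sub>R e + w)))"
    by simp
  also have "\<dots> = Aop (r *\<^sub>R e) (Aop (r *\<^sub>R e) ((-1) ^ Suc m * r ^ (2 * Suc m) * a, ((-1) ^ Suc m * r ^ (2 * Suc m) * b) *\<^sub>R e + 0))"
    unfolding Suc by simp
  also have "\<dots> = (- (r\<^sup>2)) *\<^sub>R ((-1) ^ Suc m * r ^ (2 * Suc m) * a, ((-1) ^ Suc m * r ^ (2 * Suc m) * b) *\<^sub>R e)"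
    by (rule two) simp
  also have "\<dots> = ((-1) ^ Suc (Suc m) * r ^ (2 * Suc (Suc m))) *\<^sub>R (a, b *\<^sub>R e)"
    by (simp add: power2_eq_square algebra_simps)
  finally show ?case .
qed

text \<open>On the rotating plane the two signs cancel and the series sums to \<open>ssin r\<close>;
  on \<open>w\<close> only the constant term 1 survives.\<close>

lemma U_over_sinU_eq:
  fixes e w :: "real^'n"
  assumes r: "0 < r" "r < pi" and e: "norm e = 1" and w: "e \<bullet> w = 0"
  shows "U_over_sinU (r *\<^sub>R e) (a, b *\<^sub>R e + w) = ssin r *\<^sub>R (a, b *\<^sub>R e) + (0, w)"
proof -
  define c where "c = (\<lambda>k. Re (zc k * of_real r ^ k))"
  have c: "c sums ssin r"
    using sums_Re[OF zsinz_sums[of r]] r by (simp add: c_def)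
  define F where "F = (\<lambda>k. zsinz_coeff k *\<^sub>R ((Aop (r *\<^sub>R e) ^^ k) (a, b *\<^sub>R e + w)))"
  have F: "F k = c k *\<^sub>R (a, b *\<^sub>R e) + (if k = 0 then (0, w) else 0)" for k
  proof (cases "odd k")
    case True
    then show ?thesis using zsinz_coeff_odd[OF True] zc_odd[OF True] by (auto simp: F_def c_def zero_prod_def)
  next
    case False
    then obtain m where k: "k = 2 * m" by (auto elim: evenE)
    show ?thesis
    proof (cases m)
      case 0
      then show ?thesis using k zsinz_coeff_even[of 0] by (simp add: F_def c_def zc_0)
    next
      case (Suc n)
      have "Re (zc k * of_real r ^ k) = Re (zc k) * r ^ k" by (simp flip: of_real_power)
      then have "c k = Re (zc k) * r ^ k" by (simp add: c_def)
      moreover have "F k = (((-1) ^ m * Re (zc k)) * ((-1) ^ m * r ^ k)) *\<^sub>R (a, b *\<^sub>R e)"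
        unfolding F_def k zsinz_coeff_even Suc Aop_even_power[OF e w] by simp
      moreover have "((-1) ^ m * Re (zc k)) * ((-1) ^ m * r ^ k) = Re (zc k) * r ^ k * ((-1) ^ m * (-1) ^ m)" by simp
      moreover have "((-1::real) ^ m * (-1) ^ m) = 1" by (simp flip: power_mult_distrib)
      ultimately show ?thesis using k Suc by simp
    qed
  qed
  have "(\<lambda>k. c k *\<^sub>R (a, b *\<^sub>R e) + (if k = 0 then (0, w) else 0)) sums (ssin r *\<^sub>R (a, b *\<^sub>R e) + (0, w))"
    by (intro sums_add sums_scaleR_left c sums_single[of 0 "\<lambda>_. (0, w)", unfolded if_distrib])
  then have "F sums (ssin r *\<^sub>R (a, b *\<^sub>R e) + (0, w))" using F by presburger
  then show ?thesis unfolding U_over_sinU_def F_def by (simp add: sums_iff)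
qed

lemma U_over_sinU_zero: "U_over_sinU 0 x = x"
proof -
  have A: "(Aop 0 ^^ Suc k) x = 0" for k by (induction k) (simp_all add: Aop_def zero_prod_def)
  have "(\<lambda>k. zsinz_coeff k *\<^sub>R ((Aop 0 ^^ k) x)) = (\<lambda>k. if k = 0 then x else 0)"
  proof
    fix k show "zsinz_coeff k *\<^sub>R ((Aop 0 ^^ k) x) = (if k = 0 then x else 0)"
      using A zsinz_coeff_even[of 0] by (cases k) (simp_all add: zc_0)
  qed
  moreover have "(\<lambda>k::nat. if k = 0 then x else 0) sums x" using sums_single[of 0 "\<lambda>_. x"] by simp
  ultimately show ?thesis unfolding U_over_sinU_def by (simp add: sums_iff)
qed

theorem norm_U_over_sinU:
  fixes \<theta> :: "real^'n"
  assumes \<theta>: "\<theta> \<in> OmegaK"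
  shows "(norm (U_over_sinU \<theta> (x1, xs)))\<^sup>2 = (ssin (norm \<theta>))\<^sup>2 * x1\<^sup>2 + (norm xs)\<^sup>2
     + ((ssin (norm \<theta>))\<^sup>2 - 1) * (xs \<bullet> sgn \<theta>)\<^sup>2"
proof (cases "\<theta> = 0")
  case True
  then show ?thesis by (simp add: U_over_sinU_zero ssin_def norm_Pair)
next
  case False
  define r where "r = norm \<theta>"
  define e where "e = sgn \<theta>"
  define b where "b = xs \<bullet> e"
  define w where "w = xs - b *\<^sub>R e"
  have r: "0 < r" "r < pi" using \<theta> False by (auto simp: r_def OmegaK_def)
  have e: "norm e = 1" "e \<bullet> e = 1" using False by (auto simp: e_def norm_sgn dot_square_norm)
  have re: "\<theta> = r *\<^sub>R e" using False by (simp add: r_def e_def sgn_div_norm)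
  have w: "e \<bullet> w = 0" using e by (simp add: w_def inner_simps b_def inner_commute)
  have xs: "xs = b *\<^sub>R e + w" by (simp add: w_def)
  have U: "U_over_sinU \<theta> (x1, xs) = (ssin r * x1, (ssin r * b) *\<^sub>R e + w)"
    unfolding re xs U_over_sinU_eq[OF r e(1) w] by simp
  have 1: "(norm ((ssin r * b) *\<^sub>R e + w))\<^sup>2 = (ssin r * b)\<^sup>2 + w \<bullet> w"
    unfolding power2_norm_eq_inner using e w by (simp add: inner_simps inner_commute power2_eq_square)
  have 2: "(norm xs)\<^sup>2 = b\<^sup>2 + w \<bullet> w"
    unfolding power2_norm_eq_inner xs using e w by (simp add: inner_simps inner_commute power2_eq_square)
  show ?thesis
    unfolding U norm_Pair r_def[symmetric] e_def[symmetric] b_def[symmetric] real_norm_def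
    using 1 2 by (simp add: power_mult_distrib algebra_simps)
qed

section \<open>The gradient through derivatives of f and psi, and assembly of the theorem\<close>

lemma deriv_psiK_fK:
  assumes "\<bar>r\<bar> < pi"
  shows "deriv psiK r = dPK (r\<^sup>2) * (2 * r)"
    and "deriv fK r = 2 * r * PK (r\<^sup>2) + r\<^sup>2 * (dPK (r\<^sup>2) * (2 * r))"
proof -
  have S: "open {- pi<..<pi}" "r \<in> {- pi<..<pi}" using assms by auto
  note d = DERIV_PK_square[OF assms]
  have "(psiK has_real_derivative dPK (r\<^sup>2) * (2 * r)) (at r)"
    by (rule has_field_derivative_transform_within_open[OF d S]) (auto simp: psiK_eq_PK)
  then show "deriv psiK r = dPK (r\<^sup>2) * (2 * r)" by (rule DERIV_imp_deriv)
  have "((\<lambda>s. s\<^sup>2 * PK (s\<^sup>2)) has_real_derivative 2 * r * PK (r\<^sup>2) + dPK (r\<^sup>2) * (2 * r) * r\<^sup>2) (at r)"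
    by (rule DERIV_mult[OF _ d]) (auto intro!: derivative_eq_intros)
  then have "(fK has_real_derivative 2 * r * PK (r\<^sup>2) + dPK (r\<^sup>2) * (2 * r) * r\<^sup>2) (at r)"
    by (rule has_field_derivative_transform_within_open[OF _ S]) (auto simp: fK_eq_PK)
  then show "deriv fK r = 2 * r * PK (r\<^sup>2) + r\<^sup>2 * (dPK (r\<^sup>2) * (2 * r))"
    by (simp add: DERIV_imp_deriv mult.commute)
qed

lemma gradF_deriv_form:
  fixes \<theta> :: "real^'n"
  assumes "\<theta> \<in> OmegaK"
  shows "gradF x1 xs \<theta> = (deriv fK (norm \<theta>) / norm \<theta> * x1\<^sup>2) *\<^sub>R \<theta>
     + (deriv psiK (norm \<theta>) / norm \<theta> * (\<theta> \<bullet> xs)\<^sup>2) *\<^sub>R \<theta> + (2 * psiK (norm \<theta>) * (\<theta> \<bullet> xs)) *\<^sub>R xs"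
proof (cases "\<theta> = 0")
  case True
  \<comment> \<open>The quotients by \<open>norm \<theta>\<close> are 0 by convention, and every
    term carries a factor \<theta> or \<open>\<theta> \<bullet> xs\<close>, so both sides are
    0.\<close>
  then show ?thesis by (simp add: gradF_def)
next
  case False
  have r: "\<bar>norm \<theta>\<bar> < pi" using assms by (simp add: OmegaK_def)
  have q: "\<theta> \<bullet> \<theta> = (norm \<theta>)\<^sup>2" by (simp add: power2_norm_eq_inner)
  have 1: "deriv fK (norm \<theta>) / norm \<theta> = 2 * PK ((norm \<theta>)\<^sup>2) + 2 * (norm \<theta>)\<^sup>2 * dPK ((norm \<theta>)\<^sup>2)"
    unfolding deriv_psiK_fK(2)[OF r] using False by (simp add: add_divide_distrib)
  have 2: "deriv psiK (norm \<theta>) / norm \<theta> = 2 * dPK ((norm \<theta>)\<^sup>2)"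
    unfolding deriv_psiK_fK(1)[OF r] using False by simp
  show ?thesis unfolding gradF_def q 1 2 psiK_eq_PK[OF r] by (simp add: algebra_simps)
qed

lemma CutK_eq:
  assumes n2: "CARD('n::finite) \<ge> 2"
  shows "(CutK :: 'n Kpt set) = - MK"
proof
  show "CutK \<subseteq> - (MK :: 'n Kpt set)"
    using open_MK[OF n2] smooth_on_MK[OF n2] unfolding CutK_def by blast
  show "- (MK :: 'n Kpt set) \<subseteq> CutK"
    using ZK_subset_CutK[OF n2] MK_eq[OF n2] by auto
qed

lemma MK_unique_critical_point:
  fixes xs t :: "real^'n::finite"
  assumes n2: "CARD('n) \<ge> 2" and M: "(x1, xs, t) \<in> MK"
  shows "\<exists>!\<theta>. \<theta> \<in> OmegaK \<and> 4 *\<^sub>R t = gradF x1 xs \<theta>"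
proof -
  have "(x1, xs, t) \<in> expK ` WK" using M expK_image[OF n2] by simp
  then obtain w where w: "w \<in> WK" "expK w = (x1, xs, t)" by auto
  then have "fst w = x1" "fst (snd w) = xs" "t = (1/4) *\<^sub>R gradF (fst w) (fst (snd w)) (snd (snd w))"
    by (auto simp: expK_def)
  then have \<theta>: "snd (snd w) \<in> OmegaK" "4 *\<^sub>R t = gradF x1 xs (snd (snd w))" "x1 \<noteq> 0 \<or> snd (snd w) \<bullet> xs \<noteq> 0"
    using w(1) by (auto simp: WK_def)
  then show ?thesis using critical_point_unique[OF \<theta>(1,2) _ _ \<theta>(3)] by blast
qed

theorem theorem10p1:
  assumes n2: "CARD('n) \<ge> 2"
  shows
   "(\<forall>g :: ('n::finite) Kpt. (ccdist g)^2 = (SUP \<tau>\<in>OmegaK. phiK g \<tau>))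
  \<and> (CutK = - (MK :: ('n::finite) Kpt set)
     \<and> - (MK :: ('n::finite) Kpt set) = {(0, xs, t) | xs t.
          \<bar>xs \<bullet> t\<bar> \<le> (norm xs)^2 / sqrt pi * sqrt (norm (t - (t \<bullet> sgn xs) *\<^sub>R sgn xs))}
     \<and> (\<forall>t :: real^'n. (ccdist (0, 0, t))^2 = 4 * pi * norm t)
     \<and> (\<forall>(xs :: real^'n) t. (0, xs, t) \<in> - MK \<and> xs \<noteq> 0 \<longrightarrow>
          (ccdist (0, xs, t))^2 = (norm xs)^2 + 4 * pi * norm (t - (t \<bullet> sgn xs) *\<^sub>R sgn xs)))
  \<and> (\<forall>x1 (xs :: real^'n) t. (x1, xs, t) \<in> MK \<longrightarrow>
       (\<exists>!\<theta>. \<theta> \<in> OmegaK \<and>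
          ((\<lambda>\<sigma>. fK (norm \<sigma>) * x1^2 + psiK (norm \<sigma>) * (\<sigma> \<bullet> xs)^2)
             has_derivative (\<lambda>h. (4 *\<^sub>R t) \<bullet> h)) (at \<theta>))
     \<and> (\<forall>\<theta>. \<theta> \<in> OmegaK \<and>
          ((\<lambda>\<sigma>. fK (norm \<sigma>) * x1^2 + psiK (norm \<sigma>) * (\<sigma> \<bullet> xs)^2)
             has_derivative (\<lambda>h. (4 *\<^sub>R t) \<bullet> h)) (at \<theta>) \<longrightarrow>
          t = (1/4) *\<^sub>R ((deriv fK (norm \<theta>) / norm \<theta> * x1^2) *\<^sub>R \<theta>
                 + (deriv psiK (norm \<theta>) / norm \<theta> * (\<theta> \<bullet> xs)^2) *\<^sub>R \<theta>
                 + (2 * psiK (norm \<theta>) * (\<theta> \<bullet> xs)) *\<^sub>R xs)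
        \<and> (ccdist (x1, xs, t))^2 = phiK (x1, xs, t) \<theta>
        \<and> phiK (x1, xs, t) \<theta> = (ssin (norm \<theta>))^2 * x1^2 + (norm xs)^2
              + ((ssin (norm \<theta>))^2 - 1) * (xs \<bullet> sgn \<theta>)^2
        \<and> phiK (x1, xs, t) \<theta> = (norm (U_over_sinU \<theta> (x1, xs)))^2))"
proof -
  have Z: "- (MK :: 'n Kpt set) = ZK" using MK_eq[OF n2] by auto
  \<comment> \<open>Membership in \<open>OmegaK\<close> is part of the equivalence because the
    gradient formula holds only there; in this shape it rewrites both the uniqueness claim and the
    premises.\<close>
  have crit: "\<theta> \<in> OmegaK \<and> ((\<lambda>\<sigma>. fK (norm \<sigma>) * x1^2 + psiK (norm \<sigma>) * (\<sigma> \<bullet> xs)^2)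
        has_derivative (\<lambda>h. (4 *\<^sub>R t) \<bullet> h)) (at \<theta>) \<longleftrightarrow> \<theta> \<in> OmegaK \<and> 4 *\<^sub>R t = gradF x1 xs \<theta>"
    for x1 and xs t \<theta> :: "real^'n"
    using FK_critical_iff[of \<theta> x1 xs t] unfolding FK_def[abs_def] by blast
  show ?thesis
    unfolding crit
  proof (intro conjI allI impI, goal_cases)
    case (1 g)
    show ?case by (rule ccdist_eq_SUP)
  next
    case 2
    show ?case by (rule CutK_eq[OF n2])
  next
    case 3
    show ?case unfolding Z ZK_def tperp_def ..
  next
    case (4 t)
    have "(0, 0, t) \<in> ZK" by (simp add: ZK_def)
    from ZK_ccdist(1)[OF this] show ?case by (simp add: tperp_def)
  next
    case (5 xs t)
    then have "(0, xs, t) \<in> ZK" unfolding Z by blast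
    from ZK_ccdist(1)[OF this] show ?case by (simp add: tperp_def)
  next
    case (6 x1 xs t)
    then show ?case by (rule MK_unique_critical_point[OF n2])
  next
    case (7 x1 xs t \<theta>)
    then have \<theta>: "\<theta> \<in> OmegaK" "4 *\<^sub>R t = gradF x1 xs \<theta>" by auto
    have "t = (1/4) *\<^sub>R (4 *\<^sub>R t)" by simp
    then show ?case unfolding \<theta>(2) gradF_deriv_form[OF \<theta>(1)] .
  next
    case (8 x1 xs t \<theta>)
    then show ?case using critical_point_ccdist(2)[of \<theta> t x1 xs] by blast
  next
    case (9 x1 xs t \<theta>)
    then show ?case using critical_point_ccdist(3)[of \<theta> t x1 xs] by blast
  next
    case (10 x1 xs t \<theta>)
    then have \<theta>: "\<theta> \<in> OmegaK" "4 *\<^sub>R t = gradF x1 xs \<theta>" by auto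
    show ?case unfolding critical_point_ccdist(3)[OF \<theta>] norm_U_over_sinU[OF \<theta>(1)] ..
  qed
qed

end
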